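(* Each of the following planar quadratic differential systems in the variables $(z,y)$, with parameters $p,q$, has the indicated invariant curve $g=0$, of degree twelve and genus one, with cofactor $K=12y$. (i) $\dot z=zy+1$, $\ \dot y=3y^2+pzy+(-pq-2p^2)z^2+q$, with $$\begin{aligned} g={}&\tfrac{1}{36}p^6(q+2p^2)z^{12}+\tfrac12p\big(\tfrac13p^5q+\tfrac23p^6\big)z^{10}+\big(\tfrac13p^5q+\tfrac23p^6\big)yz^9\\ &+\Big(\tfrac12\big(\tfrac13qp^3+\tfrac53p^4\big)(-pq-2p^2)+\tfrac14p^2\big(\tfrac13qp^3+\tfrac53p^4\big)+\tfrac34p^5q+\tfrac32p^6\Big)z^8\\ &+p\big(\tfrac13qp^3+\tfrac53p^4\big)yz^7+\Big(\tfrac{17}{12}p\big(\tfrac13qp^3+\tfrac53p^4\big)+\big(\tfrac13qp^3+\tfrac53p^4\big)y^2+\tfrac14p^5\\ &\quad+\tfrac13\big(\tfrac13qp^3+\tfrac53p^4\big)q+\tfrac54p^3(-pq-2p^2)\Big)z^6+\Big(4p^4+\tfrac12qp^3+\tfrac32(-pq-2p^2)p^2\Big)yz^5\\ &+\Big(\tfrac{19}{16}qp^3+\tfrac{23}{8}p^4+\tfrac{89}{48}(-pq-2p^2)p^2+\tfrac14(-pq-2p^2)^2+3p^3y^2\Big)z^4\\ &+\Big(\big(qp^2+3p^3+\tfrac43p(-pq-2p^2)\big)y+2p^2y^3\Big)z^3\\ &+\Big(\tfrac{119}{120}qp^2+\tfrac{59}{120}p(-pq-2p^2)+\tfrac{59}{60}p^3+(-pq+p^2)y^2+\tfrac13(-pq-2p^2)q\Big)z^2\\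 &+\Big(2y^3p+\big(\tfrac23pq+\tfrac13p^2\big)y\Big)z+y^4+\big(\tfrac23q+\tfrac13p\big)y^2+\tfrac19q^2+\tfrac1{36}p^2+\tfrac19pq. \end{aligned}$$ (ii) $\dot z=zy+1$, $\ \dot y=3y^2-\tfrac{35}{19}qzy-\tfrac{525}{361}q^2z^2+q$, with $$\begin{aligned} g={}&\tfrac{16748046875}{271737008656}z^{12}q^8-\tfrac{3349609375}{7150973912}q^7z^{10}+\tfrac{95703125}{188183524}q^6yz^9+\tfrac{1003515625}{752734096}q^6z^8-\tfrac{7109375}{2476099}q^5yz^7\\ &+\Big(\tfrac{203125}{130321}q^4y^2-\tfrac{16765625}{9904396}q^5\Big)z^6+\tfrac{1396875}{260642}q^4yz^5+\Big(\tfrac{1638125}{2085136}q^4-\tfrac{39375}{6859}q^3y^2\Big)z^4\\ &+\Big(\tfrac{750}{361}q^2y^3-\tfrac{22625}{6859}q^3y\Big)z^3+\Big(\tfrac{155}{2888}q^3+\tfrac{1875}{361}q^2y^2\Big)z^2+\Big(-\tfrac{70}{19}qy^3-\tfrac{155}{1444}q^2y\Big)z\\ &-\tfrac{1}{5776}q^2+y^4+\tfrac1{19}qy^2. \end{aligned}$$ (iii) $\dot z=zy+1$, $\ \dot y=3y^2-\tfrac{10}{59}qzy-\tfrac{150}{3481}q^2z^2+q$, with $$\begin{aligned} g={}&-\tfrac{781250000}{50362840098282103}q^8z^{12}+\tfrac{312500000}{853607459292917}q^7z^{10}-\tfrac{62500000}{14467923038863}q^6yz^9-\tfrac{159375000}{14467923038863}q^6z^8\\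 &-\tfrac{3750000}{245219034557}q^5yz^7+\Big(\tfrac{375000}{4156254823}q^4y^2+\tfrac{230375000}{245219034557}q^5\Big)z^6-\tfrac{1425000}{593750689}q^4yz^5\\ &+\Big(-\tfrac{4215000}{70444997}q^3y^2-\tfrac{82923125}{4156254823}q^4\Big)z^4+\Big(\tfrac{5291500}{70444997}yq^3+\tfrac{281000}{1193983}y^3q^2\Big)z^3\\ &+\Big(\tfrac{210750}{1193983}q^2y^2+\tfrac{64980}{1193983}q^3\Big)z^2+\Big(-\tfrac{20}{59}qy^3-\tfrac{129960}{1193983}q^2y\Big)z+\tfrac{110592}{1193983}q^2+y^4+\tfrac{36}{59}qy^2. \end{aligned}$$ (iv) $\dot z=zy+1$, $\ \dot y=3y^2-\tfrac{55}{311}qzy+\tfrac{363}{96721}q^2z^2+q$, with $$\begin{aligned} g={}&\tfrac{78460709418025}{22403871730541898055936}q^8z^{12}+\tfrac{35663958826375}{36019086383507874688}q^7z^{10}-\tfrac{648435615025}{57908499008855104}yz^9q^6-\tfrac{10221703240485}{231633996035420416}q^6z^8\\ &+\tfrac{16076916075}{46550240360816}yq^5z^7+\Big(-\tfrac{292307565}{149679229456}q^4y^2-\tfrac{69082021195}{186200961443264}q^5\Big)z^6+\tfrac{611188545}{299358458912}q^4yz^5\\ &+\Big(-\tfrac{29164418129}{2394867671296}q^4-\tfrac{12078825}{240641848}q^3y^2\Big)z^4+\Big(\tfrac{73205}{386884}q^2y^3+\tfrac{23645215}{481283696}q^3y\Big)z^3\\ &+\Big(\tfrac{298023}{1547536}q^2y^2+\tfrac{689337}{12380288}q^3\Big)z^2+\Big(-\tfrac{110}{311}qy^3-\tfrac{689337}{6190144}yq^2\Big)z+\tfrac{189}{311}y^2q+\tfrac{2278125}{24760576}q^2+y^4.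 \end{aligned}$$ (v) $\dot z=zy+1$, $\ \dot y=3y^2-\tfrac{187}{107}qzy-\tfrac{8349}{11449}q^2z^2+q$, with $$\begin{aligned} g={}&\tfrac{1227125495297911}{274909788773107216}q^8z^{12}-\tfrac{82455072806579}{1284625181182744}q^7z^{10}+\tfrac{440936218217}{6002921407396}yz^9q^6+\tfrac{8241027180045}{24011685629584}z^8q^6\\ &-\tfrac{10932302931}{14025517307}yq^5z^7+\Big(-\tfrac{45176577061}{56102069228}q^5+\tfrac{58461513}{131079601}y^2q^4\Big)z^6+\tfrac{706852839}{262159202}yq^4z^5\\ &+\Big(\tfrac{1471610833}{2097273616}q^4-\tfrac{3733455}{1225043}y^2q^3\Big)z^4+\Big(\tfrac{13310}{11449}y^3q^2-\tfrac{3587045}{1225043}yq^3\Big)z^3\\ &+\Big(\tfrac{54087}{11449}q^2y^2+\tfrac{7623}{91592}q^3\Big)z^2+\Big(-\tfrac{7623}{45796}yq^2-\tfrac{374}{107}y^3q\Big)z+\tfrac{27}{183184}q^2+y^4+\tfrac{9}{107}qy^2. \end{aligned}$$ (vi) $\dot z=zy+1$, $\ \dot y=3y^2+qzy-q^2z^2-q$, with $$\begin{aligned} g={}&\big(\tfrac1{64}q^6p-\tfrac1{288}q^8\big)z^{12}+\big(\tfrac3{32}q^5p-\tfrac1{48}q^7\big)z^{10}+\big(-\tfrac1{24}yq^6+\tfrac3{16}yq^4p\big)z^9+\big(-\tfrac5{96}q^6+\tfrac{15}{64}q^4p\big)z^8\\ &+\big(\tfrac34yq^3p-\tfrac16yq^5\big)z^7+\big(\tfrac34y^2q^2p-\tfrac{13}{72}q^5+\tfrac5{16}q^3p-\tfrac16y^2q^4\big)z^6+\big(-\tfrac14q^4+\tfrac98q^2p\big)yz^5\\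 &+\big(-\tfrac{37}{96}q^4+\tfrac{15}{64}q^2p+\tfrac32y^2qp\big)z^4+\big(-\tfrac56yq^3+y^3p+\tfrac34yqp\big)z^3\\ &+\big(\tfrac3{32}qp+\tfrac34y^2p-\tfrac{17}{48}q^3+\tfrac12y^2q^2\big)z^2+\big(2y^3q+\tfrac3{16}yp-\tfrac{17}{24}yq^2\big)z+\tfrac1{64}p+y^4-\tfrac13y^2q-\tfrac1{288}q^2. \end{aligned}$$
   Context: For a polynomial differential system $\dot z=P(z,y)$, $\dot y=Q(z,y)$, an algebraic curve $g(z,y)=0$ (with $g$ a polynomial) is invariant with cofactor $K$, where $K$ is a polynomial, if $P\,\partial g/\partial z+Q\,\partial g/\partial y=K g$ identically. The degree of the curve is the total degree of $g$ in $(z,y)$; the genus is the genus of the algebraic curve $g=0$ in the usual sense. The system is quadratic if $\max(\deg P,\deg Q)=2$.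
   Formalization: In (i) the z^12 coefficient is corrected to p^6(q+2p)^2/36 and the genus is 0, not one (g is a square); degree and genus are claimed only for p≠0, q≠-2p in (i), q≠0 in (ii)-(v), and q≠0, p≠2q^2, 9p≠2q^2 in (vi), since the claim fails otherwise. *)

theory Defs
  imports
    "HOL-Computational_Algebra.Computational_Algebra"
    "HOL-Algebra.Algebraic_Closure_Type"
begin

section \<open>Bivariate polynomials and invariant curves\<close>

text \<open>A polynomial in \<open>z\<close> and \<open>y\<close> is a polynomial in \<open>y\<close> whose coefficients are polynomials in \<open>z\<close>.\<close>

type_synonym bpoly = "complex poly poly"

definition Z :: bpoly where "Z = [:[:0, 1:]:]"

definition Y :: bpoly where "Y = [:0, 1:]"

definition cst :: "complex \<Rightarrow> bpoly" where "cst c = [:[:c:]:]"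

definition pderiv_z :: "bpoly \<Rightarrow> bpoly" where "pderiv_z g = map_poly pderiv g"

definition pderiv_y :: "bpoly \<Rightarrow> bpoly" where "pderiv_y g = pderiv g"

definition total_degree :: "bpoly \<Rightarrow> nat" where
  "total_degree g = Max (insert 0 {i + j |i j. Polynomial.coeff (Polynomial.coeff g j) i \<noteq> 0})"

definition quadratic_system :: "bpoly \<Rightarrow> bpoly \<Rightarrow> bool" where
  "quadratic_system P Q \<longleftrightarrow> max (total_degree P) (total_degree Q) = 2"

definition invariant_curve :: "bpoly \<Rightarrow> bpoly \<Rightarrow> bpoly \<Rightarrow> bpoly \<Rightarrow> bool" where
  "invariant_curve P Q g K \<longleftrightarrow> P * pderiv_z g + Q * pderiv_y g = K * g"


section \<open>The genus of a plane curve\<close>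

text \<open>The universal domain: an algebraically closed field of transcendence degree one over the
  complex numbers. The function field of every irreducible plane curve embeds into it.\<close>

type_synonym udom = "complex poly fract alg_closure"

definition const :: "complex \<Rightarrow> udom" where "const c = to_ac (to_fract [:c:])"

definition eval2 :: "bpoly \<Rightarrow> udom \<Rightarrow> udom \<Rightarrow> udom" where
  "eval2 g x y = poly (map_poly (\<lambda>a. poly (map_poly const a) x) g) y"

text \<open>By the Nullstellensatz, the polynomials vanishing on the curve \<open>g = 0\<close> are those with a power
  divisible by \<open>g\<close>. A generic point is one that satisfies exactly these polynomials; it exists
  if and only if \<open>g\<close> is, up to a unit, a power of an irreducible polynomial.\<close>

definition generic_point :: "bpoly \<Rightarrow> udom \<Rightarrow> udom \<Rightarrow> bool" where
  "generic_point g x y \<longleftrightarrow> (\<forall>h. eval2 h x y = 0 \<longleftrightarrow> (\<exists>k. g dvd h ^ k))"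

definition function_field :: "udom \<Rightarrow> udom \<Rightarrow> udom set" where
  "function_field x y = {eval2 a x y / eval2 b x y |a b. eval2 b x y \<noteq> 0}"

text \<open>A place is given by its normalized discrete valuation, trivial on the constants. Outside the
  nonzero elements of \<open>F\<close> the value is fixed to be \<open>0\<close>, so that distinct functions are distinct
  places.\<close>

definition place :: "udom set \<Rightarrow> (udom \<Rightarrow> int) \<Rightarrow> bool" where
  "place F v \<longleftrightarrow>
     (\<forall>f. f \<notin> F - {0} \<longrightarrow> v f = 0) \<and>
     (\<forall>f\<in>F - {0}. \<forall>h\<in>F - {0}. v (f * h) = v f + v h) \<and>
     (\<forall>f\<in>F - {0}. \<forall>h\<in>F - {0}. f + h \<noteq> 0 \<longrightarrow> min (v f) (v h) \<le> v (f + h)) \<and>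
     (\<forall>c. v (const c) = 0) \<and>
     (\<exists>t\<in>F - {0}. v t = 1)"

definition divisor :: "udom set \<Rightarrow> ((udom \<Rightarrow> int) \<Rightarrow> int) \<Rightarrow> bool" where
  "divisor F D \<longleftrightarrow> finite {v. D v \<noteq> 0} \<and> (\<forall>v. D v \<noteq> 0 \<longrightarrow> place F v)"

text \<open>Every place has degree one, because the constant field is algebraically closed.\<close>

definition divisor_degree :: "((udom \<Rightarrow> int) \<Rightarrow> int) \<Rightarrow> int" where
  "divisor_degree D = (\<Sum>v | D v \<noteq> 0. D v)"

definition riemann_roch_space :: "udom set \<Rightarrow> ((udom \<Rightarrow> int) \<Rightarrow> int) \<Rightarrow> udom set" where
  "riemann_roch_space F D = {f \<in> F. f = 0 \<or> (\<forall>v. place F v \<longrightarrow> 0 \<le> v f + D v)}"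

definition riemann_roch_dim :: "udom set \<Rightarrow> ((udom \<Rightarrow> int) \<Rightarrow> int) \<Rightarrow> nat" where
  "riemann_roch_dim F D = vector_space.dim (\<lambda>c f. const c * f) (riemann_roch_space F D)"

text \<open>The genus of a function field is the maximum of \<open>deg D - l(D) + 1\<close> over all divisors \<open>D\<close>.\<close>

definition field_genus :: "udom set \<Rightarrow> nat \<Rightarrow> bool" where
  "field_genus F n \<longleftrightarrow>
     (\<forall>D. divisor F D \<longrightarrow> divisor_degree D - int (riemann_roch_dim F D) + 1 \<le> int n) \<and>
     (\<exists>D. divisor F D \<and> divisor_degree D - int (riemann_roch_dim F D) + 1 = int n)"

text \<open>The curve \<open>g = 0\<close> is irreducible of genus \<open>n\<close>. The function fields of any two generic points
  are isomorphic over the constants, so the choice is immaterial.\<close>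

definition curve_genus :: "bpoly \<Rightarrow> nat \<Rightarrow> bool" where
  "curve_genus g n \<longleftrightarrow> (\<exists>x y. generic_point g x y \<and> field_genus (function_field x y) n)"


section \<open>The curves\<close>

text \<open>The source prints \<open>q + 2 p\<^sup>2\<close> for the factor \<open>(q + 2 p)\<^sup>2\<close> of the first coefficient of
  \<open>g_i\<close>. With that value the curve is not invariant; the value below is the only one for which it
  is. Then \<open>g_i\<close> is the square of
    \<open>y\<^sup>2 + (p\<^sup>2 z\<^sup>3 + p z) y + p\<^sup>3 (q + 2 p) z\<^sup>6 / 6 + p\<^sup>3 z\<^sup>4 / 2 - p q z\<^sup>2 / 2 + (2 q + p) / 6\<close>,
  whose discriminant in \<open>y\<close> is \<open>- (p + 2 q) (p z\<^sup>2 - 1)\<^sup>2 (p z\<^sup>2 + 2) / 3\<close>. For \<open>p \<noteq> 0\<close> the curve is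
  therefore rational, so its genus is \<open>0\<close> and not the claimed \<open>1\<close>.\<close>

definition g_i :: "complex \<Rightarrow> complex \<Rightarrow> bpoly" where
  "g_i p q =
     cst (1/36 * p^6 * (q + 2 * p)^2) * Z^12
   + cst (1/2 * p * (1/3 * p^5 * q + 2/3 * p^6)) * Z^10
   + cst (1/3 * p^5 * q + 2/3 * p^6) * Y * Z^9
   + cst (1/2 * (1/3 * q * p^3 + 5/3 * p^4) * (- p * q - 2 * p^2)
       + 1/4 * p^2 * (1/3 * q * p^3 + 5/3 * p^4) + 3/4 * p^5 * q + 3/2 * p^6) * Z^8
   + cst (p * (1/3 * q * p^3 + 5/3 * p^4)) * Y * Z^7
   + (cst (17/12 * p * (1/3 * q * p^3 + 5/3 * p^4)) + cst (1/3 * q * p^3 + 5/3 * p^4) * Y^2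
       + cst (1/4 * p^5 + 1/3 * (1/3 * q * p^3 + 5/3 * p^4) * q +
         5/4 * p^3 * (- p * q - 2 * p^2))) * Z^6
   + cst (4 * p^4 + 1/2 * q * p^3 + 3/2 * (- p * q - 2 * p^2) * p^2) * Y * Z^5
   + (cst (19/16 * q * p^3 + 23/8 * p^4 + 89/48 * (- p * q - 2 * p^2) * p^2
       + 1/4 * (- p * q - 2 * p^2)^2) + cst (3 * p^3) * Y^2) * Z^4
   + (cst (q * p^2 + 3 * p^3 + 4/3 * p * (- p * q - 2 * p^2)) * Y + cst (2 * p^2) * Y^3) * Z^3
   + (cst (119/120 * q * p^2 + 59/120 * p * (- p * q - 2 * p^2) + 59/60 * p^3)
       + cst (- p * q + p^2) * Y^2 + cst (1/3 * (- p * q - 2 * p^2) * q)) * Z^2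
   + (cst (2 * p) * Y^3 + cst (2/3 * p * q + 1/3 * p^2) * Y) * Z
   + Y^4
   + cst (2/3 * q + 1/3 * p) * Y^2
   + cst (1/9 * q^2 + 1/36 * p^2 + 1/9 * p * q)"

definition g_ii :: "complex \<Rightarrow> bpoly" where
  "g_ii q =
     cst (16748046875/271737008656 * q^8) * Z^12
   - cst (3349609375/7150973912 * q^7) * Z^10
   + cst (95703125/188183524 * q^6) * Y * Z^9
   + cst (1003515625/752734096 * q^6) * Z^8
   - cst (7109375/2476099 * q^5) * Y * Z^7
   + (cst (203125/130321 * q^4) * Y^2 - cst (16765625/9904396 * q^5)) * Z^6
   + cst (1396875/260642 * q^4) * Y * Z^5
   + (cst (1638125/2085136 * q^4) - cst (39375/6859 * q^3) * Y^2) * Z^4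
   + (cst (750/361 * q^2) * Y^3 - cst (22625/6859 * q^3) * Y) * Z^3
   + (cst (155/2888 * q^3) + cst (1875/361 * q^2) * Y^2) * Z^2
   + (- cst (70/19 * q) * Y^3 - cst (155/1444 * q^2) * Y) * Z
   - cst (1/5776 * q^2)
   + Y^4
   + cst (1/19 * q) * Y^2"

definition g_iii :: "complex \<Rightarrow> bpoly" where
  "g_iii q =
   - cst (781250000/50362840098282103 * q^8) * Z^12
   + cst (312500000/853607459292917 * q^7) * Z^10
   - cst (62500000/14467923038863 * q^6) * Y * Z^9
   - cst (159375000/14467923038863 * q^6) * Z^8
   - cst (3750000/245219034557 * q^5) * Y * Z^7
   + (cst (375000/4156254823 * q^4) * Y^2 + cst (230375000/245219034557 * q^5)) * Z^6
   - cst (1425000/593750689 * q^4) * Y * Z^5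
   + (- cst (4215000/70444997 * q^3) * Y^2 - cst (82923125/4156254823 * q^4)) * Z^4
   + (cst (5291500/70444997 * q^3) * Y + cst (281000/1193983 * q^2) * Y^3) * Z^3
   + (cst (210750/1193983 * q^2) * Y^2 + cst (64980/1193983 * q^3)) * Z^2
   + (- cst (20/59 * q) * Y^3 - cst (129960/1193983 * q^2) * Y) * Z
   + cst (110592/1193983 * q^2)
   + Y^4
   + cst (36/59 * q) * Y^2"

definition g_iv :: "complex \<Rightarrow> bpoly" where
  "g_iv q =
     cst (78460709418025/22403871730541898055936 * q^8) * Z^12
   + cst (35663958826375/36019086383507874688 * q^7) * Z^10
   - cst (648435615025/57908499008855104 * q^6) * Y * Z^9
   - cst (10221703240485/231633996035420416 * q^6) * Z^8
   + cst (16076916075/46550240360816 * q^5) * Y * Z^7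
   + (- cst (292307565/149679229456 * q^4) * Y^2 - cst (69082021195/186200961443264 * q^5)) * Z^6
   + cst (611188545/299358458912 * q^4) * Y * Z^5
   + (- cst (29164418129/2394867671296 * q^4) - cst (12078825/240641848 * q^3) * Y^2) * Z^4
   + (cst (73205/386884 * q^2) * Y^3 + cst (23645215/481283696 * q^3) * Y) * Z^3
   + (cst (298023/1547536 * q^2) * Y^2 + cst (689337/12380288 * q^3)) * Z^2
   + (- cst (110/311 * q) * Y^3 - cst (689337/6190144 * q^2) * Y) * Z
   + cst (189/311 * q) * Y^2
   + cst (2278125/24760576 * q^2)
   + Y^4"

definition g_v :: "complex \<Rightarrow> bpoly" where
  "g_v q =
     cst (1227125495297911/274909788773107216 * q^8) * Z^12
   - cst (82455072806579/1284625181182744 * q^7) * Z^10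
   + cst (440936218217/6002921407396 * q^6) * Y * Z^9
   + cst (8241027180045/24011685629584 * q^6) * Z^8
   - cst (10932302931/14025517307 * q^5) * Y * Z^7
   + (- cst (45176577061/56102069228 * q^5) + cst (58461513/131079601 * q^4) * Y^2) * Z^6
   + cst (706852839/262159202 * q^4) * Y * Z^5
   + (cst (1471610833/2097273616 * q^4) - cst (3733455/1225043 * q^3) * Y^2) * Z^4
   + (cst (13310/11449 * q^2) * Y^3 - cst (3587045/1225043 * q^3) * Y) * Z^3
   + (cst (54087/11449 * q^2) * Y^2 + cst (7623/91592 * q^3)) * Z^2
   + (- cst (7623/45796 * q^2) * Y - cst (374/107 * q) * Y^3) * Z
   + cst (27/183184 * q^2)
   + Y^4
   + cst (9/107 * q) * Y^2"

definition g_vi :: "complex \<Rightarrow> complex \<Rightarrow> bpoly" where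
  "g_vi p q =
     cst (1/64 * q^6 * p - 1/288 * q^8) * Z^12
   + cst (3/32 * q^5 * p - 1/48 * q^7) * Z^10
   + (- cst (1/24 * q^6) * Y + cst (3/16 * q^4 * p) * Y) * Z^9
   + cst (- 5/96 * q^6 + 15/64 * q^4 * p) * Z^8
   + (cst (3/4 * q^3 * p) * Y - cst (1/6 * q^5) * Y) * Z^7
   + (cst (3/4 * q^2 * p) * Y^2 - cst (13/72 * q^5 - 5/16 * q^3 * p)
       - cst (1/6 * q^4) * Y^2) * Z^6
   + cst (- 1/4 * q^4 + 9/8 * q^2 * p) * Y * Z^5
   + (cst (- 37/96 * q^4 + 15/64 * q^2 * p) + cst (3/2 * q * p) * Y^2) * Z^4
   + (- cst (5/6 * q^3) * Y + cst p * Y^3 + cst (3/4 * q * p) * Y) * Z^3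
   + (cst (3/32 * q * p) + cst (3/4 * p) * Y^2 - cst (17/48 * q^3) + cst (1/2 * q^2) * Y^2) * Z^2
   + (cst (2 * q) * Y^3 + cst (3/16 * p) * Y - cst (17/24 * q^2) * Y) * Z
   + cst (1/64 * p)
   + Y^4
   - cst (1/3 * q) * Y^2
   - cst (1/288 * q^2)"

end

theory Submission
  imports Defs
begin

text \<open>A double cover \<open>s\<^sup>2 = f(t)\<close> of the line branched at infinity, with \<open>f\<close> squarefree of degree
  \<open>2 g + 1\<close>, has genus \<open>g\<close>. Its places are those over the points of the affine curve, realised by
  Laurent expansions, and one place \<open>\<infinity>\<close>. Dividing by \<open>t - c\<close> moves every divisor to a multiple of \<open>\<infinity>\<close>
  without decreasing its defect \<open>deg D - l(D)\<close>, and for multiples of \<open>\<infinity>\<close> the functions \<open>t\<^sup>i\<close> and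
  \<open>s t\<^sup>j\<close> give Riemann's inequality. It is attained at \<open>2 g \<infinity>\<close>, because a function without finite
  poles is a polynomial in \<open>t\<close> and \<open>s\<close>.

  Each of the curves is birational to such a double cover, by \<open>z = Q(t) / s\<close> and
  \<open>y = M(t) / s\<^sup>3\<close>. That the polynomial is irreducible, up to a power in the first case, follows by
  counting the points over one value of \<open>z\<close>. The identities are checked at complex points and
  transferred to the function field.\<close>

section \<open>Evaluation of polynomials along ring homomorphisms\<close>

text \<open>The genus is a maximum over all divisors, so exhibiting some places is not enough: an
  arbitrary place has to be controlled. Its residue field must be the complex numbers, only one
  place may have a pole of \<open>t\<close>, and the places over a value of \<open>t\<close> must be
  at most those given by expansions. Residues come from the quadratic equation over C(t) that every
  element satisfies; uniqueness comes from parity at a branch point and from the norm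
  \<open>a^2 - f * b^2\<close> elsewhere. The curves are approached from the cover. A point
  \<open>(z, y)\<close> is written down in the field of an abstract cover, and it generates that
  field because \<open>t\<close> is a rational function of \<open>z\<close> and \<open>y\<close>.
  The singularities of the curve of degree twelve never have to be analysed. The curves of genus one
  lead to covers with four finite branch points, one of which is moved to infinity.\<close>

locale hom_ring =
  fixes h :: "'r::comm_ring_1 \<Rightarrow> 'a::comm_ring_1"
  assumes hom_add: "h (a + b) = h a + h b"
    and hom_mult: "h (a * b) = h a * h b"
    and hom_one: "h 1 = 1"
begin

lemma hom_zero: "h 0 = 0"
  using hom_add[of 0 0] by simp

lemma hom_uminus: "h (- a) = - h a"
  using hom_add[of a "- a"] hom_zero by (simp add: minus_unique)

lemma hom_diff: "h (a - b) = h a - h b"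
  using hom_add[of a "- b"] hom_uminus by simp

lemma hom_power: "h (a ^ n) = h a ^ n"
  by (induction n) (simp_all add: hom_one hom_mult)

lemma hom_numeral: "h (numeral n) = numeral n"
proof -
  have "h (of_nat m) = of_nat m" for m
    by (induction m) (simp_all add: hom_zero hom_one hom_add)
  from this[of "numeral n"] show ?thesis by simp
qed

lemmas homs = hom_zero hom_one hom_add hom_mult hom_uminus hom_diff hom_power hom_numeral

end

text \<open>One evaluation scheme serves every target: the identity for complex points,
  \<open>const\<close> for the universal domain, \<open>fps_const\<close> and
  \<open>fls_const\<close> for expansions.\<close>

definition eval_by :: "('r::comm_ring_1 \<Rightarrow> 'a::comm_ring_1) \<Rightarrow> 'r poly \<Rightarrow> 'a \<Rightarrow> 'a" where
  "eval_by h p x = poly (map_poly h p) x"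

context hom_ring
begin

lemma eval_by_0 [simp]: "eval_by h 0 x = 0"
  by (simp add: eval_by_def)

lemma eval_by_pCons: "eval_by h (pCons a p) x = h a + x * eval_by h p x"
  using hom_zero by (simp add: eval_by_def map_poly_pCons)

lemma eval_by_add: "eval_by h (p + q) x = eval_by h p x + eval_by h q x"
proof (induction p arbitrary: q)
  case (pCons a p)
  obtain b r where "q = pCons b r" by (cases q)
  then show ?case
    using pCons(2)[of r] by (simp add: eval_by_pCons hom_add algebra_simps)
qed simp

lemma eval_by_smult: "eval_by h (smult a p) x = h a * eval_by h p x"
  by (induction p) (simp_all add: eval_by_pCons hom_mult algebra_simps)

lemma eval_by_mult: "eval_by h (p * q) x = eval_by h p x * eval_by h q x"
  by (induction p) (simp_all add: eval_by_pCons eval_by_add eval_by_smult hom_zero algebra_simps)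

lemma hom_ring_eval_by: "hom_ring (\<lambda>p. eval_by h p x)"
  by unfold_locales (simp_all add: eval_by_add eval_by_mult one_pCons eval_by_pCons hom_one)

lemma eval_by_diff: "eval_by h (p - q) x = eval_by h p x - eval_by h q x"
  and eval_by_uminus: "eval_by h (- p) x = - eval_by h p x"
  and eval_by_power: "eval_by h (p ^ n) x = eval_by h p x ^ n"
  and eval_by_1: "eval_by h 1 x = 1"
  and eval_by_numeral: "eval_by h (numeral k) x = numeral k"
  using hom_ring.homs[OF hom_ring_eval_by] by auto

lemma eval_by_monom: "eval_by h (Polynomial.monom c n) x = h c * x ^ n"
  by (induction n) (simp_all add: monom_0 monom_Suc eval_by_pCons hom_zero algebra_simps)

lemma eval_by_sum: "eval_by h (sum f A) x = (\<Sum>a\<in>A. eval_by h (f a) x)"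
  by (induction A rule: infinite_finite_induct) (simp_all add: eval_by_add)

end

definition eval2_by :: "(complex \<Rightarrow> 'a::comm_ring_1) \<Rightarrow> bpoly \<Rightarrow> 'a \<Rightarrow> 'a \<Rightarrow> 'a" where
  "eval2_by h g x y = eval_by (\<lambda>a. eval_by h a x) g y"

lemma eval2_eq: "eval2 g x y = eval2_by const g x y"
  by (simp add: eval2_def eval2_by_def eval_by_def)

locale hom_complex = hom_ring h for h :: "complex \<Rightarrow> 'a::comm_ring_1"
begin

sublocale inner: hom_ring "\<lambda>p. eval_by h p x" for x
  by (rule hom_ring_eval_by)

sublocale outer: hom_ring "\<lambda>g. eval2_by h g x y" for x y
  unfolding eval2_by_def by (rule inner.hom_ring_eval_by)

lemma eval2_by_pCons: "eval2_by h (pCons a g) x y = eval_by h a x + y * eval2_by h g x y"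
  by (simp add: eval2_by_def inner.eval_by_pCons)

lemma eval2_by_Z: "eval2_by h Z x y = x"
  by (simp add: Z_def eval2_by_def inner.eval_by_pCons eval_by_pCons hom_zero hom_one)

lemma eval2_by_Y: "eval2_by h Y x y = y"
  by (simp add: Y_def eval2_by_def inner.eval_by_pCons eval_by_1)

lemma eval2_by_cst: "eval2_by h (cst c) x y = h c"
  by (simp add: cst_def eval2_by_def inner.eval_by_pCons eval_by_pCons)

lemmas eval2_by_simps = outer.homs eval2_by_Z eval2_by_Y eval2_by_cst

end

lemma const_add: "const (a + b) = const a + const b"
  unfolding const_def to_ac_add[symmetric] to_fract_add[symmetric] by simp

lemma const_mult: "const (a * b) = const a * const b"
  unfolding const_def to_ac_mult[symmetric] to_fract_mult[symmetric] by simp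

lemma const_1 [simp]: "const 1 = 1"
  by (simp add: const_def flip: one_pCons)

interpretation const: hom_complex const
  by unfold_locales (simp_all add: const_add const_mult)

interpretation ident: hom_complex "\<lambda>c::complex. c"
  by unfold_locales simp_all

lemma const_0 [simp]: "const 0 = 0"
  by (rule const.hom_zero)

lemma const_eq_0_iff [simp]: "const c = 0 \<longleftrightarrow> c = 0"
  by (simp add: const_def)

lemma const_inverse: "const (inverse c) = inverse (const c)"
proof (cases "c = 0")
  case False
  then have "const c * const (inverse c) = 1"
    by (simp flip: const_mult)
  then show ?thesis by (metis inverse_unique)
qed simp

lemma eval_by_ident [simp]: "eval_by (\<lambda>c. c) p x = poly p x"
  by (simp add: eval_by_def)

text \<open>An element outside the image of the complex numbers is transcendental, because the complex
  numbers are algebraically closed.\<close>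

lemma eval_by_eq_0_iff:
  fixes h :: "complex \<Rightarrow> 'a::idom"
  assumes h: "hom_complex h" and inj: "\<And>c. h c = 0 \<Longrightarrow> c = 0" and x: "x \<notin> range h"
  shows "eval_by h p x = 0 \<longleftrightarrow> p = 0"
proof
  interpret hom_complex h by (rule h)
  show "eval_by h p x = 0 \<Longrightarrow> p = 0"
  proof (induction "Polynomial.degree p" arbitrary: p)
    case 0
    then obtain c where "p = [:c:]" by (metis degree_eq_zeroE)
    then show ?case using 0 inj by (simp add: eval_by_pCons)
  next
    case (Suc n)
    then have "\<not> constant (poly p)" by (simp add: constant_degree)
    then obtain c where "poly p c = 0" using fundamental_theorem_of_algebra by blast
    then obtain r where r: "p = [:- c, 1:] * r" by (auto simp: poly_eq_0_iff_dvd)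
    with Suc.hyps(2) have "r \<noteq> 0" by auto
    then have "Polynomial.degree p = Suc (Polynomial.degree r)"
      unfolding r by (subst degree_mult_eq) auto
    with Suc.hyps(2) have "n = Polynomial.degree r" by simp
    moreover have "eval_by h [:- c, 1:] x = x - h c"
      by (simp add: eval_by_pCons hom_uminus hom_one)
    with x have "eval_by h [:- c, 1:] x \<noteq> 0" by auto
    with Suc.prems have "eval_by h r x = 0" unfolding r eval_by_mult by simp
    ultimately show ?case using Suc.hyps(1) \<open>r \<noteq> 0\<close> by blast
  qed
qed (simp add: eval_by_def)

section \<open>Subfields containing the constants\<close>

locale const_subfield =
  fixes F :: "udom set"
  assumes const_in [simp]: "const c \<in> F"
    and add_in [simp]: "a \<in> F \<Longrightarrow> b \<in> F \<Longrightarrow> a + b \<in> F"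
    and mult_in [simp]: "a \<in> F \<Longrightarrow> b \<in> F \<Longrightarrow> a * b \<in> F"
    and inverse_in [simp]: "a \<in> F \<Longrightarrow> inverse a \<in> F"
begin

lemma zero_in [simp]: "0 \<in> F" and one_in [simp]: "1 \<in> F"
  using const_in[of 0] const_in[of 1] by simp_all

lemma uminus_in [simp]: "a \<in> F \<Longrightarrow> - a \<in> F"
  using mult_in[OF const_in[of "- 1"], of a] by (simp add: const.hom_uminus)

lemma diff_in [simp]: "a \<in> F \<Longrightarrow> b \<in> F \<Longrightarrow> a - b \<in> F"
  using add_in[of a "- b"] by simp

lemma divide_in [simp]: "a \<in> F \<Longrightarrow> b \<in> F \<Longrightarrow> a / b \<in> F"
  using mult_in[of a "inverse b"] by (simp add: field_class.field_divide_inverse)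

lemma power_in [simp]: "a \<in> F \<Longrightarrow> a ^ n \<in> F"
  by (induction n) simp_all

lemma eval_by_in [simp]: "x \<in> F \<Longrightarrow> eval_by const p x \<in> F"
  by (induction p) (simp_all add: const.eval_by_pCons)

lemma eval2_in [simp]: "x \<in> F \<Longrightarrow> y \<in> F \<Longrightarrow> eval2 g x y \<in> F"
  unfolding eval2_eq by (induction g) (simp_all add: const.eval2_by_pCons const.outer.hom_zero)

lemma function_field_subset: "x \<in> F \<Longrightarrow> y \<in> F \<Longrightarrow> function_field x y \<subseteq> F"
  by (auto simp: function_field_def)

end

lemma const_subfield_function_field: "const_subfield (function_field x y)"
proof
  show "const c \<in> function_field x y" for c
    unfolding function_field_def
    by (rule CollectI, rule exI[of _ "cst c"], rule exI[of _ 1])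
       (simp add: eval2_eq const.eval2_by_simps)
next
  fix a b assume "a \<in> function_field x y" "b \<in> function_field x y"
  then obtain a1 a2 b1 b2 where
    *: "a = eval2 a1 x y / eval2 a2 x y" "b = eval2 b1 x y / eval2 b2 x y"
       "eval2 a2 x y \<noteq> 0" "eval2 b2 x y \<noteq> 0"
    by (auto simp: function_field_def)
  have "a + b = eval2 (a1 * b2 + b1 * a2) x y / eval2 (a2 * b2) x y"
    using * by (simp add: eval2_eq const.eval2_by_simps add_frac_eq)
  moreover have "a * b = eval2 (a1 * b1) x y / eval2 (a2 * b2) x y"
    using * by (simp add: eval2_eq const.eval2_by_simps)
  moreover have "eval2 (a2 * b2) x y \<noteq> 0"
    using * by (simp add: eval2_eq const.eval2_by_simps)
  ultimately show "a + b \<in> function_field x y" "a * b \<in> function_field x y"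
    by (auto simp: function_field_def)
next
  fix a assume "a \<in> function_field x y"
  then obtain a1 a2 where *: "a = eval2 a1 x y / eval2 a2 x y" "eval2 a2 x y \<noteq> 0"
    by (auto simp: function_field_def)
  show "inverse a \<in> function_field x y"
  proof (cases "eval2 a1 x y = 0")
    case True
    then have "inverse a = eval2 0 x y / eval2 1 x y" "eval2 1 x y \<noteq> 0"
      using * by (simp_all add: eval2_eq const.eval2_by_simps)
    then show ?thesis by (auto simp: function_field_def)
  next
    case False
    then have "inverse a = eval2 a2 x y / eval2 a1 x y" using * by simp
    then show ?thesis using False by (auto simp: function_field_def)
  qed
qed

lemma generators_in_function_field: "x \<in> function_field x y" "y \<in> function_field x y"
  unfolding function_field_def
  by (rule CollectI, rule exI[of _ Z], rule exI[of _ 1], simp add: eval2_eq const.eval2_by_simps,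
      rule CollectI, rule exI[of _ Y], rule exI[of _ 1], simp add: eval2_eq const.eval2_by_simps)

lemma function_field_eqI:
  assumes "x \<in> function_field t s" "y \<in> function_field t s"
    and "t \<in> function_field x y" "s \<in> function_field x y"
  shows "function_field x y = function_field t s"
  using assms const_subfield.function_field_subset[OF const_subfield_function_field] by blast

section \<open>Places\<close>

locale function_place = const_subfield F for F +
  fixes v :: "udom \<Rightarrow> int"
  assumes place: "place F v"
begin

lemma v_mult: "f \<in> F \<Longrightarrow> h \<in> F \<Longrightarrow> f \<noteq> 0 \<Longrightarrow> h \<noteq> 0 \<Longrightarrow> v (f * h) = v f + v h"
  using place by (auto simp: place_def)

lemma v_const [simp]: "v (const c) = 0"
  using place by (auto simp: place_def)

lemma v_outside: "f \<notin> F \<or> f = 0 \<Longrightarrow> v f = 0"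
  using place by (auto simp: place_def)

lemma v_0 [simp]: "v 0 = 0" and v_1 [simp]: "v 1 = 0"
  using v_const[of 0] v_const[of 1] by simp_all

lemma v_add: "f \<in> F \<Longrightarrow> h \<in> F \<Longrightarrow> f \<noteq> 0 \<Longrightarrow> h \<noteq> 0 \<Longrightarrow> f + h \<noteq> 0 \<Longrightarrow> min (v f) (v h) \<le> v (f + h)"
  using place by (auto simp: place_def)

lemma v_uminus: "f \<in> F \<Longrightarrow> v (- f) = v f"
  using v_mult[of "const (- 1)" f] v_const[of "- 1"]
  by (cases "f = 0") (simp_all add: const.hom_uminus)

lemma v_inverse: "f \<in> F \<Longrightarrow> v (inverse f) = - v f"
  using v_mult[of f "inverse f"] by (cases "f = 0") simp_all

lemma v_divide: "f \<in> F \<Longrightarrow> h \<in> F \<Longrightarrow> f \<noteq> 0 \<Longrightarrow> h \<noteq> 0 \<Longrightarrow> v (f / h) = v f - v h"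
  by (simp add: field_class.field_divide_inverse v_mult v_inverse)

lemma v_power: "f \<in> F \<Longrightarrow> v (f ^ n) = int n * v f"
proof (cases "f = 0")
  case False
  then show "f \<in> F \<Longrightarrow> ?thesis" by (induction n) (simp_all add: v_mult algebra_simps)
qed (simp add: power_0_left)

lemma uniformizer: obtains u where "u \<in> F" "u \<noteq> 0" "v u = 1"
  using place by (auto simp: place_def)

text \<open>Zero counts as having infinite value. A place assigns it 0, so plain bounds on
  \<open>v\<close> would fail for sums that vanish.\<close>

definition vge :: "int \<Rightarrow> udom \<Rightarrow> bool" where
  "vge n f \<longleftrightarrow> f = 0 \<or> n \<le> v f"

lemma vge_0 [simp]: "vge n 0"
  by (simp add: vge_def)

lemma vge_add: "f \<in> F \<Longrightarrow> h \<in> F \<Longrightarrow> vge n f \<Longrightarrow> vge n h \<Longrightarrow> vge n (f + h)"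
  using v_add[of f h] by (cases "f = 0"; cases "h = 0"; cases "f + h = 0") (auto simp: vge_def)

lemma vge_uminus: "f \<in> F \<Longrightarrow> vge n (- f) \<longleftrightarrow> vge n f"
  by (simp add: vge_def v_uminus)

lemma vge_diff: "f \<in> F \<Longrightarrow> h \<in> F \<Longrightarrow> vge n f \<Longrightarrow> vge n h \<Longrightarrow> vge n (f - h)"
  using vge_add[of f "- h"] by (simp add: vge_uminus)

lemma vge_mult: "f \<in> F \<Longrightarrow> h \<in> F \<Longrightarrow> vge m f \<Longrightarrow> vge n h \<Longrightarrow> vge (m + n) (f * h)"
  by (cases "f = 0"; cases "h = 0") (auto simp: vge_def v_mult)

lemma vge_mono: "vge n f \<Longrightarrow> m \<le> n \<Longrightarrow> vge m f"
  by (auto simp: vge_def)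

lemma vge_const [simp]: "vge 0 (const c)"
  by (simp add: vge_def)

text \<open>If \<open>h\<close> has the larger value, then \<open>f = (f + h) - h\<close> prevents
  \<open>f + h\<close> from having a value above \<open>v f\<close>.\<close>

lemma v_add_dominant:
  assumes "f \<in> F" "h \<in> F" "f \<noteq> 0" "h = 0 \<or> v f < v h"
  shows "f + h \<noteq> 0" "v (f + h) = v f"
proof -
  show ne: "f + h \<noteq> 0"
    using assms v_uminus[of h] by (metis add_eq_0_iff2 add_0_right less_irrefl)
  show "v (f + h) = v f"
  proof (cases "h = 0")
    case False
    then have "min (v f) (v h) \<le> v (f + h)" using assms ne v_add by blast
    moreover have "min (v (f + h)) (v (- h)) \<le> v (f + h + - h)"
      using assms ne False by (intro v_add) auto
    ultimately show ?thesis using assms False by (simp add: v_uminus)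
  qed simp
qed

text \<open>\<open>c\<close> is the residue of \<open>f\<close>. Residues play the role of values of
  functions at points of the curve.\<close>

definition has_value :: "udom \<Rightarrow> complex \<Rightarrow> bool" where
  "has_value f c \<longleftrightarrow> f \<in> F \<and> vge 1 (f - const c)"

lemma has_value_const [simp]: "has_value (const c) c"
  by (simp add: has_value_def)

lemma has_value_vge: "has_value f c \<Longrightarrow> vge 0 f"
  using vge_add[of "f - const c" "const c" 0] vge_mono[of 1 "f - const c" 0]
  by (auto simp: has_value_def)

lemma has_value_add: "has_value f a \<Longrightarrow> has_value h b \<Longrightarrow> has_value (f + h) (a + b)"
  using vge_add[of "f - const a" "h - const b" 1]
  by (simp add: has_value_def const.homs algebra_simps)

lemma has_value_mult:
  assumes "has_value f a" "has_value h b" shows "has_value (f * h) (a * b)"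
proof -
  have "vge (1 + 0) ((f - const a) * h)" "vge (0 + 1) (const a * (h - const b))"
    using assms by (intro vge_mult; simp add: has_value_def has_value_vge[OF assms(2)])+
  then have "vge 1 ((f - const a) * h + const a * (h - const b))"
    using assms by (intro vge_add) (auto simp: has_value_def)
  then show ?thesis
    using assms by (simp add: has_value_def const.homs algebra_simps)
qed

lemma has_value_nonzero: "has_value f c \<Longrightarrow> c \<noteq> 0 \<Longrightarrow> f \<noteq> 0 \<and> v f = 0"
  using v_add_dominant[of "const c" "f - const c"] by (auto simp: has_value_def vge_def)

lemma has_value_unique:
  assumes "has_value f a" "has_value f b" shows "a = b"
proof (rule ccontr)
  assume "a \<noteq> b"
  have "has_value (f + const (- 1) * f) (a + - 1 * b)"
    by (intro has_value_add has_value_mult assms has_value_const)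
  with has_value_nonzero[OF this] \<open>a \<noteq> b\<close> show False by (simp add: const.homs)
qed

lemma has_value_inverse:
  assumes "has_value f a" "a \<noteq> 0" shows "has_value (inverse f) (inverse a)"
proof -
  have f: "f \<noteq> 0" "v f = 0" "f \<in> F" and a: "vge 1 (f - const a)"
    using has_value_nonzero[OF assms] assms(1) by (auto simp: has_value_def)
  have "vge (1 + 0) ((f - const a) * (- (inverse f * const (inverse a))))"
    using f a assms(2) by (intro vge_mult) (auto simp: vge_def v_uminus v_mult v_inverse)
  moreover have "(f - const a) * (- (inverse f * const (inverse a))) = inverse f - const (inverse a)"
    using f assms(2) by (simp add: const_inverse algebra_simps del: inverse_eq_divide)
  ultimately show ?thesis using f by (simp add: has_value_def)
qed

lemma has_value_divide:
  "has_value f a \<Longrightarrow> has_value h b \<Longrightarrow> b \<noteq> 0 \<Longrightarrow> has_value (f / h) (a / b)"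
  using has_value_mult[OF _ has_value_inverse] by (simp add: field_class.field_divide_inverse)

lemma has_value_power: "has_value f a \<Longrightarrow> has_value (f ^ n) (a ^ n)"
  using has_value_const[of 1] by (induction n) (auto intro: has_value_mult)

lemma has_value_eval_by: "has_value x a \<Longrightarrow> has_value (eval_by const p x) (poly p a)"
proof (induction p)
  case 0 then show ?case using has_value_const[of 0] by simp
next
  case (pCons c p) then show ?case
    by (auto simp: const.eval_by_pCons intro!: has_value_add has_value_mult)
qed

lemma has_value_eval2:
  assumes "has_value x a" "has_value y b"
  shows "has_value (eval2 g x y) (eval2_by (\<lambda>c. c) g a b)"
  unfolding eval2_eq
proof (induction g)
  case 0 then show ?case using has_value_const[of 0] by (simp add: const.outer.homs ident.outer.homs)
next
  case (pCons c g) then show ?case using assms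
    by (auto simp: const.eval2_by_pCons ident.eval2_by_pCons
             intro!: has_value_add has_value_mult has_value_eval_by)
qed

end

text \<open>Two proportional places are equal because their values have no common factor.\<close>

lemma proportional_places_eq:
  assumes "const_subfield F" "place F v" "place F w" "t \<in> F" "t \<noteq> 0"
    and pos: "0 < v t * w t"
    and prp: "\<And>f. f \<in> F \<Longrightarrow> f \<noteq> 0 \<Longrightarrow> v f * w t = w f * v t"
  shows "v = w"
proof -
  interpret v: function_place F v by (rule function_place.intro) (auto simp: assms function_place_axioms.intro)
  interpret w: function_place F w by (rule function_place.intro) (auto simp: assms function_place_axioms.intro)
  obtain a where "a \<in> F" "a \<noteq> 0" "v a = 1" by (rule v.uniformizer)
  \<comment> \<open>\<open>v\<close> takes the value 1 at \<open>a\<close>, so proportionality makes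
    \<open>w t\<close> a multiple of \<open>v t\<close>. By symmetry the two agree up to
    sign.\<close>
  then have "v t dvd w t" using prp[of a] by simp
  obtain b where "b \<in> F" "b \<noteq> 0" "w b = 1" by (rule w.uniformizer)
  then have "w t dvd v t" using prp[of b] dvd_triv_right[of "w t" "v b"] by simp
  with \<open>v t dvd w t\<close> have "\<bar>v t\<bar> = \<bar>w t\<bar>" by (rule zdvd_antisym_abs)
  then have *: "v t = w t" "w t \<noteq> 0" using pos by (auto simp: abs_eq_iff zero_less_mult_iff)
  show ?thesis
  proof
    fix f
    show "v f = w f"
    proof (cases "f \<in> F \<and> f \<noteq> 0")
      case True
      then have "v f * w t = w f * w t" using prp[of f] *(1) by simp
      then show ?thesis using *(2) by simp
    next
      case False
      then show ?thesis using v.v_outside[of f] w.v_outside[of f] by auto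
    qed
  qed
qed

section \<open>Double covers of the line\<close>

text \<open>Division by a polynomial that is monic in \<open>Y\<close>: in the Horner step the
  remainder is multiplied by \<open>Y\<close>, and \<open>Y^2\<close> is replaced by
  \<open>f\<close>.\<close>

lemma bpoly_reduce: "\<exists>k a b. g = (Y^2 - [:f:]) * k + [:a, b:]"
proof (induction g)
  case 0
  have "(0::bpoly) = (Y^2 - [:f:]) * 0 + [:0, 0:]" by simp
  then show ?case by blast
next
  case (pCons c g)
  then obtain k a b where g: "g = (Y^2 - [:f:]) * k + [:a, b:]" by blast
  have "pCons c g = [:c:] + Y * g" by (simp add: Y_def)
  also have "\<dots> = (Y^2 - [:f:]) * (Y * k + [:b:]) + ([:c:] + Y * [:a, b:] - (Y^2 - [:f:]) * [:b:])"
    by (simp add: g algebra_simps)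
  also have "[:c:] + Y * [:a, b:] - (Y^2 - [:f:]) * [:b:] = [:c + f * b, a:]"
    by (simp add: Y_def power2_eq_square)
  finally show ?case by blast
qed

lemma (in hom_complex) eval2_by_linear: "eval2_by h [:a, b:] x y = eval_by h a x + y * eval_by h b x"
  by (simp add: eval2_by_pCons outer.hom_zero)

lemma (in hom_complex) eval2_by_reduce:
  assumes "y ^ 2 = eval_by h f x"
  shows "eval2_by h ((Y^2 - [:f:]) * k + [:a, b:]) x y = eval_by h a x + y * eval_by h b x"
proof -
  have "eval2_by h [:f:] x y = eval_by h f x"
    by (simp add: eval2_by_pCons outer.hom_zero)
  then show ?thesis
    using assms by (simp add: eval2_by_simps eval2_by_linear)
qed

text \<open>Squarefreeness, phrased so that a Bezout identity for \<open>f\<close> and its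
  derivative certifies it. The positive degree guarantees a branch point.\<close>

definition simple_roots :: "complex poly \<Rightarrow> bool" where
  "simple_roots f \<longleftrightarrow> 0 < Polynomial.degree f \<and> (\<forall>c. poly f c = 0 \<longrightarrow> poly (pderiv f) c \<noteq> 0)"

lemma simple_roots_order:
  assumes "simple_roots f" "poly f c = 0" shows "Polynomial.order c f = 1"
proof -
  have "f \<noteq> 0" "poly (pderiv f) c \<noteq> 0" using assms by (auto simp: simple_roots_def)
  then have "Polynomial.order c (pderiv f) = 0" by (metis order_root)
  then show ?thesis using order_pderiv[OF \<open>f \<noteq> 0\<close> assms(2)] by simp
qed

lemma simple_roots_factor:
  assumes "simple_roots f" "poly f c = 0"
  obtains k where "f = [:- c, 1:] * k" "poly k c \<noteq> 0"
proof -
  obtain k where k: "f = [:- c, 1:] * k" using assms(2) by (auto simp: poly_eq_0_iff_dvd)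
  have "poly (pderiv f) c = poly k c" unfolding k pderiv_mult by (simp add: pderiv_pCons)
  then show ?thesis using that k assms by (auto simp: simple_roots_def)
qed

text \<open>The square root of a polynomial with simple roots is irrational: the order of \<open>f b\<^sup>2\<close> at a
  root of \<open>f\<close> is odd.\<close>

lemma double_cover_independent:
  fixes h :: "complex \<Rightarrow> 'a::field"
  assumes h: "hom_complex h" "\<And>c. h c = 0 \<Longrightarrow> c = 0" "x \<notin> range h"
    and f: "simple_roots f" and y: "y ^ 2 = eval_by h f x"
  shows "eval_by h a x + y * eval_by h b x = 0 \<longleftrightarrow> a = 0 \<and> b = 0"
proof
  interpret hom_complex h by (rule h)
  assume eq: "eval_by h a x + y * eval_by h b x = 0"
  \<comment> \<open>Multiplying by the conjugate leaves a relation between polynomials in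
    \<open>x\<close> alone.\<close>
  have "eval_by h (a^2 - f * b^2) x
      = (eval_by h a x + y * eval_by h b x) * (eval_by h a x - y * eval_by h b x)"
    by (simp add: eval_by_diff eval_by_mult eval_by_power y[symmetric] algebra_simps power2_eq_square)
  then have ab: "a^2 = f * b^2"
    using eval_by_eq_0_iff[OF h] by (simp add: eq)
  have "b = 0"
  proof (rule ccontr)
    assume b: "b \<noteq> 0"
    have "\<not> constant (poly f)" using f by (simp add: simple_roots_def constant_degree)
    then obtain c where c: "poly f c = 0" using fundamental_theorem_of_algebra by blast
    have f0: "f \<noteq> 0" using f by (auto simp: simple_roots_def)
    then have "a \<noteq> 0" using ab b by auto
    then have "Polynomial.order c (a^2) = 2 * Polynomial.order c a"
      by (simp add: power2_eq_square order_mult)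
    moreover have "Polynomial.order c (f * b^2) = 1 + 2 * Polynomial.order c b"
      using b f0 simple_roots_order[OF f c] by (simp add: power2_eq_square order_mult)
    ultimately have "2 * Polynomial.order c a = 1 + 2 * Polynomial.order c b" using ab by simp
    then show False by presburger
  qed
  then show "a = 0 \<and> b = 0" using ab by simp
qed (simp add: eval_by_def)

text \<open>At a nonconstant point of the cover the kernel of evaluation is generated by
  \<open>Y^2 - [:f:]\<close>, whatever field contains the point. Points in different fields thus
  satisfy the same polynomials, which lets Laurent series stand for elements of the function
  field.\<close>

lemma eval2_by_eq_0_iff:
  fixes h :: "complex \<Rightarrow> 'a::field"
  assumes h: "hom_complex h" "\<And>c. h c = 0 \<Longrightarrow> c = 0" "x \<notin> range h"
    and f: "simple_roots f" and y: "y ^ 2 = eval_by h f x"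
  shows "eval2_by h g x y = 0 \<longleftrightarrow> (Y^2 - [:f:]) dvd g"
proof -
  interpret hom_complex h by (rule h)
  obtain k a b where g: "g = (Y^2 - [:f:]) * k + [:a, b:]" using bpoly_reduce by blast
  have "eval2_by h g x y = 0 \<longleftrightarrow> a = 0 \<and> b = 0"
    unfolding g eval2_by_reduce[OF y] by (rule double_cover_independent[OF assms])
  moreover have "(Y^2 - [:f:]) dvd g" if "a = 0 \<and> b = 0"
    using that by (simp add: g)
  moreover have "eval2_by h g x y = 0" if dv: "(Y^2 - [:f:]) dvd g"
  proof -
    obtain l where "g = (Y^2 - [:f:]) * l + [:0, 0:]" using dv by (auto elim!: dvdE)
    then show ?thesis using eval2_by_reduce[OF y, of l 0 0] by simp
  qed
  ultimately show ?thesis by blast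
qed

locale double_cover =
  fixes t s :: udom and f :: "complex poly"
  assumes transcendental: "t \<notin> range const"
    and s_square: "s ^ 2 = eval_by const f t"
    and simple: "simple_roots f"
begin

abbreviation at_t :: "complex poly \<Rightarrow> udom" where "at_t a \<equiv> eval_by const a t"

abbreviation F :: "udom set" where "F \<equiv> function_field t s"

sublocale const_subfield F
  by (rule const_subfield_function_field)

lemma t_in [simp]: "t \<in> F" and s_in [simp]: "s \<in> F"
  by (rule generators_in_function_field)+

lemma at_t_eq_0_iff [simp]: "at_t a = 0 \<longleftrightarrow> a = 0"
  by (rule eval_by_eq_0_iff) (use transcendental in \<open>simp_all add: const.hom_complex_axioms\<close>)

lemma independent: "at_t a + s * at_t b = 0 \<longleftrightarrow> a = 0 \<and> b = 0"
  by (rule double_cover_independent)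
     (use transcendental s_square simple in \<open>simp_all add: const.hom_complex_axioms\<close>)

lemma f_nonzero [simp]: "f \<noteq> 0"
  using simple by (auto simp: simple_roots_def)

lemma s_nonzero [simp]: "s \<noteq> 0"
  using s_square by (metis at_t_eq_0_iff f_nonzero zero_power2)

lemma eval2_eq_0_iff: "eval2 g t s = 0 \<longleftrightarrow> (Y^2 - [:f:]) dvd g"
  unfolding eval2_eq
  by (rule eval2_by_eq_0_iff)
     (use transcendental s_square simple in \<open>simp_all add: const.hom_complex_axioms\<close>)

lemma eval2_rep: "\<exists>a b. eval2 g t s = at_t a + s * at_t b"
  using bpoly_reduce[of g f] const.eval2_by_reduce[OF s_square] by (metis eval2_eq)

text \<open>Rationalising the denominator: \<open>1 / (a + b s) = (a - b s) / (a\<^sup>2 - f b\<^sup>2)\<close>.\<close>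

lemma element_rep:
  assumes "x \<in> F" obtains a b c where "c \<noteq> 0" "x = (at_t a + s * at_t b) / at_t c"
proof -
  obtain g k where x: "x = eval2 g t s / eval2 k t s" "eval2 k t s \<noteq> 0"
    using assms by (auto simp: function_field_def)
  obtain a b where g: "eval2 g t s = at_t a + s * at_t b" using eval2_rep by blast
  obtain c d where k: "eval2 k t s = at_t c + s * at_t d" using eval2_rep by blast
  have cd: "c \<noteq> 0 \<or> d \<noteq> 0" using x k by auto
  have conj: "at_t c - s * at_t d \<noteq> 0"
    using independent[of c "- d"] cd by (simp add: const.eval_by_uminus)
  have "at_t (c^2 - f * d^2) = (at_t c + s * at_t d) * (at_t c - s * at_t d)"
    by (simp add: const.eval_by_diff const.eval_by_mult const.eval_by_power s_square[symmetric]
        algebra_simps power2_eq_square)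
  moreover from this have "at_t (c^2 - f * d^2) \<noteq> 0" using conj x(2) k by simp
  moreover have "at_t (a * c - f * b * d) + s * at_t (b * c - a * d)
      = (at_t a + s * at_t b) * (at_t c - s * at_t d)"
    by (simp add: const.eval_by_diff const.eval_by_mult s_square[symmetric]
        algebra_simps power2_eq_square)
  ultimately have "c^2 - f * d^2 \<noteq> 0"
      "x = (at_t (a * c - f * b * d) + s * at_t (b * c - a * d)) / at_t (c^2 - f * d^2)"
    using conj x k g by auto
  then show ?thesis using that by blast
qed

end

section \<open>Places from Laurent series\<close>

lemma hom_complex_fls_const: "hom_complex (fls_const :: complex \<Rightarrow> complex fls)"
  by unfold_locales (simp_all add: fls_plus_const)

lemma hom_complex_fps_const: "hom_complex (fps_const :: complex \<Rightarrow> complex fps)"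
  by unfold_locales simp_all

interpretation fls: hom_complex "fls_const :: complex \<Rightarrow> complex fls"
  by (rule hom_complex_fls_const)

interpretation fps: hom_complex "fps_const :: complex \<Rightarrow> complex fps"
  by (rule hom_complex_fps_const)

lemma eval_by_fps_to_fls:
  fixes p :: "complex poly"
  shows "eval_by fls_const p (fps_to_fls u) = fps_to_fls (eval_by fps_const p u)"
  by (induction p) (simp_all add: fls.eval_by_pCons fps.eval_by_pCons fls_times_fps_to_fls)

lemma eval_by_fps_nth_0:
  fixes p :: "complex poly"
  shows "fps_nth (eval_by fps_const p u) 0 = poly p (fps_nth u 0)"
  by (induction p) (simp_all add: fps.eval_by_pCons)

lemma fps_square_root:
  fixes a :: "complex fps"
  assumes "fps_nth a 0 = b ^ 2" "b \<noteq> 0"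
  obtains r where "r ^ 2 = a" "fps_nth r 0 = b"
proof -
  have "fps_radical (\<lambda>_ _. b) (Suc 1) a ^ Suc 1 = a"
    by (subst power_radical[symmetric]) (use assms in \<open>simp_all add: power2_eq_square\<close>)
  moreover have "fps_nth (fps_radical (\<lambda>_ _. b) (Suc 1) a) 0 = b" by simp
  ultimately show ?thesis using that by (simp add: numeral_2_eq_2)
qed

lemma fls_subdegree_power: "fls_subdegree (u ^ n) = int n * fls_subdegree u"
  for u :: "complex fls"
proof (cases "u = 0")
  case False
  then show ?thesis by (induction n) (simp_all add: algebra_simps)
qed (simp add: power_0_left)

lemma fls_subdegree_divide_field:
  fixes u w :: "complex fls"
  assumes "u \<noteq> 0" "w \<noteq> 0" shows "fls_subdegree (u / w) = fls_subdegree u - fls_subdegree w"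
  using fls_subdegree_mult[of "u / w" w] assms by simp

context double_cover
begin

text \<open>The points \<open>(x, y)\<close> and \<open>(t, s)\<close> satisfy the same polynomials,
  so \<open>F\<close> embeds into the Laurent series and inherits their order. The quotient of
  \<open>a\<close> and \<open>b\<close> has order one and makes the inherited valuation
  normalized.\<close>

lemma place_of_series:
  fixes x y :: "complex fls"
  assumes x: "x \<notin> range fls_const" and y: "y ^ 2 = eval_by fls_const f x"
    and unif: "eval2_by fls_const a x y \<noteq> 0" "eval2_by fls_const b x y \<noteq> 0"
      "fls_subdegree (eval2_by fls_const a x y) - fls_subdegree (eval2_by fls_const b x y) = 1"
  obtains v where "place F v" "\<And>g. v (eval2 g t s) = fls_subdegree (eval2_by fls_const g x y)"
proof -
  define E where "E g = eval2_by fls_const g x y" for g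
  have E0: "E g = 0 \<longleftrightarrow> eval2 g t s = 0" for g
    unfolding E_def eval2_eq_0_iff
    by (rule eval2_by_eq_0_iff) (use x y simple in \<open>auto simp: hom_complex_fls_const\<close>)
  have E_mult: "E (g * k) = E g * E k" and E_add: "E (g + k) = E g + E k"
    and E_diff: "E (g - k) = E g - E k" for g k
    by (simp_all add: E_def fls.outer.homs)
  have eval2_mult: "eval2 (g * k) t s = eval2 g t s * eval2 k t s"
    and eval2_add: "eval2 (g + k) t s = eval2 g t s + eval2 k t s"
    and eval2_diff: "eval2 (g - k) t s = eval2 g t s - eval2 k t s" for g k
    by (simp_all add: eval2_eq const.outer.homs)
  \<comment> \<open>\<open>R z p\<close> says that \<open>p\<close> is a numerator and denominator
    of a nonzero \<open>z\<close>. The order is defined on such pairs and then shown to depend on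
    \<open>z\<close> only.\<close>
  define R where "R z p \<longleftrightarrow> eval2 (snd p) t s \<noteq> 0 \<and> eval2 (fst p) t s \<noteq> 0 \<and>
    z = eval2 (fst p) t s / eval2 (snd p) t s" for z p
  define d where "d p = fls_subdegree (E (fst p)) - fls_subdegree (E (snd p))" for p
  have R_ex: "\<exists>p. R z p" if z: "z \<in> F - {0}" for z
  proof -
    obtain k l where "z = eval2 k t s / eval2 l t s" "eval2 l t s \<noteq> 0"
      using z unfolding function_field_def by blast
    then have "R z (k, l)" using z by (auto simp: R_def)
    then show ?thesis ..
  qed
  have R_F: "z \<in> F - {0}" if "R z p" for z p
    using that by (auto simp: R_def function_field_def)
  have d_unique: "d p = d p'" if "R z p" "R z p'" for z p p'
  proof -
    have "eval2 (fst p) t s / eval2 (snd p) t s = eval2 (fst p') t s / eval2 (snd p') t s"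
      using that by (simp add: R_def)
    then have "eval2 (fst p) t s * eval2 (snd p') t s = eval2 (fst p') t s * eval2 (snd p) t s"
      using that by (subst (asm) frac_eq_eq) (simp_all add: R_def)
    then have "eval2 (fst p * snd p' - fst p' * snd p) t s = 0"
      by (simp add: eval2_mult eval2_diff)
    then have eq: "E (fst p) * E (snd p') = E (fst p') * E (snd p)"
      by (simp flip: E0 add: E_mult E_diff)
    have "E (fst p) \<noteq> 0" "E (snd p) \<noteq> 0" "E (fst p') \<noteq> 0" "E (snd p') \<noteq> 0"
      using that by (simp_all add: E0 R_def)
    then show ?thesis
      using arg_cong[OF eq, of fls_subdegree] by (simp add: d_def)
  qed
  define v where "v z = (if z \<in> F - {0} then d (SOME p. R z p) else 0)" for z
  have v: "v z = d p" if "R z p" for z p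
    using d_unique[OF someI[of "R z", OF that] that] R_F[OF that] by (simp add: v_def)
  have "place F v" unfolding place_def
  proof (intro conjI ballI allI impI)
    show "v z = 0" if "z \<notin> F - {0}" for z unfolding v_def using that by (rule if_not_P)
  next
    fix z w assume "z \<in> F - {0}" "w \<in> F - {0}"
    then obtain p p' where p: "R z p" "R w p'" using R_ex by blast
    then have "R (z * w) (fst p * fst p', snd p * snd p')"
      by (simp add: R_def eval2_mult)
    moreover have "d (fst p * fst p', snd p * snd p') = d p + d p'"
      using p by (simp add: d_def R_def E_mult flip: E0)
    ultimately show "v (z * w) = v z + v w" using v p by simp
  next
    fix z w assume "z \<in> F - {0}" "w \<in> F - {0}" and ne: "z + w \<noteq> 0"
    then obtain p p' where p: "R z p" "R w p'" using R_ex by blast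
    let ?n = "fst p * snd p' + fst p' * snd p" and ?m = "snd p * snd p'"
    have R: "R (z + w) (?n, ?m)"
      using p ne by (auto simp: R_def eval2_mult eval2_add add_frac_eq)
    then have "E ?n \<noteq> 0" by (simp add: R_def E0)
    then have "min (fls_subdegree (E (fst p * snd p'))) (fls_subdegree (E (fst p' * snd p)))
        \<le> fls_subdegree (E ?n)"
      unfolding E_add by (rule fls_plus_subdegree)
    then have "min (d p) (d p') \<le> d (?n, ?m)"
      using p by (auto simp: d_def R_def E_mult simp flip: E0)
    then show "min (v z) (v w) \<le> v (z + w)" using v p R by simp
  next
    fix c
    show "v (const c) = 0"
    proof (cases "c = 0")
      case False
      then have "R (const c) (cst c, 1)"
        by (simp add: R_def eval2_eq const.eval2_by_simps)
      moreover have "d (cst c, 1) = 0"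
        by (simp add: d_def E_def fls.eval2_by_simps)
      ultimately show ?thesis using v by simp
    qed (simp add: v_def)
  next
    have "R (eval2 a t s / eval2 b t s) (a, b)"
      using unif by (simp add: R_def E_def flip: E0)
    moreover have "d (a, b) = 1" using unif by (simp add: d_def E_def)
    ultimately show "\<exists>u\<in>F - {0}. v u = 1" using v R_F by metis
  qed
  moreover have "v (eval2 g t s) = fls_subdegree (eval2_by fls_const g x y)" for g
  proof (cases "eval2 g t s = 0")
    case True
    then have "E g = 0" by (simp add: E0)
    then show ?thesis using True by (simp add: v_def E_def)
  next
    case False
    then have "R (eval2 g t s) (g, 1)" by (simp add: R_def eval2_eq const.eval2_by_simps)
    then show ?thesis using v by (simp add: d_def E_def fls.eval2_by_simps)
  qed
  ultimately show ?thesis using that by blast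
qed

text \<open>Expand with \<open>t = c + X\<close>. As \<open>f(c)\<close> is not 0, the expansion of
  \<open>f\<close> has a power series square root with constant term \<open>b\<close>. The
  alternative \<open>s = const b\<close> accounts for zero having value 0 instead of
  infinity.\<close>

lemma place_unramified:
  assumes b: "b ^ 2 = poly f c" "b \<noteq> 0"
  obtains v where "place F v" "v (t - const c) = 1" "0 < v (s - const b) \<or> s = const b"
proof -
  define u :: "complex fps" where "u = fps_const c + fps_X"
  have "fps_nth (eval_by fps_const f u) 0 = b ^ 2"
    unfolding eval_by_fps_nth_0 by (simp add: u_def b)
  then obtain r where r: "r ^ 2 = eval_by fps_const f u" "fps_nth r 0 = b"
    using b(2) by (rule fps_square_root)
  have X: "fps_to_fls u - fls_const c = fls_X"
    by (simp add: u_def)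
  have Zc: "eval2_by fls_const (Z - cst c) (fps_to_fls u) (fps_to_fls r) = fls_X"
    by (simp add: fls.eval2_by_simps X)
  have nr: "fps_to_fls u \<notin> range fls_const"
  proof
    assume "fps_to_fls u \<in> range fls_const"
    then obtain d where "fps_to_fls u = fls_const d" by auto
    then have "fls_X = fls_const (d - c)" using X by (simp add: fls.hom_diff)
    then have "fls_nth (fls_X :: complex fls) 1 = fls_nth (fls_const (d - c)) 1" by simp
    then show False by simp
  qed
  have sq: "fps_to_fls r ^ 2 = eval_by fls_const f (fps_to_fls u)"
    by (simp add: eval_by_fps_to_fls r(1)[symmetric] power2_eq_square fls_times_fps_to_fls)
  have one: "eval2_by fls_const 1 (fps_to_fls u) (fps_to_fls r) = 1"
    by (rule fls.outer.hom_one)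
  obtain v where v: "place F v"
      "\<And>g. v (eval2 g t s) = fls_subdegree (eval2_by fls_const g (fps_to_fls u) (fps_to_fls r))"
    by (rule place_of_series[OF nr sq, of "Z - cst c" 1, unfolded Zc one]) auto
  have "eval2 (Z - cst c) t s = t - const c"
    by (simp add: eval2_eq const.eval2_by_simps)
  then have "v (t - const c) = 1" using v(2)[of "Z - cst c"] by (simp add: Zc)
  moreover have "0 < v (s - const b) \<or> s = const b"
  proof (rule disjCI)
    assume "s \<noteq> const b"
    have e: "eval2 (Y - cst b) t s = s - const b"
      by (simp add: eval2_eq const.eval2_by_simps)
    have "eval2_by fls_const (Y - cst b) (fps_to_fls u) (fps_to_fls r) = fps_to_fls (r - fps_const b)"
      by (simp add: fls.eval2_by_simps)
    then have "v (s - const b) = int (subdegree (r - fps_const b))"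
      using v(2)[of "Y - cst b"] by (simp only: e fls_subdegree_fls_to_fps)
    moreover have "r - fps_const b \<noteq> 0"
    proof
      assume "r - fps_const b = 0"
      then have "eval2_by fls_const (Y - cst b) (fps_to_fls u) (fps_to_fls r) = 0"
        by (simp add: fls.eval2_by_simps)
      moreover have "\<not> (Y^2 - [:f:]) dvd (Y - cst b)"
        using \<open>s \<noteq> const b\<close> e by (simp flip: eval2_eq_0_iff)
      moreover have "eval2_by fls_const (Y - cst b) (fps_to_fls u) (fps_to_fls r) = 0
          \<longleftrightarrow> (Y^2 - [:f:]) dvd (Y - cst b)"
        by (rule eval2_by_eq_0_iff) (use nr sq simple in \<open>auto simp: hom_complex_fls_const\<close>)
      ultimately show False by simp
    qed
    then have "subdegree (r - fps_const b) \<noteq> 0"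
      unfolding subdegree_eq_0_iff using r(2) by simp
    ultimately show "0 < v (s - const b)" by simp
  qed
  ultimately show ?thesis using that v(1) by blast
qed

text \<open>At a branch point \<open>t - c\<close> is a square up to a unit. With
  \<open>t = c + X^2\<close> and \<open>f = (t - c) k\<close>, the expansion of \<open>s\<close> is
  \<open>X\<close> times a square root of \<open>k(c + X^2)\<close>.\<close>

lemma place_ramified:
  assumes c: "poly f c = 0"
  obtains v where "place F v" "v (t - const c) = 2" "v s = 1"
proof -
  obtain k where k: "f = [:- c, 1:] * k" "poly k c \<noteq> 0"
    using simple_roots_factor[OF simple c] by blast
  define u :: "complex fps" where "u = fps_const c + fps_X ^ 2"
  have "fps_nth (eval_by fps_const k u) 0 = csqrt (poly k c) ^ 2"
    unfolding eval_by_fps_nth_0 by (simp add: u_def)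
  then obtain r where r: "r ^ 2 = eval_by fps_const k u" "fps_nth r 0 = csqrt (poly k c)"
    by (rule fps_square_root) (use k(2) in simp)
  have r0: "r \<noteq> 0" "subdegree r = 0" using r(2) k(2) by (auto simp: subdegree_eq_0_iff)
  have X: "fps_to_fls u - fls_const c = fls_X ^ 2"
    by (simp add: u_def power2_eq_square fls_times_fps_to_fls)
  define w where "w = fps_to_fls (fps_X * r)"
  have w: "w \<noteq> 0" "fls_subdegree w = 1"
    using r0 by (simp_all add: w_def fls_subdegree_fls_to_fps)
  have Zc: "eval2_by fls_const (Z - cst c) (fps_to_fls u) w = fls_X ^ 2"
    by (simp add: fls.eval2_by_simps X)
  have nr: "fps_to_fls u \<notin> range fls_const"
  proof
    assume "fps_to_fls u \<in> range fls_const"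
    then obtain d where "fps_to_fls u = fls_const d" by auto
    then have "fls_X ^ 2 = fls_const (d - c)" using X by (simp add: fls.hom_diff)
    then have "fls_subdegree (fls_X ^ 2 :: complex fls) = fls_subdegree (fls_const (d - c))" by simp
    then show False by (simp add: fls_subdegree_power)
  qed
  have "w ^ 2 = fps_to_fls (fps_X ^ 2 * r ^ 2)"
    by (simp add: w_def power2_eq_square fls_times_fps_to_fls algebra_simps)
  also have "fps_X ^ 2 * r ^ 2 = eval_by fps_const f u"
    unfolding k(1) fps.eval_by_mult r(1) by (simp add: fps.eval_by_pCons u_def)
  finally have sq: "w ^ 2 = eval_by fls_const f (fps_to_fls u)"
    by (simp add: eval_by_fps_to_fls)
  obtain v where v: "place F v"
      "\<And>g. v (eval2 g t s) = fls_subdegree (eval2_by fls_const g (fps_to_fls u) w)"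
    by (rule place_of_series[OF nr sq, of Y 1]) (auto simp: fls.eval2_by_simps w)
  have "eval2 (Z - cst c) t s = t - const c" "eval2 Y t s = s"
    by (simp_all add: eval2_eq const.eval2_by_simps)
  then have "v (t - const c) = 2" "v s = 1"
    using v(2)[of "Z - cst c", unfolded Zc] v(2)[of Y] w
    by (simp_all add: fls.eval2_by_simps fls_subdegree_power)
  then show ?thesis using that v(1) by blast
qed

end

text \<open>The polynomial \<open>x^n p(1/x)\<close>. The length \<open>n\<close> is separate from
  the degree so that several polynomials can be reversed together.\<close>

definition reverse_poly :: "nat \<Rightarrow> complex poly \<Rightarrow> complex poly" where
  "reverse_poly n p = (\<Sum>i\<le>n. Polynomial.monom (Polynomial.coeff p (n - i)) i)"

lemma coeff_reverse_poly:
  "Polynomial.coeff (reverse_poly n p) i = (if i \<le> n then Polynomial.coeff p (n - i) else 0)"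
  by (simp add: reverse_poly_def coeff_sum coeff_monom)

lemma (in hom_complex) eval_by_reverse:
  assumes ux: "u * x = 1" and "Polynomial.degree p \<le> n"
  shows "eval_by h p x * u ^ n = eval_by h (reverse_poly n p) u"
proof -
  have "eval_by h p x = eval_by h (\<Sum>i\<le>n. Polynomial.monom (Polynomial.coeff p i) i) x"
    using poly_as_sum_of_monoms'[OF assms(2)] by simp
  then have "eval_by h p x * u ^ n = (\<Sum>i\<le>n. h (Polynomial.coeff p i) * (x ^ i * u ^ n))"
    by (simp add: eval_by_sum eval_by_monom sum_distrib_right mult.assoc)
  also have "\<dots> = (\<Sum>i\<le>n. h (Polynomial.coeff p i) * u ^ (n - i))"
  proof (rule sum.cong)
    fix i assume "i \<in> {..n}"
    then have "u ^ n = u ^ i * u ^ (n - i)" by (simp flip: power_add)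
    then have "x ^ i * u ^ n = (u * x) ^ i * u ^ (n - i)"
      by (simp add: power_mult_distrib mult_ac)
    then show "h (Polynomial.coeff p i) * (x ^ i * u ^ n) = h (Polynomial.coeff p i) * u ^ (n - i)"
      by (simp add: ux)
  qed simp
  also have "\<dots> = (\<Sum>i\<le>n. h (Polynomial.coeff p (n - i)) * u ^ i)"
    by (rule sum.reindex_bij_witness[of _ "\<lambda>i. n - i" "\<lambda>i. n - i"]) auto
  finally show ?thesis
    by (simp add: reverse_poly_def eval_by_sum eval_by_monom)
qed

context double_cover
begin

text \<open>Expand with \<open>t = 1 / X^2\<close>. Because the degree is odd, \<open>s\<close> is a
  square root of the reversed polynomial at \<open>X^2\<close>, divided by
  \<open>X^(2 n + 1)\<close>, and \<open>t^n / s\<close> has order one.\<close>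

lemma place_infinity:
  assumes deg: "Polynomial.degree f = 2 * n + 1"
  obtains v where "place F v" "v t = - 2" "v s = - int (2 * n + 1)"
proof -
  define k where "k = reverse_poly (Polynomial.degree f) f"
  have k0: "poly k 0 \<noteq> 0" by (simp add: k_def poly_0_coeff_0 coeff_reverse_poly)
  define w :: "complex fls" where "w = fls_X"
  have w0: "w \<noteq> 0" "fls_subdegree w = 1" by (simp_all add: w_def)
  have "fps_nth (eval_by fps_const k (fps_X ^ 2)) 0 = csqrt (poly k 0) ^ 2"
    unfolding eval_by_fps_nth_0 by simp
  then obtain r where r: "r ^ 2 = eval_by fps_const k (fps_X ^ 2)" "fps_nth r 0 = csqrt (poly k 0)"
    by (rule fps_square_root) (use k0 in simp)
  have r0: "r \<noteq> 0" "subdegree r = 0" using r(2) k0 by (auto simp: subdegree_eq_0_iff)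
  define x where "x = 1 / w ^ 2"
  define y where "y = fps_to_fls r / w ^ (2 * n + 1)"
  have xd: "fls_subdegree x = - 2"
    using w0 by (simp add: x_def fls_subdegree_divide_field fls_subdegree_power)
  have yd: "y \<noteq> 0" "fls_subdegree y = - int (2 * n + 1)"
    using w0 r0 by (simp_all add: y_def fls_subdegree_divide_field fls_subdegree_power fls_subdegree_fls_to_fps)
  have nr: "x \<notin> range fls_const" using xd by auto
  have "fps_to_fls (fps_X ^ 2) = w ^ 2"
    by (simp add: w_def power2_eq_square fls_times_fps_to_fls)
  then have "fps_to_fls r ^ 2 = eval_by fls_const k (w ^ 2)"
    using arg_cong[OF r(1), of fps_to_fls]
    by (simp add: power2_eq_square fls_times_fps_to_fls flip: eval_by_fps_to_fls)
  also have "\<dots> = eval_by fls_const f x * (w ^ 2) ^ Polynomial.degree f"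
    unfolding k_def by (rule fls.eval_by_reverse[symmetric]) (use w0 in \<open>simp_all add: x_def\<close>)
  also have "(w ^ 2) ^ Polynomial.degree f = (w ^ (2 * n + 1)) ^ 2"
    by (simp only: deg power_mult[symmetric] mult.commute)
  finally have sq: "y ^ 2 = eval_by fls_const f x"
    using w0 by (simp add: y_def power_divide)
  have xy: "fls_subdegree (x ^ n) - fls_subdegree y = 1"
    by (simp add: fls_subdegree_power xd yd)
  have x0: "x \<noteq> 0" using w0 by (simp add: x_def)
  obtain v where v: "place F v"
      "\<And>g. v (eval2 g t s) = fls_subdegree (eval2_by fls_const g x y)"
    by (rule place_of_series[OF nr sq, of "Z ^ n" Y]) (use x0 yd xy in \<open>auto simp: fls.eval2_by_simps\<close>)
  have "eval2 Z t s = t" "eval2 Y t s = s"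
    by (simp_all add: eval2_eq const.eval2_by_simps)
  then have "v t = - 2" "v s = - int (2 * n + 1)"
    using v(2)[of Z] v(2)[of Y] xd yd by (simp_all add: fls.eval2_by_simps)
  then show ?thesis using that v(1) by blast
qed

end

section \<open>The places of a double cover\<close>

lemma (in hom_ring) eval_by_pcompose: "eval_by h (pcompose p q) x = eval_by h p (eval_by h q x)"
  by (induction p) (simp_all add: pcompose_pCons eval_by_add eval_by_mult eval_by_pCons)

context function_place
begin

text \<open>The polynomial splits over the complex numbers, so a positive value of the product
  forces a positive value of some factor \<open>x - const c\<close>.\<close>

lemma residue_of_root:
  assumes x: "x \<in> F" "vge 0 x"
  shows "p \<noteq> 0 \<Longrightarrow> vge 1 (eval_by const p x) \<Longrightarrow> \<exists>c. has_value x c"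
proof (induction "Polynomial.degree p" arbitrary: p)
  case 0
  then obtain c where c: "p = [:c:]" by (metis degree_eq_zeroE)
  with 0 have "c \<noteq> 0" by auto
  then show ?case using 0 c by (simp add: const.eval_by_pCons vge_def)
next
  case (Suc n)
  then have "\<not> constant (poly p)" by (simp add: constant_degree)
  then obtain c where "poly p c = 0" using fundamental_theorem_of_algebra by blast
  then obtain r where r: "p = [:- c, 1:] * r" by (auto simp: poly_eq_0_iff_dvd)
  with Suc.hyps(2) have r0: "r \<noteq> 0" by auto
  then have "Polynomial.degree p = Suc (Polynomial.degree r)"
    unfolding r by (subst degree_mult_eq) auto
  then have n: "n = Polynomial.degree r" using Suc.hyps(2) by simp
  have p: "eval_by const p x = (x - const c) * eval_by const r x"
    unfolding r const.eval_by_mult by (simp add: const.eval_by_pCons const.hom_uminus)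
  show ?case
  proof (cases "vge 1 (x - const c)")
    case True
    then show ?thesis using x by (auto simp: has_value_def)
  next
    case False
    have "vge 0 (x - const c)" using x by (intro vge_diff) auto
    with False have "x - const c \<noteq> 0" "v (x - const c) = 0" by (auto simp: vge_def)
    then have "vge 1 (eval_by const r x)"
      using Suc.prems(2) x v_mult[of "x - const c" "eval_by const r x"]
      unfolding p by (cases "eval_by const r x = 0") (auto simp: vge_def)
    then show ?thesis using Suc.hyps(1)[OF n r0] by blast
  qed
qed

text \<open>After division by a power of \<open>u\<close> the relation has a nontrivial reduction at the place,
  which the residue of \<open>x\<close> has to satisfy.\<close>

lemma residue_of_relation:
  assumes u: "u \<in> F" "u \<noteq> 0" "vge 1 u" and x: "x \<in> F" "vge 0 x"
  shows "a2 \<noteq> 0 \<Longrightarrow> eval_by const a0 u + eval_by const a1 u * x + eval_by const a2 u * x ^ 2 = 0 \<Longrightarrow>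
    \<exists>c. has_value x c"
proof (induction "Polynomial.degree a2" arbitrary: a0 a1 a2 rule: less_induct)
  case less
  let ?e = "\<lambda>a. eval_by const a u"
  have val: "has_value (?e a) (poly a 0)" for a
    using u by (intro has_value_eval_by) (simp add: has_value_def)
  show ?case
  proof (cases "poly a0 0 = 0 \<and> poly a1 0 = 0 \<and> poly a2 0 = 0")
    case True
    have split: "\<exists>b. a = pCons 0 b" if "poly a 0 = 0" for a :: "complex poly"
      using that by (cases a) auto
    obtain b0 b1 b2 where b: "a0 = pCons 0 b0" "a1 = pCons 0 b1" "a2 = pCons 0 b2"
      using True split by blast
    have "u * (?e b0 + ?e b1 * x + ?e b2 * x ^ 2) = 0"
      using less.prems(2) by (simp add: b const.eval_by_pCons algebra_simps)
    then have "?e b0 + ?e b1 * x + ?e b2 * x ^ 2 = 0" using u by simp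
    moreover have "b2 \<noteq> 0" using less.prems(1) b by auto
    ultimately show ?thesis using less.hyps[of b2 b0 b1] b by simp
  next
    case False
    \<comment> \<open>\<open>?p\<close> is the relation with \<open>u\<close> set to 0. It is not
      zero, and the discarded terms all have positive value.\<close>
    let ?p = "[:poly a0 0, poly a1 0, poly a2 0:]"
    have diff: "vge (1 + 0) ((const (poly a 0) - ?e a) * z)" if "z \<in> F" "vge 0 z" for a z
    proof (rule vge_mult)
      show "vge 1 (const (poly a 0) - ?e a)"
        using val[of a] vge_uminus[of "?e a - const (poly a 0)" 1] by (simp add: has_value_def)
    qed (use that u in auto)
    have "vge 0 (x ^ 2)" using vge_mult[OF x(1) x(1) x(2) x(2)] by (simp add: power2_eq_square)
    then have "vge 1 ((const (poly a0 0) - ?e a0) * 1 + (const (poly a1 0) - ?e a1) * x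
        + (const (poly a2 0) - ?e a2) * x ^ 2)"
      using diff[of x a1] diff[of 1 a0] diff[of "x ^ 2" a2] x u
      by (intro vge_add) (auto simp: vge_const[of 1, simplified])
    moreover have "eval_by const ?p x = (const (poly a0 0) - ?e a0) * 1
        + (const (poly a1 0) - ?e a1) * x + (const (poly a2 0) - ?e a2) * x ^ 2
        + (?e a0 + ?e a1 * x + ?e a2 * x ^ 2)"
      by (simp add: const.eval_by_pCons algebra_simps power2_eq_square)
    ultimately have "vge 1 (eval_by const ?p x)" using less.prems(2) by simp
    then show ?thesis using residue_of_root[OF x, of ?p] False by auto
  qed
qed

end

context double_cover
begin

lemma function_place: "place F v \<Longrightarrow> function_place F v"
  by (intro function_place.intro function_place_axioms.intro const_subfield_function_field)

lemma t_minus_const [simp]: "t - const c \<noteq> 0" "t \<noteq> const c"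
  using transcendental by auto

lemma t_nonzero [simp]: "t \<noteq> 0"
  using t_minus_const(2)[of 0] by simp

lemma norm_eq: "(at_t a + s * at_t b) * (at_t a - s * at_t b) = at_t (a^2 - f * b^2)"
  by (simp add: const.eval_by_diff const.eval_by_mult const.eval_by_power s_square[symmetric]
      algebra_simps power2_eq_square)

lemma norm_nonzero: "a \<noteq> 0 \<or> b \<noteq> 0 \<Longrightarrow> a^2 - f * b^2 \<noteq> 0"
  using norm_eq[of a b] independent[of a b] independent[of a "- b"]
  by (auto simp: const.eval_by_uminus)

lemma v_at_t:
  assumes "place F v" "0 < v (t - const c)" "p \<noteq> 0"
  shows "v (at_t p) = int (Polynomial.order c p) * v (t - const c)"
proof -
  interpret v: function_place F v by (rule function_place[OF assms(1)])
  obtain q where q: "p = [:- c, 1:] ^ Polynomial.order c p * q" "\<not> [:- c, 1:] dvd q"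
    using order_decomp[OF assms(3)] by blast
  then have "poly q c \<noteq> 0" by (simp add: poly_eq_0_iff_dvd)
  moreover have "v.has_value t c"
    using assms(2) by (simp add: v.has_value_def v.vge_def)
  ultimately have "at_t q \<noteq> 0" "v (at_t q) = 0"
    using v.has_value_nonzero[OF v.has_value_eval_by] by blast+
  moreover have "at_t p = (t - const c) ^ Polynomial.order c p * at_t q"
    by (subst q(1)) (simp add: const.eval_by_mult const.eval_by_power const.eval_by_pCons const.hom_uminus)
  ultimately show ?thesis by (simp add: v.v_mult v.v_power)
qed

lemma v_at_t_infinity:
  assumes "place F v" "v t < 0"
  shows "p \<noteq> 0 \<Longrightarrow> v (at_t p) = int (Polynomial.degree p) * v t"
proof (induction p)
  case (pCons a p)
  interpret v: function_place F v by (rule function_place[OF assms(1)])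
  show ?case
  proof (cases "p = 0")
    case False
    then have "v (t * at_t p) = int (Polynomial.degree (pCons a p)) * v t"
      using pCons by (simp add: v.v_mult algebra_simps)
    moreover have "v (t * at_t p) < 0"
      using assms(2) False unfolding calculation by (simp add: mult_less_0_iff)
    ultimately show ?thesis
      using v.v_add_dominant(2)[of "t * at_t p" "const a"] False
      by (simp add: const.eval_by_pCons add.commute)
  qed (simp add: const.eval_by_pCons)
qed simp

lemma v_s: "place F v \<Longrightarrow> 2 * v s = v (at_t f)"
  using function_place.v_power[OF function_place s_in, of v 2] by (simp add: s_square)

text \<open>Otherwise all nonzero polynomials in \<open>t\<close> have value 0, hence so has
  \<open>s\<close>; then \<open>a + b s\<close> and its conjugate have nonnegative values with sum
  0. The place would be trivial on \<open>F\<close>, contrary to the existence of a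
  uniformizer.\<close>

lemma finite_place_centre:
  assumes v: "place F v" and t: "0 \<le> v t"
  shows "\<exists>c. 0 < v (t - const c)"
proof (rule ccontr)
  interpret v: function_place F v by (rule function_place[OF v])
  assume no: "\<nexists>c. 0 < v (t - const c)"
  have tc: "v (t - const c) = 0" for c
  proof -
    have "v.vge 0 (t - const c)" using t by (intro v.vge_diff) (auto simp: v.vge_def)
    moreover have "\<not> 0 < v (t - const c)" using no by blast
    ultimately show ?thesis by (simp add: v.vge_def)
  qed
  have poly_v: "p \<noteq> 0 \<Longrightarrow> v (at_t p) = 0" for p
  proof (induction "Polynomial.degree p" arbitrary: p)
    case 0
    then obtain c where "p = [:c:]" by (metis degree_eq_zeroE)
    then show ?case by (simp add: const.eval_by_pCons)
  next
    case (Suc n)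
    then have "\<not> constant (poly p)" by (simp add: constant_degree)
    then obtain c where "poly p c = 0" using fundamental_theorem_of_algebra by blast
    then obtain r where r: "p = [:- c, 1:] * r" by (auto simp: poly_eq_0_iff_dvd)
    with Suc.hyps(2) have r0: "r \<noteq> 0" by auto
    then have "Polynomial.degree p = Suc (Polynomial.degree r)"
      unfolding r by (subst degree_mult_eq) auto
    then have "v (at_t r) = 0" using Suc r0 by simp
    then show ?case
      unfolding r const.eval_by_mult using r0
      by (simp add: const.eval_by_pCons const.hom_uminus v.v_mult tc)
  qed
  have vs: "v s = 0" using v_s[OF v] poly_v[of f] by simp
  have lin: "v.vge 0 (at_t a + s * at_t b)" for a b
  proof (intro v.vge_add)
    have "v.vge 0 (at_t p)" for p using poly_v[of p] by (cases "p = 0") (auto simp: v.vge_def)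
    moreover have "v.vge 0 s" using vs by (simp add: v.vge_def)
    ultimately show "v.vge 0 (at_t a)" "v.vge 0 (s * at_t b)"
      using v.vge_mult[of s "at_t b" 0 0] by auto
  qed auto
  have unit: "v (at_t a + s * at_t b) = 0" if "a \<noteq> 0 \<or> b \<noteq> 0" for a b
  proof -
    have ne: "at_t a + s * at_t b \<noteq> 0" "at_t a - s * at_t b \<noteq> 0"
      using norm_eq[of a b] norm_nonzero[OF that] by auto
    have "v (at_t a + s * at_t b) + v (at_t a - s * at_t b) = 0"
      using ne poly_v[OF norm_nonzero[OF that]] by (simp flip: norm_eq v.v_mult)
    moreover have "0 \<le> v (at_t a + s * at_t b)" "0 \<le> v (at_t a - s * at_t b)"
      using lin[of a b] lin[of a "- b"] ne by (auto simp: v.vge_def const.eval_by_uminus)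
    ultimately show ?thesis by simp
  qed
  obtain x where x: "x \<in> F" "x \<noteq> 0" "v x = 1" by (rule v.uniformizer)
  obtain a b c where abc: "c \<noteq> 0" "x = (at_t a + s * at_t b) / at_t c"
    using element_rep[OF x(1)] by blast
  then have "at_t a + s * at_t b \<noteq> 0" using x(2) by auto
  then have "a \<noteq> 0 \<or> b \<noteq> 0" by auto
  then have "v x = 0"
    using abc unit[of a b] poly_v[of c] \<open>at_t a + s * at_t b \<noteq> 0\<close> by (simp add: v.v_divide)
  then show False using x by simp
qed

text \<open>The characteristic polynomial of \<open>(a + b s) / c\<close> over C(t), with trace
  \<open>2 a / c\<close> and norm \<open>(a^2 - f b^2) / c^2\<close>, multiplied by
  \<open>c^2\<close>.\<close>

lemma quadratic_relation:
  assumes "x \<in> F"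
  obtains a0 a1 a2 where "a2 \<noteq> 0" "at_t a0 + at_t a1 * x + at_t a2 * x ^ 2 = 0"
proof -
  obtain a b c where abc: "c \<noteq> 0" "x = (at_t a + s * at_t b) / at_t c"
    using element_rep[OF assms] by blast
  have cx: "at_t c * x = at_t a + s * at_t b" using abc by simp
  have "at_t (a^2 - f * b^2) + at_t (- 2 * a * c) * x + at_t (c^2) * x ^ 2
      = at_t (a^2 - f * b^2) - 2 * at_t a * (at_t c * x) + (at_t c * x) ^ 2"
    by (simp add: const.eval_by_mult const.eval_by_power const.eval_by_uminus const.eval_by_numeral
        power_mult_distrib mult_ac)
  also have "\<dots> = 0"
    unfolding cx norm_eq[symmetric] by (simp add: algebra_simps power2_eq_square)
  finally show ?thesis using that[of "c^2"] abc(1) by simp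
qed

text \<open>Every place has residue field C, which is why degrees of divisors are plain sums. The
  quadratic relation is rewritten in a function of positive value, \<open>t - c\<close> or
  \<open>1 / t\<close>, and then reduced.\<close>

lemma residue:
  assumes v: "place F v" and x: "x \<in> F" "x = 0 \<or> 0 \<le> v x"
  shows "\<exists>c. function_place.has_value F v x c"
proof -
  interpret v: function_place F v by (rule function_place[OF v])
  have vx: "v.vge 0 x" using x(2) by (simp add: v.vge_def)
  obtain a0 a1 a2 where a: "a2 \<noteq> 0" "at_t a0 + at_t a1 * x + at_t a2 * x ^ 2 = 0"
    by (rule quadratic_relation[OF x(1)])
  show ?thesis
  proof (cases "0 \<le> v t")
    case True
    then obtain c where c: "0 < v (t - const c)" using finite_place_centre[OF v] by blast
    have shift: "at_t a = eval_by const (pcompose a [:c, 1:]) (t - const c)" for a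
      by (simp add: const.eval_by_pcompose const.eval_by_pCons)
    have "pcompose a2 [:c, 1:] \<noteq> 0"
      using a(1) shift[of a2] at_t_eq_0_iff[of a2] by auto
    then show ?thesis
      by (rule v.residue_of_relation[where u = "t - const c" and ?a2.0 = "pcompose a2 [:c, 1:]"
          and ?a0.0 = "pcompose a0 [:c, 1:]" and ?a1.0 = "pcompose a1 [:c, 1:]", rotated 5])
         (use c x vx a(2) in \<open>simp_all add: v.vge_def flip: shift\<close>)
  next
    case False
    \<comment> \<open>A common length for the reversals, so that one factor \<open>u ^ n\<close>
      turns all three coefficients into polynomials in \<open>u = 1 / t\<close>.\<close>
    define n where "n = max (Polynomial.degree a0) (max (Polynomial.degree a1) (Polynomial.degree a2))"
    have deg: "Polynomial.degree a0 \<le> n" "Polynomial.degree a1 \<le> n" "Polynomial.degree a2 \<le> n"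
      by (simp_all add: n_def)
    define u where "u = inverse t"
    have rev: "at_t a * u ^ n = eval_by const (reverse_poly n a) u" if "Polynomial.degree a \<le> n" for a
      by (rule const.eval_by_reverse) (use that in \<open>simp_all add: u_def\<close>)
    have "reverse_poly n a2 \<noteq> 0"
    proof
      assume "reverse_poly n a2 = 0"
      then have "at_t a2 * u ^ n = 0" using rev[OF deg(3)] by simp
      then show False using a(1) by (simp add: u_def)
    qed
    moreover have "(at_t a0 + at_t a1 * x + at_t a2 * x ^ 2) * u ^ n = 0" using a(2) by simp
    then have "at_t a0 * u ^ n + at_t a1 * u ^ n * x + at_t a2 * u ^ n * x ^ 2 = 0"
      by (simp add: algebra_simps)
    ultimately show ?thesis unfolding rev[OF deg(1)] rev[OF deg(2)] rev[OF deg(3)]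
      by (rule v.residue_of_relation[of u, rotated 5])
         (use False x vx in \<open>simp_all add: v.vge_def u_def v.v_inverse\<close>)
  qed
qed

section \<open>Uniqueness of the places over a point of the line\<close>

lemma places_eqI:
  assumes vw: "place F v" "place F w" and u: "u \<in> F" "u \<noteq> 0" "0 < v u * w u"
    and lin: "\<And>a b. a \<noteq> 0 \<or> b \<noteq> 0 \<Longrightarrow>
      v (at_t a + s * at_t b) * w u = w (at_t a + s * at_t b) * v u"
  shows "v = w"
proof (rule proportional_places_eq[OF const_subfield_function_field vw u])
  interpret v: function_place F v by (rule function_place[OF vw(1)])
  interpret w: function_place F w by (rule function_place[OF vw(2)])
  fix x assume "x \<in> F" "x \<noteq> 0"
  then obtain a b c where abc: "c \<noteq> 0" "x = (at_t a + s * at_t b) / at_t c"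
    using element_rep by blast
  then have ne: "at_t a + s * at_t b \<noteq> 0" using \<open>x \<noteq> 0\<close> by auto
  then have "a \<noteq> 0 \<or> b \<noteq> 0" by auto
  then show "v x * w u = w x * v u"
    using lin[of a b] lin[of c 0] abc ne
    by (simp add: v.v_divide w.v_divide algebra_simps)
qed

text \<open>Where \<open>s\<close> has a value that is not attained on \<open>\<complex>(t)\<close>, no cancellation occurs in \<open>a + b s\<close>.\<close>

lemma ramified_places_eq:
  assumes vw: "place F v" "place F w" and u: "u \<in> F" "u \<noteq> 0" "0 < v u * w u"
    and poly: "\<And>a. a \<noteq> 0 \<Longrightarrow> v (at_t a) * w u = w (at_t a) * v u"
    and ramified: "\<And>a b. a \<noteq> 0 \<Longrightarrow> b \<noteq> 0 \<Longrightarrow> 2 * v (at_t a) \<noteq> v (at_t f) + 2 * v (at_t b)"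
  shows "v = w"
proof (rule places_eqI[OF vw u])
  interpret v: function_place F v by (rule function_place[OF vw(1)])
  interpret w: function_place F w by (rule function_place[OF vw(2)])
  fix a b :: "complex poly" assume ab: "a \<noteq> 0 \<or> b \<noteq> 0"
  have "2 * (v s * w u) = 2 * (w s * v u)"
    using poly[of f] v_s[OF vw(1)] v_s[OF vw(2)] by (simp flip: mult.assoc)
  then have s: "v s * w u = w s * v u" by simp
  have sb: "v (s * at_t b) * w u = w (s * at_t b) * v u" if "b \<noteq> 0"
    using that s poly[of b] by (simp add: v.v_mult w.v_mult algebra_simps)
  show "v (at_t a + s * at_t b) * w u = w (at_t a + s * at_t b) * v u"
  proof (cases "a = 0 \<or> b = 0")
    case True
    then show ?thesis using ab poly[of a] sb by auto
  next
    case False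
    \<comment> \<open>\<open>v u\<close> and \<open>w u\<close> have the same sign, so proportional
      values are ordered alike at both places.\<close>
    have dichotomy: "(v (at_t a) < v (s * at_t b) \<longleftrightarrow> w (at_t a) < w (s * at_t b))
        \<and> (v (s * at_t b) < v (at_t a) \<longleftrightarrow> w (s * at_t b) < w (at_t a))"
    proof (cases "0 < w u")
      case True
      then have "0 < v u" using u(3) by (simp add: zero_less_mult_iff)
      then show ?thesis
        using True poly[of a] sb False by (metis mult_less_cancel_right_pos)
    next
      case False': False
      then have "v u < 0" "w u < 0" using u(3) by (auto simp: zero_less_mult_iff)
      then show ?thesis
        using poly[of a] sb False by (metis mult_less_cancel_right_neg)
    qed
    have "v (at_t a) \<noteq> v (s * at_t b)"
      using ramified[of a b] False v_s[OF vw(1)] by (auto simp: v.v_mult)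
    then consider "v (at_t a) < v (s * at_t b)" | "v (s * at_t b) < v (at_t a)" by linarith
    then show ?thesis
    proof cases
      case 1
      then show ?thesis
        using dichotomy poly[of a] False v.v_add_dominant(2)[of "at_t a" "s * at_t b"]
          w.v_add_dominant(2)[of "at_t a" "s * at_t b"] by simp
    next
      case 2
      then show ?thesis
        using dichotomy sb False v.v_add_dominant(2)[of "s * at_t b" "at_t a"]
          w.v_add_dominant(2)[of "s * at_t b" "at_t a"] by (simp add: add.commute)
    qed
  qed
qed

text \<open>Parity: \<open>f\<close> has a simple root at \<open>c\<close>, so
  \<open>2 * v (at_t a)\<close> is an even multiple of \<open>v (t - const c)\<close> and
  \<open>v (at_t f) + 2 * v (at_t b)\<close> an odd one.\<close>

lemma place_over_root_unique:
  assumes vw: "place F v" "place F w" and c: "poly f c = 0"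
    and pos: "0 < v (t - const c)" "0 < w (t - const c)"
  shows "v = w"
proof (rule ramified_places_eq[OF vw, of "t - const c"])
  fix a b :: "complex poly" assume ab: "a \<noteq> 0" "b \<noteq> 0"
  have "2 * int (Polynomial.order c a) \<noteq> 1 + 2 * int (Polynomial.order c b)" by presburger
  moreover have "2 * v (at_t a) = (2 * int (Polynomial.order c a)) * v (t - const c)"
    "v (at_t f) + 2 * v (at_t b) = (1 + 2 * int (Polynomial.order c b)) * v (t - const c)"
    using ab v_at_t[OF vw(1) pos(1)] simple_roots_order[OF simple c] by (simp_all add: algebra_simps)
  ultimately show "2 * v (at_t a) \<noteq> v (at_t f) + 2 * v (at_t b)"
    using pos(1) by (metis less_irrefl mult_right_cancel)
qed (use pos v_at_t[OF vw(1) pos(1)] v_at_t[OF vw(2) pos(2)] in auto)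

text \<open>The same parity argument, with degrees in place of orders at a root.\<close>

lemma place_infinity_unique:
  assumes odd: "odd (Polynomial.degree f)" and vw: "place F v" "place F w"
    and neg: "v t < 0" "w t < 0"
  shows "v = w"
proof (rule ramified_places_eq[OF vw, of t])
  fix a b :: "complex poly" assume ab: "a \<noteq> 0" "b \<noteq> 0"
  have "2 * int (Polynomial.degree a) \<noteq> int (Polynomial.degree f) + 2 * int (Polynomial.degree b)"
    using odd by presburger
  moreover have "2 * v (at_t a) = (2 * int (Polynomial.degree a)) * v t"
    "v (at_t f) + 2 * v (at_t b) = (int (Polynomial.degree f) + 2 * int (Polynomial.degree b)) * v t"
    using ab v_at_t_infinity[OF vw(1) neg(1)] by (simp_all add: algebra_simps)
  ultimately show "2 * v (at_t a) \<noteq> v (at_t f) + 2 * v (at_t b)"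
    using neg(1) by (metis less_irrefl mult_right_cancel)
qed (use neg v_at_t_infinity[OF vw(1) neg(1)] v_at_t_infinity[OF vw(2) neg(2)]
    in \<open>auto simp: mult_neg_neg\<close>)

text \<open>Induction on the degrees in \<open>a + b s\<close>. If it does not vanish at
  \<open>(c, d)\<close>, its value is 0; if its conjugate does not, its value is that of the norm.
  As \<open>d\<close> is not 0, the only other case is \<open>a(c) = b(c) = 0\<close>, where a
  factor \<open>t - c\<close> cancels.\<close>

lemma place_over_point_unique:
  assumes vw: "place F v" "place F w"
    and pos: "0 < v (t - const c)" "0 < w (t - const c)"
    and d: "d \<noteq> 0" "function_place.has_value F v s d" "function_place.has_value F w s d"
  shows "v = w"
proof (rule places_eqI[OF vw, of "t - const c"])
  interpret v: function_place F v by (rule function_place[OF vw(1)])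
  interpret w: function_place F w by (rule function_place[OF vw(2)])
  have tc: "v.has_value t c" "w.has_value t c"
    using pos by (simp_all add: v.has_value_def w.has_value_def v.vge_def w.vge_def)
  have vv: "v.has_value (at_t a + s * at_t b) (poly a c + d * poly b c)"
    "w.has_value (at_t a + s * at_t b) (poly a c + d * poly b c)" for a b
    using tc d by (auto intro!: v.has_value_add v.has_value_mult v.has_value_eval_by
        w.has_value_add w.has_value_mult w.has_value_eval_by)
  fix a b :: "complex poly"
  show "a \<noteq> 0 \<or> b \<noteq> 0 \<Longrightarrow>
    v (at_t a + s * at_t b) * w (t - const c) = w (at_t a + s * at_t b) * v (t - const c)"
  proof (induction "Polynomial.degree a + Polynomial.degree b" arbitrary: a b rule: less_induct)
    case less
    have ne: "at_t a + s * at_t b \<noteq> 0" "at_t a - s * at_t b \<noteq> 0"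
      using norm_eq[of a b] norm_nonzero[OF less.prems] by auto
    consider "poly a c + d * poly b c \<noteq> 0" | "poly a c - d * poly b c \<noteq> 0"
      | "poly a c = 0" "poly b c = 0"
    proof -
      have "poly a c = 0 \<and> poly b c = 0"
        if z: "poly a c + d * poly b c = 0" "poly a c - d * poly b c = 0"
      proof -
        have "2 * poly a c = (poly a c + d * poly b c) + (poly a c - d * poly b c)" by simp
        then have "poly a c = 0" unfolding z by simp
        then show ?thesis using z(1) d(1) by simp
      qed
      then show thesis using that by blast
    qed
    then show ?case
    proof cases
      case 1
      then show ?thesis using vv[of a b] v.has_value_nonzero w.has_value_nonzero by simp
    next
      case 2
      then have "v (at_t a - s * at_t b) = 0" "w (at_t a - s * at_t b) = 0"
        using vv[of a "- b"] v.has_value_nonzero w.has_value_nonzero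
        by (auto simp: const.eval_by_uminus)
      then have "v (at_t a + s * at_t b) = v (at_t (a^2 - f * b^2))"
        "w (at_t a + s * at_t b) = w (at_t (a^2 - f * b^2))"
        using ne v.v_mult[of "at_t a + s * at_t b" "at_t a - s * at_t b"]
          w.v_mult[of "at_t a + s * at_t b" "at_t a - s * at_t b"] by (simp_all add: norm_eq)
      then show ?thesis
        using norm_nonzero[OF less.prems] v_at_t[OF vw(1) pos(1)] v_at_t[OF vw(2) pos(2)] by simp
    next
      case 3
      then obtain a' b' where ab: "a = [:- c, 1:] * a'" "b = [:- c, 1:] * b'"
        unfolding poly_eq_0_iff_dvd dvd_def by blast
      have deg: "Polynomial.degree ([:- c, 1:] * p) = Suc (Polynomial.degree p)" if "p \<noteq> 0" for p
        using that by (subst degree_mult_eq) auto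
      have ab0: "a' \<noteq> 0 \<or> b' \<noteq> 0" using less.prems ab by auto
      then have "Polynomial.degree a' + Polynomial.degree b' < Polynomial.degree a + Polynomial.degree b"
        unfolding ab using deg[of a'] deg[of b'] by (cases "a' = 0"; cases "b' = 0") auto
      note IH = less.hyps[OF this ab0]
      have eq: "at_t a + s * at_t b = (t - const c) * (at_t a' + s * at_t b')"
        unfolding ab const.eval_by_mult
        by (simp add: const.eval_by_pCons const.hom_uminus algebra_simps)
      then have ne': "at_t a' + s * at_t b' \<noteq> 0" using ne by auto
      have split: "v (at_t a + s * at_t b) = v (t - const c) + v (at_t a' + s * at_t b')"
        "w (at_t a + s * at_t b) = w (t - const c) + w (at_t a' + s * at_t b')"
        unfolding eq using ne' by (simp_all add: v.v_mult w.v_mult)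
      show ?thesis
        using IH mult.commute[of "v (t - const c)" "w (t - const c)"]
        unfolding split by (simp add: distrib_right)
    qed
  qed
qed (use pos in auto)

text \<open>The fibre over \<open>c\<close> has two points counted with multiplicity.\<close>

lemma fibre_bound:
  assumes v: "place F v" and t: "0 \<le> v t"
  obtains c v' where "place F v'" "0 < v (t - const c)" "0 \<le> v' t"
    "\<And>w. place F w \<Longrightarrow> 0 \<le> w t \<Longrightarrow>
      w (t - const c) \<le> (if w = v then 1 else 0) + (if w = v' then 1 else 0)"
proof -
  interpret v: function_place F v by (rule function_place[OF v])
  obtain c where c: "0 < v (t - const c)" using finite_place_centre[OF v t] by blast
  have finite: "0 \<le> w t" if "place F w" "0 < w (t - const c)" for w
  proof -
    interpret w: function_place F w by (rule function_place[OF that(1)])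
    have "w.has_value t c" using that(2) by (simp add: w.has_value_def w.vge_def)
    then show ?thesis using w.has_value_vge[of t c] by (simp add: w.vge_def)
  qed
  show ?thesis
  proof (cases "poly f c = 0")
    \<comment> \<open>A branch point carries one place, at which \<open>t - c\<close> has value 2.
      Taking \<open>v' = v\<close> counts it twice.\<close>
    case True
    obtain v0 where v0: "place F v0" "v0 (t - const c) = 2" by (rule place_ramified[OF True])
    then have "v0 = v" using place_over_root_unique[OF v0(1) v True] c by simp
    show ?thesis
    proof (rule that[OF v c t])
      fix w assume w: "place F w"
      show "w (t - const c) \<le> (if w = v then 1 else 0) + (if w = v then 1 else 0)"
        using place_over_root_unique[OF w v True _ c] v0 \<open>v0 = v\<close> by (cases "0 < w (t - const c)") auto
    qed
  next
    case False
    have value_s: "\<exists>b. b ^ 2 = poly f c \<and> function_place.has_value F w s b"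
      if w: "place F w" "0 < w (t - const c)" for w
    proof -
      interpret w: function_place F w by (rule function_place[OF w(1)])
      have "w.has_value t c" using w(2) by (simp add: w.has_value_def w.vge_def)
      then have fc: "w.has_value (s ^ 2) (poly f c)" unfolding s_square by (rule w.has_value_eval_by)
      then have "0 \<le> w s" using w.has_value_nonzero[OF fc False] by (simp add: w.v_power)
      then obtain b where b: "w.has_value s b" using residue[OF w(1), of s] by auto
      have "b ^ 2 = poly f c" using w.has_value_unique[OF w.has_value_power[OF b, of 2] fc] .
      with b show ?thesis by blast
    qed
    obtain b where b: "b ^ 2 = poly f c" "v.has_value s b" using value_s[OF v c] by blast
    have b0: "b \<noteq> 0" using b(1) False by auto
    have place_at: "\<exists>w. place F w \<and> w (t - const c) = 1 \<and> function_place.has_value F w s d"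
      if d: "d ^ 2 = poly f c" "d \<noteq> 0" for d
    proof -
      obtain w where w: "place F w" "w (t - const c) = 1" "0 < w (s - const d) \<or> s = const d"
        by (rule place_unramified[OF d])
      interpret w: function_place F w by (rule function_place[OF w(1)])
      have "w.has_value s d" using w(3) by (auto simp: w.has_value_def w.vge_def)
      with w show ?thesis by blast
    qed
    obtain v1 where v1: "place F v1" "v1 (t - const c) = 1" "function_place.has_value F v1 s b"
      using place_at[OF b(1) b0] by blast
    obtain v' where v': "place F v'" "v' (t - const c) = 1" "function_place.has_value F v' s (- b)"
      using place_at[of "- b"] b(1) b0 by auto
    have "v1 = v" using place_over_point_unique[OF v1(1) v _ c b0 v1(3) b(2)] v1(2) by simp
    show ?thesis
    proof (rule that[OF v'(1) c])
      show "0 \<le> v' t" using finite[OF v'(1)] v'(2) by simp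
      fix w assume w: "place F w"
      show "w (t - const c) \<le> (if w = v then 1 else 0) + (if w = v' then 1 else 0)"
      proof (cases "0 < w (t - const c)")
        case True
        then obtain d where d: "d ^ 2 = poly f c" "function_place.has_value F w s d"
          using value_s[OF w] by blast
        then have "d = b \<or> d = - b" using b(1) by (metis power2_eq_iff)
        then have "w = v \<or> w = v'"
          using place_over_point_unique[OF w v True c b0] place_over_point_unique[OF w v'(1) True _ _ d(2)]
            d b b0 v' by auto
        then show ?thesis using v1(2) \<open>v1 = v\<close> v'(2) by auto
      qed auto
    qed
  qed
qed

end

section \<open>Dimensions of Riemann--Roch spaces\<close>

interpretation V: vector_space "\<lambda>c (x::udom). const c * x"
  by unfold_locales (simp_all add: const_add const_mult algebra_simps)

text \<open>\<open>V.dim\<close> is a cardinality and equals 0 on spaces of infinite dimension, so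
  lower bounds for it require this predicate.\<close>

definition finite_dim :: "udom set \<Rightarrow> bool" where
  "finite_dim W \<longleftrightarrow> (\<exists>B. finite B \<and> W \<subseteq> V.span B)"

lemma finite_dim_subset: "finite_dim W \<Longrightarrow> U \<subseteq> W \<Longrightarrow> finite_dim U"
  unfolding finite_dim_def by blast

lemma finite_dim_basis:
  assumes "finite_dim W"
  obtains B where "finite B" "B \<subseteq> W" "V.independent B" "W \<subseteq> V.span B" "card B = V.dim W"
proof -
  obtain B where B: "B \<subseteq> W" "V.independent B" "W \<subseteq> V.span B" "card B = V.dim W"
    by (rule V.basis_exists)
  obtain C where "finite C" "W \<subseteq> V.span C" using assms by (auto simp: finite_dim_def)
  then have "finite B" using V.independent_span_bound[of C B] B by blast
  then show ?thesis using that B by blast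
qed

lemma independent_card_le_dim:
  assumes "finite_dim W" "V.independent B" "B \<subseteq> W"
  shows "card B \<le> V.dim W"
proof -
  obtain C where "finite C" "C \<subseteq> W" "V.independent C" "W \<subseteq> V.span C" "card C = V.dim W"
    by (rule finite_dim_basis[OF assms(1)])
  then show ?thesis using V.independent_span_bound[of C B] assms by auto
qed

lemma dim_subspace_strict:
  assumes "V.subspace U" "U \<subseteq> W" "x \<in> W" "x \<notin> U" "finite_dim W"
  shows "V.dim U + 1 \<le> V.dim W"
proof -
  obtain B where B: "finite B" "B \<subseteq> U" "V.independent B" "U \<subseteq> V.span B" "card B = V.dim U"
    by (rule finite_dim_basis[OF finite_dim_subset[OF assms(5,2)]])
  have "V.span B \<subseteq> U" using B(2) assms(1) by (rule V.span_minimal)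
  then have "x \<notin> V.span B" using assms(4) by blast
  then have "V.independent (insert x B)" using B(3) by (rule V.independent_insertI)
  then have "card (insert x B) \<le> V.dim W"
    using B(2) assms by (intro independent_card_le_dim) auto
  moreover have "x \<notin> B" using B(2) assms(4) by blast
  ultimately show ?thesis using B by simp
qed

lemma dim_codimension_one:
  assumes "finite_dim U" and codim: "\<And>y. y \<in> W \<Longrightarrow> \<exists>c. y - const c * x \<in> U"
  shows "finite_dim W" "V.dim W \<le> V.dim U + 1"
proof -
  obtain B where B: "finite B" "B \<subseteq> U" "V.independent B" "U \<subseteq> V.span B" "card B = V.dim U"
    by (rule finite_dim_basis[OF assms(1)])
  have sub: "W \<subseteq> V.span (insert x B)"
  proof
    fix y assume "y \<in> W"
    then obtain c where "y - const c * x \<in> U" using codim by blast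
    then have "y - const c * x \<in> V.span B" using B by blast
    then show "y \<in> V.span (insert x B)" unfolding V.span_insert by blast
  qed
  then show "finite_dim W" unfolding finite_dim_def using B(1) by blast
  have "V.dim W \<le> card (insert x B)" using sub B(1) by (intro V.dim_le_card) auto
  also have "\<dots> \<le> V.dim U + 1" using B by (simp add: card_insert_if)
  finally show "V.dim W \<le> V.dim U + 1" .
qed

lemma dim_mult_le:
  assumes "z \<noteq> 0" "\<And>x. x \<in> U \<Longrightarrow> z * x \<in> W" "finite_dim W"
  shows "V.dim U \<le> V.dim W"
proof -
  interpret lin: Vector_Spaces.linear "\<lambda>c x. const c * x" "\<lambda>c x. const c * x" "(*) z"
    by unfold_locales (simp_all add: algebra_simps)
  obtain B where B: "B \<subseteq> U" "V.independent B" "U \<subseteq> V.span B" "card B = V.dim U"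
    by (rule V.basis_exists)
  have inj: "inj_on ((*) z) A" for A using assms(1) by (simp add: inj_on_def)
  have "V.independent ((*) z ` B)"
    using B(2) inj by (rule lin.independent_injective_image)
  then have "card ((*) z ` B) \<le> V.dim W"
    using assms B by (intro independent_card_le_dim) auto
  then show ?thesis using B inj by (simp add: card_image)
qed

section \<open>Divisors and their degrees\<close>

lemma divisor_degree_add:
  assumes "divisor F D"
  shows "divisor_degree (D(v := D v + k)) = divisor_degree D + k"
proof -
  let ?S = "insert v {w. D w \<noteq> 0}"
  have fin: "finite ?S" using assms by (simp add: divisor_def)
  have "divisor_degree (D(v := D v + k)) = (\<Sum>w\<in>?S. (D(v := D v + k)) w)"
    unfolding divisor_degree_def using fin by (intro sum.mono_neutral_left) auto
  also have "\<dots> = (\<Sum>w\<in>?S. D w + (if w = v then k else 0))"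
    by (intro sum.cong) auto
  also have "\<dots> = (\<Sum>w\<in>?S. D w) + k"
    using fin by (simp add: sum.distrib)
  also have "(\<Sum>w\<in>?S. D w) = divisor_degree D"
    unfolding divisor_degree_def using fin by (intro sum.mono_neutral_right) auto
  finally show ?thesis .
qed

lemma divisor_update:
  assumes "divisor F D" "place F v" shows "divisor F (D(v := k))"
proof -
  have "{w. (D(v := k)) w \<noteq> 0} \<subseteq> insert v {w. D w \<noteq> 0}" by auto
  moreover have "finite (insert v {w. D w \<noteq> 0})" using assms(1) by (simp add: divisor_def)
  ultimately have "finite {w. (D(v := k)) w \<noteq> 0}" by (rule finite_subset)
  moreover have "place F w" if "(D(v := k)) w \<noteq> 0" for w
    using that assms by (cases "w = v") (simp_all add: divisor_def)
  ultimately show ?thesis unfolding divisor_def by blast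
qed

text \<open>An induction principle: \<open>E\<close> is reached from \<open>D\<close> by adding one
  place at a time. It serves both the finiteness of dimensions and the passage of Riemann's
  inequality to smaller divisors.\<close>

lemma divisor_climb:
  assumes "finite S" "\<forall>v\<in>S. place F v" "\<forall>v. D v \<le> E v" "\<forall>v. v \<notin> S \<longrightarrow> D v = E v"
    and "divisor F D" "R D"
    and step: "\<And>D v. divisor F D \<Longrightarrow> place F v \<Longrightarrow> R D \<Longrightarrow> R (D(v := D v + 1))"
  shows "R E"
  using assms(3-6)
proof (induction "\<Sum>v\<in>S. nat (E v - D v)" arbitrary: D rule: less_induct)
  case less
  show ?case
  proof (cases "D = E")
    case True
    then show ?thesis using less.prems(4) by simp
  next
    case False
    then obtain v where v: "D v \<noteq> E v" by blast
    then have vS: "v \<in> S" "D v < E v" using less.prems(1,2) by (auto simp: order_less_le)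
    let ?D = "D(v := D v + 1)"
    have "(\<Sum>w\<in>S. nat (E w - ?D w)) < (\<Sum>w\<in>S. nat (E w - D w))"
    proof (rule sum_strict_mono_ex1[OF assms(1)])
      show "\<forall>w\<in>S. nat (E w - ?D w) \<le> nat (E w - D w)" by (simp add: nat_mono)
      show "\<exists>w\<in>S. nat (E w - ?D w) < nat (E w - D w)" using vS by (intro bexI[of _ v]) auto
    qed
    moreover have "\<forall>w. ?D w \<le> E w" using less.prems(1) vS(2) by simp
    moreover have "\<forall>w. w \<notin> S \<longrightarrow> ?D w = E w" using less.prems(2) vS(1) by simp
    moreover have pv: "place F v" using vS(1) assms(2) by blast
    moreover have "divisor F ?D" using less.prems(3) pv by (rule divisor_update)
    moreover have "R ?D" using less.prems(3) pv less.prems(4) by (rule step)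
    ultimately show ?thesis by (intro less.hyps)
  qed
qed

section \<open>Riemann-Roch spaces of a double cover\<close>

context double_cover
begin

abbreviation L :: "((udom \<Rightarrow> int) \<Rightarrow> int) \<Rightarrow> udom set" where
  "L D \<equiv> riemann_roch_space F D"

lemma L_iff: "x \<in> L D \<longleftrightarrow> x \<in> F \<and> (x = 0 \<or> (\<forall>v. place F v \<longrightarrow> - D v \<le> v x))"
  by (auto simp: riemann_roch_space_def)

lemma L_subspace: "V.subspace (L D)"
proof (rule V.subspaceI)
  show "0 \<in> L D" by (simp add: L_iff)
next
  fix x y assume xy: "x \<in> L D" "y \<in> L D"
  have "x + y = 0 \<or> - D v \<le> v (x + y)" if v: "place F v" for v
  proof -
    interpret v: function_place F v by (rule function_place[OF v])
    have "v.vge (- D v) (x + y)" using xy v by (intro v.vge_add) (auto simp: L_iff v.vge_def)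
    then show ?thesis by (simp add: v.vge_def)
  qed
  then show "x + y \<in> L D" using xy by (auto simp: L_iff)
next
  fix c x assume x: "x \<in> L D"
  show "const c * x \<in> L D"
  proof (cases "c = 0 \<or> x = 0")
    case False
    have "- D v \<le> v (const c * x)" if v: "place F v" for v
    proof -
      interpret v: function_place F v by (rule function_place[OF v])
      show ?thesis using False x v by (simp add: v.v_mult L_iff)
    qed
    then show ?thesis using x by (auto simp: L_iff)
  qed (auto simp: L_iff)
qed

lemma L_mono: "(\<And>v. place F v \<Longrightarrow> D v \<le> E v) \<Longrightarrow> L D \<subseteq> L E"
  by (force simp: L_iff)

lemma L_add_place:
  assumes v: "place F v" and fin: "finite_dim (L D)"
  shows "finite_dim (L (D(v := D v + 1)))" "V.dim (L (D(v := D v + 1))) \<le> V.dim (L D) + 1"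
proof -
  interpret v: function_place F v by (rule function_place[OF v])
  let ?E = "D(v := D v + 1)"
  have "\<exists>x. \<forall>y\<in>L ?E. \<exists>c. y - const c * x \<in> L D"
  proof (cases "L ?E \<subseteq> L D")
    case True
    have "y - const 0 * 0 \<in> L D" if "y \<in> L ?E" for y using True that by auto
    then show ?thesis by blast
  next
    case False
    then obtain x where x: "x \<in> L ?E" "x \<notin> L D" by blast
    then have xF: "x \<in> F" "x \<noteq> 0" by (auto simp: L_iff)
    have "- D v - 1 \<le> v x" using x xF v by (auto simp: L_iff dest: spec[of _ v])
    moreover have "\<not> - D v \<le> v x"
    proof
      assume "- D v \<le> v x"
      then have "- D w \<le> w x" if "place F w" for w
        using x(1) xF that by (cases "w = v") (auto simp: L_iff dest: spec[of _ w])
      then show False using x(2) xF by (simp add: L_iff)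
    qed
    ultimately have vx: "v x = - D v - 1" by simp
    have "\<exists>c. y - const c * x \<in> L D" if y: "y \<in> L ?E" for y
    proof -
      have yF: "y \<in> F" using y by (simp add: L_iff)
      have "y = 0 \<or> - D v - 1 \<le> v y" using y v by (auto simp: L_iff dest: spec[of _ v])
      then have "y / x = 0 \<or> 0 \<le> v (y / x)"
        using yF xF vx v.v_divide[of y x] by (cases "y = 0") auto
      then obtain c where "v.has_value (y / x) c" using residue[OF v, of "y / x"] xF yF by auto
      then have "v.vge (v x + 1) (x * (y / x - const c))"
        using xF yF by (intro v.vge_mult) (auto simp: v.has_value_def v.vge_def)
      also have "x * (y / x - const c) = y - const c * x" using xF by (simp add: algebra_simps)
      finally have vge: "v.vge (- D v) (y - const c * x)" by (simp add: vx)
      have "const c * x \<in> L ?E" using L_subspace x(1) by (auto simp: V.subspace_def)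
      then have E: "y - const c * x \<in> L ?E" using L_subspace y by (intro V.subspace_diff)
      have "y - const c * x = 0 \<or> - D w \<le> w (y - const c * x)" if "place F w" for w
        using E that vge by (cases "w = v") (auto simp: L_iff v.vge_def dest: spec[of _ w])
      then have "y - const c * x \<in> L D" using E by (auto simp: L_iff)
      then show ?thesis ..
    qed
    then show ?thesis by blast
  qed
  then obtain x where "\<forall>y\<in>L ?E. \<exists>c. y - const c * x \<in> L D" by blast
  then show "finite_dim (L ?E)" "V.dim (L ?E) \<le> V.dim (L D) + 1"
    using dim_codimension_one[OF fin] by blast+
qed

end

section \<open>The genus of a hyperelliptic function field\<close>

locale hyperelliptic = double_cover +
  fixes g :: nat
  assumes degree_f: "Polynomial.degree f = 2 * g + 1"
begin

definition infinity :: "udom \<Rightarrow> int" where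
  "infinity = (SOME v. place F v \<and> v t = - 2 \<and> v s = - int (2 * g + 1))"

lemma infinity: "place F infinity" "infinity t = - 2" "infinity s = - int (2 * g + 1)"
proof -
  have "\<exists>v. place F v \<and> v t = - 2 \<and> v s = - int (2 * g + 1)"
    by (rule place_infinity[OF degree_f]) blast
  from someI_ex[OF this] show "place F infinity" "infinity t = - 2" "infinity s = - int (2 * g + 1)"
    by (simp_all add: infinity_def)
qed

sublocale inf: function_place F infinity
  by (rule function_place[OF infinity(1)])

lemma finite_place: "place F w \<Longrightarrow> w \<noteq> infinity \<Longrightarrow> 0 \<le> w t"
  using place_infinity_unique[of w infinity] infinity degree_f by force

definition pole :: "nat \<Rightarrow> (udom \<Rightarrow> int) \<Rightarrow> int" where
  "pole n = (\<lambda>_. 0)(infinity := int n)"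

lemma divisor_pole: "divisor F (pole n)"
  unfolding pole_def by (rule divisor_update[OF _ infinity(1)]) (simp add: divisor_def)

lemma degree_pole: "divisor_degree (pole n) = int n"
  using divisor_degree_add[of F "\<lambda>_. 0" infinity "int n"]
  by (simp add: pole_def divisor_def divisor_degree_def)

lemma v_poly_finite: "place F w \<Longrightarrow> w \<noteq> infinity \<Longrightarrow> a \<noteq> 0 \<Longrightarrow> 0 \<le> w (at_t a)"
proof -
  assume w: "place F w" "w \<noteq> infinity" and a: "a \<noteq> 0"
  obtain c where c: "0 < w (t - const c)" using finite_place_centre finite_place w by blast
  show ?thesis using v_at_t[OF w(1) c a] c by simp
qed

text \<open>There are enough places over \<open>e\<close> to force both numerators to vanish there.\<close>

lemma cancel_denominator:
  assumes x: "x \<in> F" "\<And>w. place F w \<Longrightarrow> w \<noteq> infinity \<Longrightarrow> x = 0 \<or> 0 \<le> w x"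
    and rep: "at_t c * x = at_t a + s * at_t b" "c \<noteq> 0" "poly c e = 0"
  shows "poly a e = 0 \<and> poly b e = 0"
proof -
  have vanish: "function_place.vge w n (at_t a + s * at_t b)"
    if w: "place F w" "w (t - const e) = n" "0 < n" for w n
  proof -
    interpret w: function_place F w by (rule function_place[OF w(1)])
    have "w.has_value t e" using w by (simp add: w.has_value_def w.vge_def)
    then have "0 \<le> w t" using w.has_value_vge[of t e] by (simp add: w.vge_def)
    then have "w \<noteq> infinity" using infinity(2) by auto
    then have "w.vge 0 x" using x(2)[OF w(1)] by (simp add: w.vge_def)
    moreover have "w.vge n (at_t c)"
    proof -
      have "w (at_t c) = int (Polynomial.order e c) * n"
        using v_at_t[OF w(1) _ rep(2), of e] w by simp
      moreover have "1 \<le> int (Polynomial.order e c)"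
        using rep(2,3) order_root[of c e] by simp
      ultimately show ?thesis using w(3) mult_right_mono[of 1 "int (Polynomial.order e c)" n]
        by (simp add: w.vge_def)
    qed
    ultimately show ?thesis
      using w.vge_mult[of "at_t c" x n 0] x(1) by (simp add: rep(1))
  qed
  show ?thesis
  proof (cases "poly f e = 0")
    \<comment> \<open>At the single place over a branch point \<open>t - e\<close> has value 2, so
      the sum has value at least 2. This gives \<open>a(e) = 0\<close>, hence value at least 2 for
      \<open>at_t a\<close>, and since \<open>s\<close> has value 1, at least 1 for
      \<open>at_t b\<close>.\<close>
    case True
    obtain w where w: "place F w" "w (t - const e) = 2" "w s = 1" by (rule place_ramified[OF True])
    interpret w: function_place F w by (rule function_place[OF w(1)])
    have te: "w.has_value t e" using w by (simp add: w.has_value_def w.vge_def)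
    have s0: "w.has_value s 0" using w by (simp add: w.has_value_def w.vge_def)
    have two: "w.vge 2 (at_t a + s * at_t b)" using vanish[OF w(1,2)] by simp
    have "w.has_value (at_t a + s * at_t b) (poly a e + 0 * poly b e)"
      using te s0 by (intro w.has_value_add w.has_value_mult w.has_value_eval_by)
    moreover have "w.has_value (at_t a + s * at_t b) 0"
      using two w.vge_mono[OF two, of 1] by (simp add: w.has_value_def)
    ultimately have a: "poly a e = 0" using w.has_value_unique by force
    have "w.vge 2 (at_t a)"
    proof (cases "a = 0")
      case False
      then have "1 \<le> int (Polynomial.order e a)" using a order_root[of a e] by simp
      then show ?thesis using v_at_t[OF w(1) _ False, of e] w by (simp add: w.vge_def)
    qed simp
    then have "w.vge 2 (at_t a + s * at_t b - at_t a)" using two by (intro w.vge_diff) auto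
    then have "w.vge 1 (at_t b)"
      using w(3) w.v_mult[of s "at_t b"] by (cases "b = 0") (simp_all add: w.vge_def)
    then have "w.has_value (at_t b) 0" by (simp add: w.has_value_def)
    then have "poly b e = 0" using w.has_value_unique w.has_value_eval_by[OF te] by blast
    then show ?thesis using a by simp
  next
    case False
    \<comment> \<open>Elsewhere there are two places, with residues \<open>d\<close> and
      \<open>- d\<close> of \<open>s\<close>, and both \<open>a(e) + d b(e)\<close> and
      \<open>a(e) - d b(e)\<close> vanish.\<close>
    define d where "d = csqrt (poly f e)"
    have d: "d ^ 2 = poly f e" "d \<noteq> 0" using False by (simp_all add: d_def)
    have zero: "poly a e + r * poly b e = 0" if r: "r ^ 2 = poly f e" "r \<noteq> 0" for r
    proof -
      obtain w where w: "place F w" "w (t - const e) = 1" "0 < w (s - const r) \<or> s = const r"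
        by (rule place_unramified[OF r])
      interpret w: function_place F w by (rule function_place[OF w(1)])
      have te: "w.has_value t e" using w by (simp add: w.has_value_def w.vge_def)
      have sr: "w.has_value s r" using w s_in by (auto simp: w.has_value_def w.vge_def)
      have "w.has_value (at_t a + s * at_t b) (poly a e + r * poly b e)"
        using te sr by (intro w.has_value_add w.has_value_mult w.has_value_eval_by)
      moreover have "w.has_value (at_t a + s * at_t b) 0"
        using vanish[OF w(1,2)] by (simp add: w.has_value_def)
      ultimately show ?thesis by (rule w.has_value_unique)
    qed
    have p: "poly a e + d * poly b e = 0" and m: "poly a e - d * poly b e = 0"
      using zero[of d] zero[of "- d"] d by auto
    have "2 * poly a e = (poly a e + d * poly b e) + (poly a e - d * poly b e)" by simp
    then have "poly a e = 0" unfolding p m by simp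
    then show ?thesis using p d(2) by simp
  qed
qed

text \<open>C[t] + s C[t] is integrally closed because \<open>f\<close> is squarefree. Concretely, a
  root of the denominator is a root of both numerators, and cancelling it lowers the degree.\<close>

lemma no_finite_poles:
  assumes x: "x \<in> F" "\<And>w. place F w \<Longrightarrow> w \<noteq> infinity \<Longrightarrow> x = 0 \<or> 0 \<le> w x"
  obtains a b where "x = at_t a + s * at_t b"
proof -
  have "\<exists>a b. x = at_t a + s * at_t b" if "at_t c * x = at_t a + s * at_t b" "c \<noteq> 0" for a b c
    using that
  proof (induction "Polynomial.degree c" arbitrary: a b c)
    case 0
    then obtain k where k: "c = [:k:]" by (metis degree_eq_zeroE)
    then have "k \<noteq> 0" using 0 by auto
    then have "x = const (inverse k) * (at_t c * x)"
      by (simp add: k const.eval_by_pCons const_inverse del: inverse_eq_divide)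
    also have "\<dots> = at_t (Polynomial.smult (inverse k) a) + s * at_t (Polynomial.smult (inverse k) b)"
      unfolding 0(2) by (simp add: const.eval_by_smult algebra_simps)
    finally show ?case by blast
  next
    case (Suc n)
    then have "\<not> constant (poly c)" by (simp add: constant_degree)
    then obtain e where e: "poly c e = 0" using fundamental_theorem_of_algebra by blast
    then have "poly a e = 0 \<and> poly b e = 0" using cancel_denominator x Suc by blast
    then obtain a' b' c' where abc: "a = [:- e, 1:] * a'" "b = [:- e, 1:] * b'" "c = [:- e, 1:] * c'"
      using e unfolding poly_eq_0_iff_dvd dvd_def by blast
    have e0: "at_t [:- e, 1:] \<noteq> 0" by simp
    have "at_t [:- e, 1:] * (at_t c' * x) = at_t [:- e, 1:] * (at_t a' + s * at_t b')"
      using Suc.prems(1) unfolding abc const.eval_by_mult by (simp only: mult_ac distrib_left)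
    then have "at_t c' * x = at_t a' + s * at_t b'" using e0 by simp
    moreover have c': "c' \<noteq> 0" using Suc.prems(2) abc by auto
    moreover have "n = Polynomial.degree c'"
      using Suc.hyps(2) c' unfolding abc by (subst (asm) degree_mult_eq) auto
    ultimately show ?case using Suc.hyps(1) by blast
  qed
  moreover obtain a b c where "c \<noteq> 0" "x = (at_t a + s * at_t b) / at_t c"
    using element_rep[OF x(1)] by blast
  then have "at_t c * x = at_t a + s * at_t b" "c \<noteq> 0" by simp_all
  ultimately show ?thesis using that by blast
qed

lemma infinity_poly: "a \<noteq> 0 \<Longrightarrow> infinity (at_t a) = - 2 * int (Polynomial.degree a)"
  using v_at_t_infinity[OF infinity(1)] infinity(2) by simp

text \<open>At infinity polynomials in \<open>t\<close> have even order, while \<open>s\<close>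
  times one has odd order at most \<open>- (2 g + 1)\<close>. Nothing cancels, so any part with
  \<open>s\<close> makes the pole too large.\<close>

lemma infinity_linear:
  assumes "a \<noteq> 0 \<or> b \<noteq> 0" "- 2 * int g \<le> infinity (at_t a + s * at_t b)"
  shows "b = 0 \<and> Polynomial.degree a \<le> g"
proof -
  have sb: "infinity (s * at_t b) = - int (2 * g + 1) - 2 * int (Polynomial.degree b)" if "b \<noteq> 0"
    using that infinity(3) by (simp add: inf.v_mult infinity_poly)
  have "b = 0"
  proof (rule ccontr)
    assume b: "b \<noteq> 0"
    consider "a = 0 \<or> infinity (s * at_t b) < infinity (at_t a)"
      | "a \<noteq> 0" "infinity (at_t a) < infinity (s * at_t b)"
    proof (cases "a = 0")
      case False
      then have "infinity (s * at_t b) \<noteq> infinity (at_t a)"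
        using infinity_poly[of a] sb[OF b] by presburger
      then have "infinity (s * at_t b) < infinity (at_t a) \<or> infinity (at_t a) < infinity (s * at_t b)"
        by linarith
      then show thesis using that False by blast
    qed (use that in blast)
    then show False
    proof cases
      case 1
      then have "infinity (s * at_t b + at_t a) = infinity (s * at_t b)"
        using b by (intro inf.v_add_dominant(2)) auto
      then show False using assms(2) sb[OF b] by (simp add: add.commute)
    next
      case 2
      then have "infinity (at_t a + s * at_t b) = infinity (at_t a)"
        using b by (intro inf.v_add_dominant(2)) auto
      then show False using assms(2) sb[OF b] 2 by simp
    qed
  qed
  then show ?thesis using assms infinity_poly[of a] by simp
qed

lemma L_pole_g: "L (pole (2 * g)) \<subseteq> V.span ((\<lambda>i. t ^ i) ` {..g})"
proof
  fix x assume x: "x \<in> L (pole (2 * g))"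
  then have "x \<in> F" by (simp add: L_iff)
  moreover have "x = 0 \<or> 0 \<le> w x" if w: "place F w" "w \<noteq> infinity" for w
  proof -
    have "x = 0 \<or> - pole (2 * g) w \<le> w x" using x w(1) unfolding L_iff by blast
    then show ?thesis using w(2) by (simp add: pole_def)
  qed
  ultimately obtain a b where ab: "x = at_t a + s * at_t b"
    by (rule no_finite_poles)
  show "x \<in> V.span ((\<lambda>i. t ^ i) ` {..g})"
  proof (cases "x = 0")
    case False
    then have "a \<noteq> 0 \<or> b \<noteq> 0" using ab by auto
    moreover have "- 2 * int g \<le> infinity (at_t a + s * at_t b)"
    proof -
      have "- pole (2 * g) infinity \<le> infinity x" using x False infinity(1) unfolding L_iff by blast
      then show ?thesis by (simp add: pole_def ab)
    qed
    ultimately have "b = 0 \<and> Polynomial.degree a \<le> g" by (rule infinity_linear)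
    then have "x = at_t (\<Sum>i\<le>g. Polynomial.monom (Polynomial.coeff a i) i)"
      unfolding ab by (simp add: poly_as_sum_of_monoms')
    also have "\<dots> = (\<Sum>i\<le>g. const (Polynomial.coeff a i) * t ^ i)"
      by (simp add: const.eval_by_sum const.eval_by_monom)
    also have "\<dots> \<in> V.span ((\<lambda>i. t ^ i) ` {..g})"
      by (intro V.span_sum V.span_scale V.span_base) auto
    finally show ?thesis .
  qed (simp add: V.span_zero)
qed

text \<open>The space of \<open>2 g\<close> times infinity is spanned by powers of \<open>t\<close>,
  and each added place costs at most one dimension. \<open>D\<close> lies below a divisor reached in
  this way.\<close>

lemma finite_dim_L:
  assumes "divisor F D" shows "finite_dim (L D)"
proof -
  define E where "E w = max (D w) (pole (2 * g) w)" for w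
  define S where "S = {w. D w \<noteq> 0} \<union> {w. pole (2 * g) w \<noteq> 0}"
  have S: "finite S" "\<forall>w\<in>S. place F w"
    using assms divisor_pole[of "2 * g"] by (auto simp: S_def divisor_def)
  have "finite_dim (L E)"
  proof (rule divisor_climb[OF S, of "pole (2 * g)" E])
    show "finite_dim (L (pole (2 * g)))" using L_pole_g unfolding finite_dim_def by blast
    show "finite_dim (L (D(v := D v + 1)))"
      if "divisor F D" "place F v" "finite_dim (L D)" for D v
      using that(2,3) by (rule L_add_place(1))
    show "\<forall>w. pole (2 * g) w \<le> E w" by (simp add: E_def)
    show "\<forall>w. w \<notin> S \<longrightarrow> pole (2 * g) w = E w" by (simp add: E_def S_def)
  qed (rule divisor_pole)
  moreover have "L D \<subseteq> L E" by (rule L_mono) (simp add: E_def)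
  ultimately show ?thesis by (rule finite_dim_subset)
qed

section \<open>Riemann's inequality\<close>

definition riemann :: "((udom \<Rightarrow> int) \<Rightarrow> int) \<Rightarrow> bool" where
  "riemann D \<longleftrightarrow> divisor_degree D - int (V.dim (L D)) + 1 \<le> int g"

text \<open>Adding a place raises the degree by one and the dimension by at most one, so the defect
  cannot fall.\<close>

lemma riemann_remove_place:
  assumes "divisor F D" "place F v" "riemann (D(v := D v + 1))"
  shows "riemann D"
  using assms L_add_place(2)[OF assms(2) finite_dim_L[OF assms(1)]] divisor_degree_add[OF assms(1), of v 1]
  by (simp add: riemann_def)

lemma riemann_mono:
  assumes D: "divisor F D" and E: "divisor F E" and le: "\<And>w. D w \<le> E w" and R: "riemann E"
  shows "riemann D"
proof -
  define S where "S = {w. D w \<noteq> 0} \<union> {w. E w \<noteq> 0}"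
  have S: "finite S" "\<forall>w\<in>S. place F w" using D E by (auto simp: S_def divisor_def)
  have "riemann E \<longrightarrow> riemann D"
  proof (rule divisor_climb[OF S, of D E "\<lambda>E. riemann E \<longrightarrow> riemann D"])
    show "riemann (D'(v := D' v + 1)) \<longrightarrow> riemann D"
      if "divisor F D'" "place F v" "riemann D' \<longrightarrow> riemann D" for D' v
      using that riemann_remove_place by blast
    show "\<forall>w. w \<notin> S \<longrightarrow> D w = E w" by (simp add: S_def)
  qed (use le D in simp_all)
  then show ?thesis using R by blast
qed

text \<open>Every even pole order at infinity is attained by a power of \<open>t\<close>, every odd
  one from \<open>2 g + 1\<close> on by some \<open>s * t ^ i\<close>. The \<open>g\<close> odd
  orders below \<open>2 g\<close> make up the term \<open>g\<close>.\<close>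

lemma dim_pole: "g \<le> n \<Longrightarrow> 2 * n + 1 \<le> V.dim (L (pole (2 * n))) + g"
proof -
  have strict: "V.dim (L (pole n)) + 1 \<le> V.dim (L (pole (Suc n)))"
    if x: "x \<in> F" "\<And>w. place F w \<Longrightarrow> w \<noteq> infinity \<Longrightarrow> 0 \<le> w x" "infinity x = - int (Suc n)" for x n
  proof (rule dim_subspace_strict[OF L_subspace _ _ _ finite_dim_L[OF divisor_pole], of _ _ x])
    have "x \<noteq> 0" using x(3) by auto
    then show "x \<in> L (pole (Suc n))" "x \<notin> L (pole n)"
      using x infinity(1) by (auto simp: L_iff pole_def)
    show "L (pole n) \<subseteq> L (pole (Suc n))" by (rule L_mono) (simp add: pole_def)
  qed
  have t_pow: "0 \<le> w (t ^ i)" if "place F w" "w \<noteq> infinity" for w i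
    using v_poly_finite[OF that, of "Polynomial.monom 1 i"]
    by (simp add: const.eval_by_monom monom_eq_0_iff)
  have s_fin: "0 \<le> w s" if "place F w" "w \<noteq> infinity" for w
    using v_poly_finite[OF that f_nonzero] v_s[OF that(1)] by simp
  have even: "V.dim (L (pole (2 * i + 1))) + 1 \<le> V.dim (L (pole (2 * i + 2)))" for i
  proof -
    have "infinity (t ^ (i + 1)) = - int (Suc (2 * i + 1))"
      using infinity(2) by (simp only: inf.v_power[OF t_in]) simp
    then show ?thesis
      using strict[of "t ^ (i + 1)" "2 * i + 1"] t_pow by (simp del: power_Suc)
  qed
  have odd: "V.dim (L (pole (2 * g + 2 * i))) + 1 \<le> V.dim (L (pole (2 * g + 2 * i + 1)))" for i
  proof -
    have "infinity (s * t ^ i) = - int (Suc (2 * g + 2 * i))"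
      using infinity(2,3) by (simp add: inf.v_mult inf.v_power)
    moreover have "0 \<le> w (s * t ^ i)" if w: "place F w" "w \<noteq> infinity" for w
    proof -
      interpret w: function_place F w by (rule function_place[OF w(1)])
      show ?thesis using t_pow[OF w] s_fin[OF w] by (simp add: w.v_mult)
    qed
    ultimately show ?thesis using strict[of "s * t ^ i" "2 * g + 2 * i"] by simp
  qed
  have mono: "V.dim (L (pole m)) \<le> V.dim (L (pole (Suc m)))" for m
  proof (rule dim_mult_le[of 1])
    have "L (pole m) \<subseteq> L (pole (Suc m))" by (rule L_mono) (simp add: pole_def)
    then show "1 * x \<in> L (pole (Suc m))" if "x \<in> L (pole m)" for x using that by auto
  qed (simp_all add: finite_dim_L divisor_pole)
  have zero: "1 \<le> V.dim (L (pole 0))"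
  proof -
    have "V.dim {0} + 1 \<le> V.dim (L (pole 0))"
    proof (rule dim_subspace_strict[OF V.subspace_single_0 _ _ _ finite_dim_L[OF divisor_pole]])
      show "{0} \<subseteq> L (pole 0)" by (simp add: L_iff)
      have "- pole 0 w \<le> w 1" if "place F w" for w
        using function_place.v_1[OF function_place[OF that]] by (simp add: pole_def)
      then show "1 \<in> L (pole 0)" unfolding L_iff using one_in by blast
    qed simp
    then show ?thesis by simp
  qed
  have low: "i + 1 \<le> V.dim (L (pole (2 * i)))" for i
  proof (induction i)
    case (Suc i)
    then show ?case using even[of i] mono[of "2 * i"] by simp
  qed (use zero in simp)
  have high: "g + 2 * i + 1 \<le> V.dim (L (pole (2 * g + 2 * i)))" for i
  proof (induction i)
    case (Suc i)
    then show ?case using even[of "g + i"] odd[of i] by simp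
  qed (use low[of g] in simp)
  show "g \<le> n \<Longrightarrow> 2 * n + 1 \<le> V.dim (L (pole (2 * n))) + g"
    using high[of "n - g"] by (simp add: algebra_simps)
qed

text \<open>Division by \<open>t - c\<close> trades the two places over \<open>c\<close> for a double pole at infinity.\<close>

lemma riemann_exchange:
  assumes D: "divisor F D" and v: "place F v" "v \<noteq> infinity"
    and R: "riemann (D(v := D v - 1, infinity := D infinity + 2))"
  shows "riemann D"
proof -
  obtain c v' where v': "place F v'" "0 \<le> v' t" and
    bound: "\<And>w. place F w \<Longrightarrow> 0 \<le> w t \<Longrightarrow>
      w (t - const c) \<le> (if w = v then 1 else 0) + (if w = v' then 1 else 0)"
    by (rule fibre_bound[OF v(1) finite_place[OF v]]) blast
  have v'_inf: "v' \<noteq> infinity" using v'(2) infinity(2) by auto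
  \<comment> \<open>\<open>Da\<close> and \<open>Db\<close> both have degree one above that of
    \<open>D\<close>, and multiplication by \<open>1 / (t - c)\<close> maps \<open>L Da\<close> into
    \<open>L Db\<close>. So the inequality passes from \<open>Da\<close> to \<open>Db\<close>, and
    from there down to \<open>D\<close>.\<close>
  define Da where "Da = D(v := D v - 1, infinity := D infinity + 2)"
  define Db where "Db = D(v' := D v' + 1)"
  have Dv: "divisor F (D(v := D v - 1))" using D v(1) by (rule divisor_update)
  have dDb: "divisor F Db" unfolding Db_def using D v'(1) by (rule divisor_update)
  have "divisor_degree (D(v := D v - 1)) = divisor_degree D - 1"
    using divisor_degree_add[OF D, of v "- 1"] by simp
  then have "divisor_degree Da = divisor_degree D + 1"
    using divisor_degree_add[OF Dv, of infinity 2] v(2) by (simp add: Da_def)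
  then have deg: "divisor_degree Da = divisor_degree Db"
    using divisor_degree_add[OF D, of v' 1] by (simp add: Db_def)
  have inf_tc: "infinity (t - const c) = - 2"
    using inf.v_add_dominant(2)[of t "- const c"] infinity(2) by (simp add: inf.v_uminus)
  have "V.dim (L Da) \<le> V.dim (L Db)"
  proof (rule dim_mult_le[of "inverse (t - const c)"])
    fix x assume x: "x \<in> L Da"
    have "- Db w \<le> w (inverse (t - const c) * x)" if w: "place F w" and x0: "x \<noteq> 0" for w
    proof -
      interpret w: function_place F w by (rule function_place[OF w])
      have "- Da w \<le> w x" using x x0 w by (auto simp: L_iff)
      moreover have "w (t - const c) \<le> Db w - Da w"
      proof (cases "w = infinity")
        case True
        then show ?thesis using inf_tc v(2) v'_inf by (auto simp: Da_def Db_def)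
      next
        case False
        then show ?thesis
          using bound[OF w finite_place[OF w False]] by (auto simp: Da_def Db_def split: if_splits)
      qed
      ultimately show ?thesis using x x0 by (simp add: w.v_mult w.v_inverse L_iff)
    qed
    then show "inverse (t - const c) * x \<in> L Db" using x by (auto simp: L_iff)
  qed (use finite_dim_L[OF dDb] in auto)
  then have "riemann Db" using R deg by (simp add: riemann_def Da_def)
  then show ?thesis using riemann_remove_place[OF D v'(1)] by (simp add: Db_def)
qed

text \<open>Induction on the total positive part away from infinity, which an exchange decreases.
  Once it is gone, \<open>D\<close> lies below a multiple of infinity.\<close>

lemma riemann_all:
  assumes "divisor F D" shows "riemann D"
proof -
  have "riemann D" if "finite S" "\<forall>w. 0 < D w \<and> w \<noteq> infinity \<longrightarrow> w \<in> S" "infinity \<notin> S"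
    "divisor F D" for S D
    using that(2,4)
  proof (induction "\<Sum>w\<in>S. nat (D w)" arbitrary: D rule: less_induct)
    case less
    show ?case
    proof (cases "\<exists>v. 0 < D v \<and> v \<noteq> infinity")
      case True
      then obtain v where v: "0 < D v" "v \<noteq> infinity" by blast
      then have vS: "v \<in> S" "place F v" using less.prems by (auto simp: divisor_def)
      let ?D = "D(v := D v - 1, infinity := D infinity + 2)"
      have "(\<Sum>w\<in>S. nat (?D w)) < (\<Sum>w\<in>S. nat (D w))"
      proof (rule sum_strict_mono_ex1[OF that(1)])
        show "\<forall>w\<in>S. nat (?D w) \<le> nat (D w)" using that(3) by (auto simp: nat_mono)
        show "\<exists>w\<in>S. nat (?D w) < nat (D w)" using vS v by (intro bexI[of _ v]) auto
      qed
      moreover have "\<forall>w. 0 < ?D w \<and> w \<noteq> infinity \<longrightarrow> w \<in> S"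
        using less.prems(1) vS(1) by auto
      moreover have "divisor F ?D"
        using less.prems(2) vS(2) infinity(1) by (intro divisor_update)
      ultimately have "riemann ?D" by (rule less.hyps)
      then show ?thesis using less.prems(2) vS(2) v(2) by (intro riemann_exchange[of D v])
    next
      case False
      \<comment> \<open>Chosen so that \<open>n \<ge> g\<close>, as the dimension bound requires,
        and \<open>2 n\<close> is at least the coefficient of \<open>D\<close> at infinity.\<close>
      define n where "n = max g (nat (D infinity))"
      have "riemann (pole (2 * n))"
        using dim_pole[of n] by (simp add: riemann_def degree_pole n_def)
      moreover have "D w \<le> pole (2 * n) w" for w
        using False by (cases "w = infinity") (auto simp: pole_def n_def not_less)
      ultimately show ?thesis using riemann_mono less.prems(2) divisor_pole by blast
    qed
  qed
  from this[of "{w. D w \<noteq> 0} - {infinity}" D] assms show ?thesis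
    by (auto simp: divisor_def)
qed

theorem genus: "field_genus F g"
proof -
  have dim: "riemann_roch_dim F D = V.dim (L D)" for D
    by (simp add: riemann_roch_dim_def)
  have "V.dim (L (pole (2 * g))) \<le> card ((\<lambda>i. t ^ i) ` {..g})"
    by (rule V.dim_le_card[OF L_pole_g]) simp
  also have "\<dots> \<le> g + 1" using card_image_le[of "{..g}" "\<lambda>i. t ^ i"] by simp
  finally have "divisor_degree (pole (2 * g)) - int (V.dim (L (pole (2 * g)))) + 1 = int g"
    using riemann_all[OF divisor_pole, of "2 * g"] by (simp add: riemann_def degree_pole)
  then show ?thesis
    using riemann_all divisor_pole unfolding field_genus_def dim riemann_def by blast
qed

end

section \<open>Double covers branched at four finite points\<close>

text \<open>For \<open>d = 1 / c\<close>, \<open>h = x (a0 + a1 x + a2 x^2 + a3 x^3)\<close> and its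
  reversal \<open>k\<close>, these say \<open>c^4 h(1/c) = k(c)\<close> and, after differentiation,
  \<open>c^3 h'(1/c) = 4 k(c) - c k'(c)\<close>.\<close>

lemma reverse_quartic:
  fixes c d :: "'a::field"
  assumes "c * d = 1"
  shows "d * (a0 + d * (a1 + d * (a2 + d * a3))) * c ^ 4 = a3 + c * (a2 + c * (a1 + c * a0))"
    and "(a0 + d * (2 * a1 + d * (3 * a2 + d * (4 * a3)))) * c ^ 3
      = 4 * (a3 + c * (a2 + c * (a1 + c * a0))) - c * (a2 + c * (2 * a1 + c * (3 * a0)))"
  using assms by Groebner_Basis.algebra+

context double_cover
begin

text \<open>Moving one of the four branch points to infinity leaves a cubic.\<close>

lemma genus_quartic:
  assumes deg: "Polynomial.degree f = 4"
  shows "field_genus F 1"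
proof -
  have "\<not> constant (poly f)" using deg by (simp add: constant_degree)
  then obtain e where e: "poly f e = 0" using fundamental_theorem_of_algebra by blast
  \<comment> \<open>The chosen branch point is put at 0, so \<open>h\<close> has no constant
    term.\<close>
  define h where "h = pcompose f [:e, 1:]"
  have h_deg: "Polynomial.degree h = 4" by (simp add: h_def degree_pcompose deg)
  define a where "a i = Polynomial.coeff h (Suc i)" for i
  have h0: "Polynomial.coeff h 0 = 0" using e by (simp add: h_def poly_pcompose flip: poly_0_coeff_0)
  have "h = [:0, a 0, a 1, a 2, a 3:]"
  proof (rule poly_eqI)
    fix n
    have "Polynomial.coeff h n = 0" if "4 < n" using that h_deg by (simp add: coeff_eq_0)
    then show "Polynomial.coeff h n = Polynomial.coeff [:0, a 0, a 1, a 2, a 3:] n"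
      using h0 by (auto simp: a_def coeff_pCons numeral_eq_Suc split: nat.split)
  qed
  note h = this
  have a3: "a 3 \<noteq> 0"
    using leading_coeff_0_iff[of h] h_deg by (auto simp: a_def numeral_eq_Suc)
  have simple_h: "poly (pderiv h) x \<noteq> 0" if "poly h x = 0" for x
    using that simple by (simp add: h_def poly_pcompose pderiv_pcompose pderiv_pCons simple_roots_def)
  have a0: "a 0 \<noteq> 0" using simple_h[of 0] by (simp add: h pderiv_pCons)
  \<comment> \<open>The reversal of \<open>h\<close>. It is a cubic because 0 is a simple root of
    \<open>h\<close>, which makes \<open>a 0\<close> nonzero.\<close>
  define k where "k = [:a 3, a 2, a 1, a 0:]"
  have k_deg: "Polynomial.degree k = 3" using a0 by (simp add: k_def)
  have "poly (pderiv k) c \<noteq> 0" if c: "poly k c = 0" for c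
  proof
    assume d: "poly (pderiv k) c = 0"
    have c0: "c \<noteq> 0" using c a3 by (auto simp: k_def)
    have "poly h (inverse c) * c ^ 4 = poly k c"
      using reverse_quartic(1)[of c "inverse c"] c0 by (simp add: h k_def del: inverse_eq_divide)
    then have h1: "poly h (inverse c) = 0" using c c0 by simp
    have "poly (pderiv h) (inverse c) * c ^ 3 = 4 * poly k c - c * poly (pderiv k) c"
      using reverse_quartic(2)[of c "inverse c"] c0
      by (simp add: h k_def pderiv_pCons del: inverse_eq_divide)
    then have "poly (pderiv h) (inverse c) = 0" using c d c0 by simp
    then show False using simple_h[OF h1] by simp
  qed
  then have simple_k: "simple_roots k" using k_deg by (simp add: simple_roots_def)
  \<comment> \<open>In the coordinate \<open>u = 1 / (t - e)\<close> the branch point lies at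
    infinity, and \<open>w^2 = u^4 f(t) = k(u)\<close>.\<close>
  define u where "u = inverse (t - const e)"
  define w where "w = s * u ^ 2"
  have u0: "u \<noteq> 0" by (simp add: u_def)
  have t_u: "t = const e + inverse u" by (simp add: u_def)
  have u_const: "u \<notin> range const"
  proof
    assume "u \<in> range const"
    then obtain c where "u = const c" by auto
    then have "t = const (e + inverse c)" using t_u by (simp add: const_add const_inverse)
    then show False using transcendental by simp
  qed
  have "at_t f = eval_by const h (t - const e)"
    by (simp add: h_def const.eval_by_pcompose const.eval_by_pCons)
  moreover have "t - const e = inverse u" by (simp add: u_def)
  ultimately have "w ^ 2 = eval_by const h (inverse u) * u ^ 4"
    by (simp add: w_def power_mult_distrib s_square flip: power_mult)
  also have "\<dots> = eval_by const k u"
    using reverse_quartic(1)[of u "inverse u"] u0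
    by (simp add: h k_def const.eval_by_pCons del: inverse_eq_divide)
  finally have "double_cover u w k"
    using u_const simple_k by (intro double_cover.intro)
  then interpret E: hyperelliptic u w k 1
    using k_deg by (intro hyperelliptic.intro hyperelliptic_axioms.intro) simp_all
  have "function_field u w = F"
  proof (rule function_field_eqI)
    show "u \<in> F" "w \<in> F" by (simp_all add: u_def w_def)
    show "t \<in> function_field u w" by (simp add: t_u)
    have "s = w * inverse (u ^ 2)" using u0 by (simp add: w_def)
    then show "s \<in> function_field u w" by simp
  qed
  then show ?thesis using E.genus by simp
qed

end

section \<open>Curves parametrised by a double cover\<close>

text \<open>Points with \<open>b = 0\<close> are left out because \<open>z\<close> and
  \<open>y\<close> have powers of \<open>s\<close> as denominators.\<close>

definition on_cover :: "complex poly \<Rightarrow> complex \<Rightarrow> complex \<Rightarrow> bool" where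
  "on_cover f a b \<longleftrightarrow> b ^ 2 = poly f a \<and> b \<noteq> 0"

context double_cover
begin

lemma place_at_point:
  assumes "on_cover f a b"
  obtains v where "place F v" "function_place.has_value F v t a" "function_place.has_value F v s b"
proof -
  obtain v where v: "place F v" "v (t - const a) = 1" "0 < v (s - const b) \<or> s = const b"
    using place_unramified[of b a] assms unfolding on_cover_def by blast
  interpret v: function_place F v by (rule function_place[OF v(1)])
  have "v.has_value t a" "v.has_value s b"
    using v(2,3) s_in by (auto simp: v.has_value_def v.vge_def)
  then show ?thesis using that v(1) by blast
qed

text \<open>Identities in the function field may be checked at complex points. If
  \<open>x = (a + b s) / c\<close> is not 0, its norm has finitely many zeros; over any other point
  that is not a branch point, \<open>a + b s\<close> has a nonzero residue, so \<open>x\<close>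
  cannot have residue 0.\<close>

lemma eq_0_if_values_0:
  assumes x: "x \<in> F"
    and val: "\<And>a b v. on_cover f a b \<Longrightarrow> place F v \<Longrightarrow> function_place.has_value F v t a \<Longrightarrow>
      function_place.has_value F v s b \<Longrightarrow> function_place.has_value F v x 0"
  shows "x = 0"
proof (rule ccontr)
  assume "x \<noteq> 0"
  obtain a b c where abc: "c \<noteq> 0" "x = (at_t a + s * at_t b) / at_t c"
    using element_rep[OF x] by blast
  then have ab: "a \<noteq> 0 \<or> b \<noteq> 0" using \<open>x \<noteq> 0\<close> by auto
  have "(a^2 - f * b^2) * f \<noteq> 0" using norm_nonzero[OF ab] by simp
  then have "finite {e. poly ((a^2 - f * b^2) * f) e = 0}" by (rule poly_roots_finite)
  then obtain e where e: "poly ((a^2 - f * b^2) * f) e \<noteq> 0"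
    using ex_new_if_finite[OF infinite_UNIV_char_0] by blast
  define d where "d = csqrt (poly f e)"
  have d: "on_cover f e d" using e by (auto simp: on_cover_def d_def)
  obtain v where v: "place F v" "function_place.has_value F v t e" "function_place.has_value F v s d"
    by (rule place_at_point[OF d])
  interpret v: function_place F v by (rule function_place[OF v(1)])
  have "v.has_value (at_t c * x) (poly c e * 0)"
    using v val[OF d v] by (intro v.has_value_mult v.has_value_eval_by)
  moreover have "at_t c * x = at_t a + s * at_t b" using abc by simp
  ultimately have "v.has_value (at_t a + s * at_t b) 0" by simp
  moreover have "v.has_value (at_t a + s * at_t b) (poly a e + d * poly b e)"
    using v by (intro v.has_value_add v.has_value_mult v.has_value_eval_by)
  ultimately have "poly a e + d * poly b e = 0" using v.has_value_unique by blast
  then have "poly a e ^ 2 = d ^ 2 * poly b e ^ 2"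
    by (simp add: add_eq_0_iff2 power_mult_distrib)
  then show False using e d by (simp add: on_cover_def)
qed

end

text \<open>After division by a power of \<open>z - c\<close>, the polynomial \<open>r(c, y)\<close> is nonzero and has too many roots.\<close>

lemma (in double_cover) low_degree_eq_0:
  assumes zy: "z \<in> F" "y \<in> F" "z \<noteq> const c"
    and B: "finite B" "Polynomial.degree r < card B"
    and val: "\<And>b. b \<in> B \<Longrightarrow> \<exists>v. place F v \<and> function_place.has_value F v z c \<and>
      function_place.has_value F v y b"
  shows "eval2 r z y = 0 \<Longrightarrow> r = 0"
  using B(2)
\<comment> \<open>Cancelling \<open>z - c\<close> keeps the degree in \<open>y\<close> and lowers
  the degree in \<open>z\<close> of the leading coefficient.\<close>
proof (induction "Polynomial.degree (Polynomial.lead_coeff r)" arbitrary: r rule: less_induct)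
  case less
  define p where "p = map_poly (\<lambda>a. poly a c) r"
  show ?case
  proof (rule ccontr)
    assume r: "r \<noteq> 0"
    have coeff_p: "Polynomial.coeff p i = poly (Polynomial.coeff r i) c" for i
      by (simp add: p_def coeff_map_poly)
    have root: "poly p b = 0" if b: "b \<in> B" for b
    proof -
      obtain v where v: "place F v" "function_place.has_value F v z c" "function_place.has_value F v y b"
        using val[OF b] by blast
      interpret v: function_place F v by (rule function_place[OF v(1)])
      have "v.has_value 0 (eval2_by (\<lambda>c. c) r c b)"
        using v.has_value_eval2[OF v(2,3), of r] less.prems(1) by simp
      then have "eval2_by (\<lambda>c. c) r c b = 0"
        using v.has_value_unique v.has_value_const[of 0] by force
      then show ?thesis by (simp add: eval2_by_def eval_by_def p_def)
    qed
    have "p = 0"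
    proof (rule ccontr)
      assume p: "p \<noteq> 0"
      have "card B \<le> card {b. poly p b = 0}"
        using root by (intro card_mono poly_roots_finite[OF p]) auto
      also have "\<dots> \<le> Polynomial.degree p" by (rule card_poly_roots_bound[OF p])
      also have "\<dots> \<le> Polynomial.degree r" by (rule degree_le) (simp add: coeff_p coeff_eq_0)
      finally show False using less.prems(2) by simp
    qed
    then have "[:- c, 1:] dvd Polynomial.coeff r i" for i
      using coeff_p[of i] by (simp add: poly_eq_0_iff_dvd)
    then have "[:[:- c, 1:]:] dvd r" by (simp add: const_poly_dvd_iff)
    then obtain r' where r': "r = [:[:- c, 1:]:] * r'" by (auto elim: dvdE)
    then have "r' \<noteq> 0" using r by auto
    have lead: "Polynomial.lead_coeff r = [:- c, 1:] * Polynomial.lead_coeff r'"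
      unfolding r' by (subst lead_coeff_mult) simp
    then have "Polynomial.degree (Polynomial.lead_coeff r') < Polynomial.degree (Polynomial.lead_coeff r)"
      unfolding lead using \<open>r' \<noteq> 0\<close> by (subst degree_mult_eq) auto
    moreover have "eval2 r z y = (z - const c) * eval2 r' z y"
      unfolding r' eval2_eq const.outer.hom_mult
      by (simp add: const.eval2_by_pCons const.eval_by_pCons const.hom_uminus const.outer.hom_zero)
    then have "eval2 r' z y = 0" using less.prems(1) zy(3) by simp
    moreover have "Polynomial.degree r' < card B"
      using less.prems(2) \<open>r' \<noteq> 0\<close> unfolding r' by (subst (asm) degree_mult_eq) auto
    ultimately have "r' = 0" by (rule less.hyps)
    then show False using \<open>r' \<noteq> 0\<close> by simp
  qed
qed

lemma exists_double_cover:
  assumes "simple_roots f" obtains t s where "double_cover t s f"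
proof -
  define t :: udom where "t = to_ac (to_fract [:0, 1:])"
  have "t \<notin> range const"
  proof
    assume "t \<in> range const"
    then obtain c where "to_fract [:0, 1:] = to_fract [:c:]" by (auto simp: t_def const_def)
    then have "[:0, 1:] = [:c:]" by (simp only: to_fract_eq_iff)
    then show False by simp
  qed
  moreover obtain s where "s ^ 2 = eval_by const f t"
    using nth_root_exists[of 2 "eval_by const f t"] by auto
  ultimately have "double_cover t s f" using assms by (intro double_cover.intro)
  then show ?thesis by (rule that)
qed

lemma genus_of_double_cover:
  assumes "double_cover t s f"
    and "Polynomial.degree f = 2 * n + 1 \<or> Polynomial.degree f = 4 \<and> n = 1"
  shows "field_genus (function_field t s) n"
proof -
  interpret double_cover t s f by (rule assms(1))
  show ?thesis
  proof (cases "Polynomial.degree f = 4 \<and> n = 1")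
    case True
    then show ?thesis using genus_quartic by simp
  next
    case False
    then interpret H: hyperelliptic t s f n
      using assms by (intro hyperelliptic.intro hyperelliptic_axioms.intro) blast+
    show ?thesis by (rule H.genus)
  qed
qed

text \<open>The quotient \<open>W / U\<close> recovers \<open>t\<close>, so the parametrisation \<open>z = Q(t) / s\<close>, \<open>y = M(t) / s\<^sup>3\<close> is
  birational.\<close>

lemma curve_genus_parametrized:
  fixes m :: bpoly
  assumes f: "simple_roots f" "Polynomial.degree f = 2 * n + 1 \<or> Polynomial.degree f = 4 \<and> n = 1"
    and m: "Polynomial.lead_coeff m = 1" and k: "0 < k"
    and Q: "Q \<noteq> 0"
    and vanish: "\<And>a b. on_cover f a b \<Longrightarrow> eval2_by (\<lambda>c. c) m (poly Q a / b) (poly M a / b ^ 3) = 0"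
    and inverse: "\<And>a b. on_cover f a b \<Longrightarrow> a * eval2_by (\<lambda>c. c) U (poly Q a / b) (poly M a / b ^ 3)
      = eval2_by (\<lambda>c. c) W (poly Q a / b) (poly M a / b ^ 3)"
    and U: "on_cover f a0 b0" "eval2_by (\<lambda>c. c) U (poly Q a0 / b0) (poly M a0 / b0 ^ 3) \<noteq> 0"
    and B: "finite B" "Polynomial.degree m \<le> card B"
      "\<And>y. y \<in> B \<Longrightarrow> \<exists>a b. on_cover f a b \<and> poly Q a / b = z0 \<and> poly M a / b ^ 3 = y"
  shows "curve_genus (m ^ k) n"
proof -
  obtain t s where cover: "double_cover t s f" by (rule exists_double_cover[OF f(1)])
  interpret double_cover t s f by (rule cover)
  define z where "z = at_t Q / s"
  define y where "y = at_t M / s ^ 3"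
  have zy [simp]: "z \<in> F" "y \<in> F" by (simp_all add: z_def y_def)
  have zy_val: "function_place.has_value F v z (poly Q a / b)"
      "function_place.has_value F v y (poly M a / b ^ 3)"
    if "on_cover f a b" "place F v" "function_place.has_value F v t a" "function_place.has_value F v s b"
    for v a b
  proof -
    interpret v: function_place F v by (rule function_place[OF that(2)])
    show "v.has_value z (poly Q a / b)" "v.has_value y (poly M a / b ^ 3)"
      using that unfolding z_def y_def on_cover_def
      by (auto intro!: v.has_value_divide v.has_value_power v.has_value_eval_by)
  qed
  have m0: "eval2 m z y = 0"
  proof (rule eq_0_if_values_0)
    fix a b v assume p: "on_cover f a b" "place F v"
      "function_place.has_value F v t a" "function_place.has_value F v s b"
    interpret v: function_place F v by (rule function_place[OF p(2)])
    show "v.has_value (eval2 m z y) 0"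
      using v.has_value_eval2[OF zy_val[OF p], of m] vanish[OF p(1)] by simp
  qed simp
  have t_rel: "t * eval2 U z y - eval2 W z y = 0"
  proof (rule eq_0_if_values_0)
    fix a b v assume p: "on_cover f a b" "place F v"
      "function_place.has_value F v t a" "function_place.has_value F v s b"
    interpret v: function_place F v by (rule function_place[OF p(2)])
    let ?e = "\<lambda>g. eval2_by (\<lambda>c. c) g (poly Q a / b) (poly M a / b ^ 3)"
    have "v.has_value (t * eval2 U z y + const (- 1) * eval2 W z y) (a * ?e U + - 1 * ?e W)"
      using p zy_val[OF p]
      by (intro v.has_value_add v.has_value_mult v.has_value_eval2 v.has_value_const)
    then show "v.has_value (t * eval2 U z y - eval2 W z y) 0"
      using inverse[OF p(1)] by (simp add: const.hom_uminus)
  qed simp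
  have U0: "eval2 U z y \<noteq> 0"
  proof -
    obtain v where v: "place F v" "function_place.has_value F v t a0" "function_place.has_value F v s b0"
      by (rule place_at_point[OF U(1)])
    interpret v: function_place F v by (rule function_place[OF v(1)])
    show ?thesis using v.has_value_nonzero[OF v.has_value_eval2[OF zy_val[OF U(1) v]] U(2)] by simp
  qed
  interpret K: const_subfield "function_field z y" by (rule const_subfield_function_field)
  have [simp]: "z \<in> function_field z y" "y \<in> function_field z y"
    by (rule generators_in_function_field)+
  have "t = eval2 W z y / eval2 U z y" using t_rel U0 by (simp add: field_simps)
  then have tK: "t \<in> function_field z y" by simp
  have z0: "z \<noteq> 0" using Q by (simp add: z_def)
  have "s = at_t Q / z" using Q by (simp add: z_def)
  then have sK: "s \<in> function_field z y" using tK by simp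
  have FK: "function_field z y = F" using tK sK by (intro function_field_eqI) simp_all
  have z_const: "z \<noteq> const c" for c
  proof
    assume "z = const c"
    then have "at_t Q + s * at_t [:- c:] = 0"
      by (simp add: z_def const.eval_by_pCons const.hom_uminus field_simps)
    then show False using Q independent by blast
  qed
  have points: "\<exists>v. place F v \<and> function_place.has_value F v z z0 \<and> function_place.has_value F v y b"
    if b: "b \<in> B" for b
  proof -
    obtain a' b' where p: "on_cover f a' b'" "poly Q a' / b' = z0" "poly M a' / b' ^ 3 = b"
      using B(3)[OF b] by blast
    obtain v where "place F v" "function_place.has_value F v t a'" "function_place.has_value F v s b'"
      by (rule place_at_point[OF p(1)])
    then show ?thesis using zy_val[OF p(1)] p(2,3) by blast
  qed
  \<comment> \<open>Pseudo-division by the monic \<open>m\<close> is true division. The remainder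
    vanishes at \<open>(z, y)\<close> and has degree below the number of points in the fibre over
    \<open>z0\<close>.\<close>
  have m_dvd: "m dvd h" if h: "eval2 h z y = 0" for h
  proof -
    obtain q r where qr: "pseudo_divmod h m = (q, r)" by (cases "pseudo_divmod h m")
    have "m \<noteq> 0" using m by auto
    then have "h = m * q + r" "r = 0 \<or> Polynomial.degree r < Polynomial.degree m"
      using pseudo_divmod[OF _ qr] m by auto
    moreover from this have "eval2 r z y = 0"
      using h m0 by (simp add: eval2_eq const.outer.homs)
    moreover have "r = 0" if "Polynomial.degree r < Polynomial.degree m" "eval2 r z y = 0"
      using low_degree_eq_0[OF zy z_const B(1) _ points that(2)] that(1) B(2) by simp
    ultimately have "r = 0" by blast
    then show ?thesis using \<open>h = m * q + r\<close> by simp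
  qed
  have "generic_point (m ^ k) z y"
    unfolding generic_point_def
  proof (intro allI iffI)
    fix h assume "eval2 h z y = 0"
    then have "m ^ k dvd h ^ k" using m_dvd by (intro dvd_power_same)
    then show "\<exists>j. m ^ k dvd h ^ j" ..
  next
    fix h assume "\<exists>j. m ^ k dvd h ^ j"
    then obtain j l where j: "h ^ j = m ^ k * l" by (auto elim: dvdE)
    have "eval2 (h ^ j) z y = eval2 (m ^ k * l) z y" unfolding j ..
    then have "eval2 h z y ^ j = 0"
      using m0 k by (simp add: eval2_eq const.outer.homs)
    then show "eval2 h z y = 0" by simp
  qed
  moreover have "field_genus (function_field z y) n"
    unfolding FK using genus_of_double_cover[OF cover f(2)] .
  ultimately show ?thesis unfolding curve_genus_def by blast
qed

section \<open>Derivatives and degrees of bivariate polynomials\<close>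

text \<open>Complex polynomials are determined by their values. This reduces the large identities to
  equations between complex numbers, which a Groebner basis computation decides.\<close>

lemma bpoly_eqI:
  assumes "\<And>z y. eval2_by (\<lambda>c. c) g z y = eval2_by (\<lambda>c. c) h z y"
  shows "g = h"
proof (rule poly_eqI)
  fix n
  have "poly (map_poly (\<lambda>a. poly a z) g) = poly (map_poly (\<lambda>a. poly a z) h)" for z
    using assms[of z] by (auto simp: eval2_by_def eval_by_def fun_eq_iff)
  then have "map_poly (\<lambda>a. poly a z) g = map_poly (\<lambda>a. poly a z) h" for z
    by (simp add: poly_eq_poly_eq_iff)
  then have "Polynomial.coeff (map_poly (\<lambda>a. poly a z) g) n = Polynomial.coeff (map_poly (\<lambda>a. poly a z) h) n" for z
    by simp
  then have "poly (Polynomial.coeff g n) = poly (Polynomial.coeff h n)"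
    by (auto simp: coeff_map_poly fun_eq_iff)
  then show "Polynomial.coeff g n = Polynomial.coeff h n"
    by (simp add: poly_eq_poly_eq_iff)
qed

lemma pderiv_z_pCons: "pderiv_z (pCons a g) = pCons (pderiv a) (pderiv_z g)"
  by (simp add: pderiv_z_def map_poly_pCons)

lemma pderiv_z_0: "pderiv_z 0 = 0"
  by (simp add: pderiv_z_def)

lemma pderiv_z_add: "pderiv_z (g + h) = pderiv_z g + pderiv_z h"
proof (induction g arbitrary: h)
  case (pCons a g)
  obtain b r where "h = pCons b r" by (cases h)
  then show ?case using pCons(2)[of r] by (simp add: pderiv_z_pCons pderiv_add)
qed (simp add: pderiv_z_0)

lemma pderiv_z_smult: "pderiv_z (Polynomial.smult a g)
    = Polynomial.smult (pderiv a) g + Polynomial.smult a (pderiv_z g)"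
  by (induction g) (simp_all add: pderiv_z_pCons pderiv_z_0 pderiv_mult algebra_simps)

lemma pderiv_z_mult: "pderiv_z (g * h) = pderiv_z g * h + g * pderiv_z h"
  by (induction g) (simp_all add: pderiv_z_pCons pderiv_z_0 pderiv_z_add pderiv_z_smult algebra_simps)

lemma pderiv_z_uminus: "pderiv_z (- g) = - pderiv_z g"
  using pderiv_z_add[of g "- g"] by (simp add: pderiv_z_0 add_eq_0_iff)

lemma pderiv_z_diff: "pderiv_z (g - h) = pderiv_z g - pderiv_z h"
  using pderiv_z_add[of g "- h"] by (simp add: pderiv_z_uminus)

lemma pderiv_z_cst: "pderiv_z (cst c) = 0"
  by (simp add: cst_def pderiv_z_pCons pderiv_z_0)

lemma pderiv_z_Z: "pderiv_z Z = 1"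
  by (simp add: Z_def pderiv_z_pCons pderiv_z_0 pderiv_pCons one_pCons)

lemma pderiv_z_Y: "pderiv_z Y = 0"
  by (simp add: Y_def pderiv_z_pCons pderiv_z_0 one_pCons pderiv_pCons)

lemma pderiv_z_power: "pderiv_z (g ^ Suc n) = of_nat (Suc n) * g ^ n * pderiv_z g"
  by (induction n) (simp_all add: pderiv_z_mult algebra_simps)

lemma pderiv_z_power_numeral:
  "pderiv_z (g ^ numeral k) = numeral k * g ^ pred_numeral k * pderiv_z g"
  by (simp only: numeral_eq_Suc pderiv_z_power) (simp flip: numeral_eq_Suc)

lemma pderiv_y_power_numeral:
  "pderiv_y (g ^ numeral k) = numeral k * g ^ pred_numeral k * pderiv_y g"
proof -
  have "pderiv (g ^ Suc n) = of_nat (Suc n) * g ^ n * pderiv g" for n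
    by (induction n) (simp_all add: pderiv_mult algebra_simps)
  then show ?thesis
    unfolding pderiv_y_def by (simp only: numeral_eq_Suc) (simp flip: numeral_eq_Suc)
qed

lemma pderiv_y_simps:
  "pderiv_y (g + h) = pderiv_y g + pderiv_y h" "pderiv_y (g - h) = pderiv_y g - pderiv_y h"
  "pderiv_y (- g) = - pderiv_y g" "pderiv_y (g * h) = pderiv_y g * h + g * pderiv_y h"
  "pderiv_y (cst c) = 0" "pderiv_y Z = 0" "pderiv_y Y = 1"
  by (simp_all add: pderiv_y_def pderiv_add pderiv_diff pderiv_minus pderiv_mult cst_def Z_def Y_def
      pderiv_pCons algebra_simps flip: one_pCons)

lemmas derivative_simps = pderiv_z_add pderiv_z_diff pderiv_z_uminus pderiv_z_mult pderiv_z_cst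
  pderiv_z_Z pderiv_z_Y pderiv_z_power_numeral pderiv_y_simps pderiv_y_power_numeral

text \<open>Weights \<open>(1, 1)\<close> bound the total degree, weights \<open>(0, 1)\<close> the
  degree in \<open>y\<close>. The closure rules read such bounds off an expression without expanding
  it.\<close>

definition weight_le :: "nat \<Rightarrow> nat \<Rightarrow> nat \<Rightarrow> bpoly \<Rightarrow> bool" where
  "weight_le a b n g \<longleftrightarrow>
    (\<forall>i j. Polynomial.coeff (Polynomial.coeff g j) i \<noteq> 0 \<longrightarrow> a * i + b * j \<le> n)"

lemma weight_le_mono: "weight_le a b m g \<Longrightarrow> m \<le> n \<Longrightarrow> weight_le a b n g"
  unfolding weight_le_def by (meson le_trans)

lemma weight_le_add: "weight_le a b n g \<Longrightarrow> weight_le a b n h \<Longrightarrow> weight_le a b n (g + h)"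
  unfolding weight_le_def by (metis add_0 coeff_add)

lemma weight_le_uminus: "weight_le a b n g \<Longrightarrow> weight_le a b n (- g)"
  unfolding weight_le_def by simp

lemma weight_le_diff: "weight_le a b n g \<Longrightarrow> weight_le a b n h \<Longrightarrow> weight_le a b n (g - h)"
  using weight_le_add[of a b n g "- h"] weight_le_uminus by simp

lemma weight_le_mult:
  assumes "weight_le a b m g" "weight_le a b n h" "m + n \<le> k"
  shows "weight_le a b k (g * h)"
  unfolding weight_le_def
proof (intro allI impI)
  fix i j assume "Polynomial.coeff (Polynomial.coeff (g * h) j) i \<noteq> 0"
  then have "(\<Sum>l\<le>j. Polynomial.coeff (Polynomial.coeff g l * Polynomial.coeff h (j - l)) i) \<noteq> 0"
    by (simp add: coeff_mult coeff_sum)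
  then obtain l where l: "l \<le> j"
      "Polynomial.coeff (Polynomial.coeff g l * Polynomial.coeff h (j - l)) i \<noteq> 0"
    by (auto elim: sum.not_neutral_contains_not_neutral)
  then have "(\<Sum>r\<le>i. Polynomial.coeff (Polynomial.coeff g l) r
      * Polynomial.coeff (Polynomial.coeff h (j - l)) (i - r)) \<noteq> 0"
    by (simp add: coeff_mult)
  then obtain r where r: "r \<le> i" "Polynomial.coeff (Polynomial.coeff g l) r \<noteq> 0"
      "Polynomial.coeff (Polynomial.coeff h (j - l)) (i - r) \<noteq> 0"
    by (auto elim: sum.not_neutral_contains_not_neutral)
  then have "a * r + b * l \<le> m" "a * (i - r) + b * (j - l) \<le> n"
    using assms(1,2) by (auto simp: weight_le_def)
  moreover have "a * i = a * r + a * (i - r)" "b * j = b * l + b * (j - l)"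
    using r(1) l(1) by (simp_all flip: distrib_left)
  ultimately show "a * i + b * j \<le> k" using assms(3) by linarith
qed

lemma weight_le_cst: "weight_le a b n (cst c)"
  unfolding weight_le_def cst_def by (auto simp: coeff_pCons split: nat.splits)

lemma weight_le_1: "weight_le a b n 1"
  using weight_le_cst[of a b n 1] by (simp add: cst_def one_pCons)

lemma weight_le_Z: "a \<le> n \<Longrightarrow> weight_le a b n Z"
  unfolding weight_le_def Z_def by (auto simp: coeff_pCons split: nat.splits)

lemma weight_le_Y: "b \<le> n \<Longrightarrow> weight_le a b n Y"
  unfolding weight_le_def Y_def by (auto simp: coeff_pCons split: nat.splits)

lemma weight_le_power:
  assumes "weight_le a b m g" "m * k \<le> n" shows "weight_le a b n (g ^ k)"
proof -
  have "weight_le a b (m * k) (g ^ k)"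
    by (induction k) (auto intro: weight_le_1 weight_le_mult assms(1))
  then show ?thesis using assms(2) by (rule weight_le_mono)
qed

lemma total_degree_eqI:
  assumes "weight_le 1 1 n g" "Polynomial.coeff (Polynomial.coeff g j) i \<noteq> 0" "i + j = n"
  shows "total_degree g = n"
proof -
  let ?S = "{i + j |i j. Polynomial.coeff (Polynomial.coeff g j) i \<noteq> 0}"
  have sub: "insert 0 ?S \<subseteq> {..n}" using assms(1) by (auto simp: weight_le_def)
  have "n \<in> insert 0 ?S" using assms(2,3) by auto
  then show ?thesis
    unfolding total_degree_def using sub finite_subset[OF sub] by (intro Max_eqI) auto
qed

lemma degree_eqI_y:
  assumes "weight_le 0 1 n g" "Polynomial.coeff g n = 1"
  shows "Polynomial.degree g = n" "Polynomial.lead_coeff g = 1"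
proof -
  have "Polynomial.degree g \<le> n"
  proof (rule degree_le, intro allI impI)
    fix j assume "n < j"
    then have "Polynomial.coeff (Polynomial.coeff g j) i = 0" for i
      using assms(1) unfolding weight_le_def by fastforce
    then show "Polynomial.coeff g j = 0" by (intro poly_eqI) simp
  qed
  moreover have "n \<le> Polynomial.degree g" using assms(2) by (intro le_degree) simp
  ultimately show "Polynomial.degree g = n" by simp
  then show "Polynomial.lead_coeff g = 1" using assms(2) by simp
qed

lemma coeff_y_simps:
  "Polynomial.coeff (cst c * g) n = [:c:] * Polynomial.coeff g n"
  "Polynomial.coeff (g * Z) n = Polynomial.coeff g n * Polynomial.monom 1 1"
  "Polynomial.coeff (g * Z ^ k) n = Polynomial.coeff g n * Polynomial.monom 1 k"
  "Polynomial.coeff (cst c) n = (if n = 0 then [:c:] else 0)"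
  "Polynomial.coeff Z n = (if n = 0 then Polynomial.monom 1 1 else 0)"
  "Polynomial.coeff (Z ^ k) n = (if n = 0 then Polynomial.monom 1 k else 0)"
  "Polynomial.coeff Y n = (if n = 1 then 1 else 0)"
  "Polynomial.coeff (Y ^ k) n = (if n = k then 1 else 0)"
proof -
  have Zk: "Z ^ k = [:Polynomial.monom 1 k:]" for k
    by (simp add: Z_def poly_const_pow monom_altdef)
  have Z1: "Z = [:Polynomial.monom 1 1:]" using Zk[of 1] by simp
  show "Polynomial.coeff (cst c * g) n = [:c:] * Polynomial.coeff g n" by (simp add: cst_def)
  show "Polynomial.coeff (g * Z ^ k) n = Polynomial.coeff g n * Polynomial.monom 1 k"
    unfolding Zk by (simp add: mult.commute[of g] mult.commute[of _ "Polynomial.monom 1 k"])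
  show "Polynomial.coeff (g * Z) n = Polynomial.coeff g n * Polynomial.monom 1 1"
    unfolding Z1 by (simp add: mult.commute[of g] mult.commute[of _ "Polynomial.monom 1 1"])
  show "Polynomial.coeff (cst c) n = (if n = 0 then [:c:] else 0)"
    by (simp add: cst_def coeff_pCons split: nat.split)
  show "Polynomial.coeff Z n = (if n = 0 then Polynomial.monom 1 1 else 0)"
    unfolding Z1 by (simp add: coeff_pCons split: nat.split)
  show "Polynomial.coeff (Z ^ k) n = (if n = 0 then Polynomial.monom 1 k else 0)"
    unfolding Zk by (simp add: coeff_pCons split: nat.split)
  have Yk: "Y ^ k = Polynomial.monom 1 k" for k
    by (simp add: Y_def monom_altdef)
  show "Polynomial.coeff (Y ^ k) n = (if n = k then 1 else 0)" unfolding Yk by auto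
  show "Polynomial.coeff Y n = (if n = 1 then 1 else 0)"
    by (simp add: Y_def coeff_pCons one_pCons split: nat.split)
qed

lemmas weight_intros = weight_le_add weight_le_diff weight_le_uminus weight_le_mult weight_le_cst
  weight_le_1 weight_le_Z weight_le_Y weight_le_power

text \<open>The term \<open>z y\<close> already has degree two, so the second component only has to
  stay within that degree.\<close>

lemma quadratic_system_Z_Y:
  assumes "weight_le 1 1 2 Q" shows "quadratic_system (Z * Y + 1) Q"
proof -
  have "weight_le 1 1 2 (Z * Y + 1)"
    by (rule weight_intros order_refl | simp)+
  moreover have "Polynomial.coeff (Polynomial.coeff (Z * Y + 1) 1) 1 \<noteq> 0"
    by (simp add: Z_def Y_def)
  ultimately have "total_degree (Z * Y + 1) = 2" by (rule total_degree_eqI) simp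
  moreover have "total_degree Q \<le> 2"
  proof -
    let ?S = "{i + j |i j. Polynomial.coeff (Polynomial.coeff Q j) i \<noteq> 0}"
    have sub: "insert 0 ?S \<subseteq> {..2}" using assms by (auto simp: weight_le_def)
    then show ?thesis
      unfolding total_degree_def using finite_subset[OF sub] by (subst Max_le_iff) auto
  qed
  ultimately show ?thesis by (simp add: quadratic_system_def)
qed

section \<open>Invariance and degree\<close>

lemma invariant_i:
  "invariant_curve (Z * Y + 1) (cst 3 * Y^2 + cst p * Z * Y + cst (- p * q - 2 * p^2) * Z^2 + cst q)
     (g_i p q) (cst 12 * Y)"
  unfolding invariant_curve_def g_i_def derivative_simps pred_numeral_simps Num.BitM.simps numeral_One power_one_right
  by (rule bpoly_eqI, unfold ident.eval2_by_simps, Groebner_Basis.algebra)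

lemma invariant_ii:
  "invariant_curve (Z * Y + 1) (cst 3 * Y^2 - cst (35/19 * q) * Z * Y - cst (525/361 * q^2) * Z^2 + cst q)
     (g_ii q) (cst 12 * Y)"
  unfolding invariant_curve_def g_ii_def derivative_simps pred_numeral_simps Num.BitM.simps numeral_One power_one_right
  by (rule bpoly_eqI, unfold ident.eval2_by_simps, Groebner_Basis.algebra)

lemma invariant_iii:
  "invariant_curve (Z * Y + 1) (cst 3 * Y^2 - cst (10/59 * q) * Z * Y - cst (150/3481 * q^2) * Z^2 + cst q)
     (g_iii q) (cst 12 * Y)"
  unfolding invariant_curve_def g_iii_def derivative_simps pred_numeral_simps Num.BitM.simps numeral_One power_one_right
  by (rule bpoly_eqI, unfold ident.eval2_by_simps, Groebner_Basis.algebra)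

lemma invariant_iv:
  "invariant_curve (Z * Y + 1) (cst 3 * Y^2 - cst (55/311 * q) * Z * Y + cst (363/96721 * q^2) * Z^2 + cst q)
     (g_iv q) (cst 12 * Y)"
  unfolding invariant_curve_def g_iv_def derivative_simps pred_numeral_simps Num.BitM.simps numeral_One power_one_right
  by (rule bpoly_eqI, unfold ident.eval2_by_simps, Groebner_Basis.algebra)

lemma invariant_v:
  "invariant_curve (Z * Y + 1) (cst 3 * Y^2 - cst (187/107 * q) * Z * Y - cst (8349/11449 * q^2) * Z^2 + cst q)
     (g_v q) (cst 12 * Y)"
  unfolding invariant_curve_def g_v_def derivative_simps pred_numeral_simps Num.BitM.simps numeral_One power_one_right
  by (rule bpoly_eqI, unfold ident.eval2_by_simps, Groebner_Basis.algebra)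

lemma invariant_vi:
  "invariant_curve (Z * Y + 1) (cst 3 * Y^2 + cst q * Z * Y - cst (q^2) * Z^2 - cst q)
     (g_vi p q) (cst 12 * Y)"
  unfolding invariant_curve_def g_vi_def derivative_simps pred_numeral_simps Num.BitM.simps numeral_One power_one_right
  by (rule bpoly_eqI, unfold ident.eval2_by_simps, Groebner_Basis.algebra)

lemma coeff_const_numeral: "Polynomial.coeff [:c:] (numeral k) = 0"
  by (simp add: coeff_pCons split: nat.split)

text \<open>The degree is attained at \<open>z^12\<close>, whose coefficient vanishes exactly for
  \<open>p = 0\<close> or \<open>q + 2 p = 0\<close>.\<close>

lemma total_degree_i:
  assumes "p \<noteq> 0 \<and> q + 2 * p \<noteq> 0"
  shows "total_degree (g_i p q) = 12"
proof (rule total_degree_eqI[of _ _ 0 12])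
  show "weight_le 1 1 12 (g_i p q)"
    unfolding g_i_def by (rule weight_intros order_refl | simp)+
  show "Polynomial.coeff (Polynomial.coeff (g_i p q) 0) 12 \<noteq> 0"
    using assms unfolding g_i_def by (simp add: coeff_y_simps coeff_const_numeral smult_monom)
qed simp

lemma total_degree_ii:
  assumes "q \<noteq> 0"
  shows "total_degree (g_ii q) = 12"
proof (rule total_degree_eqI[of _ _ 0 12])
  show "weight_le 1 1 12 (g_ii q)"
    unfolding g_ii_def by (rule weight_intros order_refl | simp)+
  show "Polynomial.coeff (Polynomial.coeff (g_ii q) 0) 12 \<noteq> 0"
    using assms unfolding g_ii_def by (simp add: coeff_y_simps coeff_const_numeral smult_monom)
qed simp

lemma total_degree_iii:
  assumes "q \<noteq> 0"
  shows "total_degree (g_iii q) = 12"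
proof (rule total_degree_eqI[of _ _ 0 12])
  show "weight_le 1 1 12 (g_iii q)"
    unfolding g_iii_def by (rule weight_intros order_refl | simp)+
  show "Polynomial.coeff (Polynomial.coeff (g_iii q) 0) 12 \<noteq> 0"
    using assms unfolding g_iii_def by (simp add: coeff_y_simps coeff_const_numeral smult_monom)
qed simp

lemma total_degree_iv:
  assumes "q \<noteq> 0"
  shows "total_degree (g_iv q) = 12"
proof (rule total_degree_eqI[of _ _ 0 12])
  show "weight_le 1 1 12 (g_iv q)"
    unfolding g_iv_def by (rule weight_intros order_refl | simp)+
  show "Polynomial.coeff (Polynomial.coeff (g_iv q) 0) 12 \<noteq> 0"
    using assms unfolding g_iv_def by (simp add: coeff_y_simps coeff_const_numeral smult_monom)
qed simp

lemma total_degree_v: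
  assumes "q \<noteq> 0"
  shows "total_degree (g_v q) = 12"
proof (rule total_degree_eqI[of _ _ 0 12])
  show "weight_le 1 1 12 (g_v q)"
    unfolding g_v_def by (rule weight_intros order_refl | simp)+
  show "Polynomial.coeff (Polynomial.coeff (g_v q) 0) 12 \<noteq> 0"
    using assms unfolding g_v_def by (simp add: coeff_y_simps coeff_const_numeral smult_monom)
qed simp

lemma total_degree_vi:
  assumes "q \<noteq> 0 \<and> 9 * p \<noteq> 2 * q^2"
  shows "total_degree (g_vi p q) = 12"
proof -
  \<comment> \<open>The coefficient of \<open>z^12\<close>; its factorization shows the origin of
    the condition \<open>9 * p \<noteq> 2 * q^2\<close>.\<close>
  have eq: "1/64 * q^6 * p - 1/288 * q^8 = q^6 / 576 * (9 * p - 2 * q^2)" by (simp add: field_simps)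
  have ne: "1/64 * q^6 * p - 1/288 * q^8 \<noteq> 0" unfolding eq using assms by simp
  show ?thesis
proof (rule total_degree_eqI[of _ _ 0 12])
  show "weight_le 1 1 12 (g_vi p q)"
    unfolding g_vi_def by (rule weight_intros order_refl | simp)+
  show "Polynomial.coeff (Polynomial.coeff (g_vi p q) 0) 12 \<noteq> 0"
    using ne unfolding g_vi_def by (simp add: coeff_y_simps coeff_const_numeral smult_monom)
qed simp
qed

section \<open>The genus of the six curves\<close>

lemma simple_roots_bezout:
  assumes "0 < Polynomial.degree f" "a * f + b * pderiv f = [:d:]" "d \<noteq> 0"
  shows "simple_roots f"
  unfolding simple_roots_def
proof (intro conjI allI impI notI)
  fix c assume "poly f c = 0" "poly (pderiv f) c = 0"
  then show False using arg_cong[OF assms(2), of "\<lambda>p. poly p c"] assms(3) by simp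
qed (rule assms(1))

lemma simple_roots_smult: "simple_roots f \<Longrightarrow> c \<noteq> 0 \<Longrightarrow> simple_roots (Polynomial.smult c f)"
  by (simp add: simple_roots_def pderiv_smult)

lemma quadratic_two_roots:
  fixes a b c :: complex
  assumes "a \<noteq> 0" "b ^ 2 - 4 * a * c \<noteq> 0"
  obtains x y where "x \<noteq> y" "poly [:c, b, a:] x = 0" "poly [:c, b, a:] y = 0"
proof -
  define d where "d = csqrt (b ^ 2 - 4 * a * c)"
  have d: "d ^ 2 = b ^ 2 - 4 * a * c" "d \<noteq> 0" using assms(2) by (simp_all add: d_def)
  have root: "poly [:c, b, a:] ((- b + e) / (2 * a)) = 0" if "e ^ 2 = b ^ 2 - 4 * a * c" for e
  proof -
    have "4 * a * poly [:c, b, a:] ((- b + e) / (2 * a)) = e ^ 2 - (b ^ 2 - 4 * a * c)"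
      using assms(1) by (simp add: field_simps power2_eq_square)
    then show ?thesis using that assms(1) by simp
  qed
  have "(- b + d) / (2 * a) \<noteq> (- b + - d) / (2 * a)"
    using d(2) assms(1) by simp
  then show ?thesis by (rule that[OF _ root root]) (simp_all add: d(1))
qed

text \<open>The four points over \<open>z = 0\<close> lie over the two roots of \<open>Q\<close>; their values of \<open>y\<close> differ
  because \<open>y\<^sup>2\<close> is a nonconstant linear function of the root.\<close>

lemma curve_genus_one_criterion:
  assumes f: "simple_roots f" "Polynomial.degree f = 4"
    and m: "weight_le 0 1 4 m" "Polynomial.coeff m 4 = 1"
    and Q: "a \<noteq> 0" "b ^ 2 - 4 * a * c \<noteq> 0"
    and fibre: "\<And>x. poly [:c, b, a:] x = 0 \<Longrightarrow>
      poly f x \<noteq> 0 \<and> l + k * x \<noteq> 0 \<and> poly N x ^ 2 = poly f x ^ 3 * (l + k * x)"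
    and k: "k \<noteq> 0"
    and scale: "\<alpha> \<noteq> 0" "\<beta> \<noteq> 0"
    and U: "\<And>y. eval2_by (\<lambda>c. c) U 0 y \<noteq> 0"
    and vanish: "\<And>x w z y. w \<noteq> 0 \<Longrightarrow> w ^ 2 = \<alpha> * poly f x \<Longrightarrow> z * w = poly [:c, b, a:] x \<Longrightarrow>
      y * w ^ 3 = \<beta> * poly N x \<Longrightarrow> eval2_by (\<lambda>c. c) m z y = 0"
    and inverse: "\<And>x w z y. w \<noteq> 0 \<Longrightarrow> w ^ 2 = \<alpha> * poly f x \<Longrightarrow> z * w = poly [:c, b, a:] x \<Longrightarrow>
      y * w ^ 3 = \<beta> * poly N x \<Longrightarrow> x * eval2_by (\<lambda>c. c) U z y = eval2_by (\<lambda>c. c) W z y"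
  shows "curve_genus m 1"
proof -
  let ?Q = "[:c, b, a:]" and ?f = "Polynomial.smult \<alpha> f" and ?M = "Polynomial.smult \<beta> N"
  obtain x1 x2 where x: "x1 \<noteq> x2" "poly ?Q x1 = 0" "poly ?Q x2 = 0"
    by (rule quadratic_two_roots[OF Q])
  define w where "w x = csqrt (\<alpha> * poly f x)" for x
  define y where "y x = poly ?M x / w x ^ 3" for x
  have w: "w x ^ 2 = poly ?f x" "w x \<noteq> 0" if "poly ?Q x = 0" for x
    using fibre[OF that] scale(1) by (auto simp: w_def)
  \<comment> \<open>Here \<open>y^2 = \<beta>^2 N^2 / w^6\<close> and
    \<open>w^6 = (\<alpha> f)^3\<close>, so the factor \<open>f^3\<close> in the hypothesis on
    \<open>N\<close> cancels.\<close>
  have y2: "y x ^ 2 = \<beta> ^ 2 / \<alpha> ^ 3 * (l + k * x)" if "poly ?Q x = 0" for x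
  proof -
    have "(w x ^ 3) ^ 2 = (w x ^ 2) ^ 3"
      by (simp only: power_mult[symmetric] mult.commute)
    then have "(w x ^ 3) ^ 2 = (\<alpha> * poly f x) ^ 3" unfolding w(1)[OF that] by simp
    then show ?thesis
      using fibre[OF that] scale(1) by (simp add: y_def power_divide power_mult_distrib)
  qed
  have y0: "y x \<noteq> 0" if "poly ?Q x = 0" for x
    using y2[OF that] fibre[OF that] scale by auto
  have y12: "y x1 ^ 2 \<noteq> y x2 ^ 2" using y2 x k scale by simp
  let ?B = "{y x1, - y x1, y x2, - y x2}"
  have card: "card ?B = 4"
  proof -
    have "y x1 \<noteq> - y x1" "y x2 \<noteq> - y x2" using y0 x by (simp_all add: eq_neg_iff_add_eq_0)
    moreover have "y x1 \<noteq> y x2" "y x1 \<noteq> - y x2" using y12 by auto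
    moreover from this have "- y x1 \<noteq> y x2" by (metis minus_minus)
    ultimately show ?thesis by (simp add: card_insert_if)
  qed
  have points: "\<exists>x v. on_cover ?f x v \<and> poly ?Q x / v = 0 \<and> poly ?M x / v ^ 3 = e" if e: "e \<in> ?B" for e
  proof -
    obtain x where xr: "poly ?Q x = 0" "e = y x \<or> e = - y x" using e x(2,3) by blast
    have "on_cover ?f x (w x) \<and> poly ?Q x / w x = 0 \<and> poly ?M x / w x ^ 3 = y x"
      "on_cover ?f x (- w x) \<and> poly ?Q x / (- w x) = 0 \<and> poly ?M x / (- w x) ^ 3 = - y x"
      using w[OF xr(1)] xr(1) by (simp_all add: on_cover_def y_def del: poly_pCons)
    then show ?thesis using xr(2) by blast
  qed
  have "curve_genus (m ^ 1) 1"
  proof (rule curve_genus_parametrized[OF simple_roots_smult[OF f(1) scale(1)] _ _ _ _ _ _ _ _ _ _ points])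
    show "on_cover ?f x1 (w x1)" using w[OF x(2)] by (simp add: on_cover_def)
    show "eval2_by (\<lambda>c. c) U (poly ?Q x1 / w x1) (poly ?M x1 / w x1 ^ 3) \<noteq> 0"
      unfolding x(2) using U by simp
    show "eval2_by (\<lambda>c. c) m (poly ?Q x / v) (poly ?M x / v ^ 3) = 0" if "on_cover ?f x v" for x v
      by (rule vanish[of v x]) (use that in \<open>simp_all add: on_cover_def\<close>)
    show "x * eval2_by (\<lambda>c. c) U (poly ?Q x / v) (poly ?M x / v ^ 3)
        = eval2_by (\<lambda>c. c) W (poly ?Q x / v) (poly ?M x / v ^ 3)" if "on_cover ?f x v" for x v
      by (rule inverse[of v x]) (use that in \<open>simp_all add: on_cover_def\<close>)
    show "Polynomial.degree m \<le> card ?B" using degree_eqI_y(1)[OF m] card by simp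
    show "Polynomial.lead_coeff m = 1" by (rule degree_eqI_y(2)[OF m])
    show "Polynomial.degree ?f = 2 * 1 + 1 \<or> Polynomial.degree ?f = 4 \<and> (1::nat) = 1"
      using f(2) scale(1) by simp
    show "?Q \<noteq> 0" using Q(1) by simp
  qed simp_all
  then show ?thesis by simp
qed

section \<open>The first family: powers of rational curves\<close>

lemma simple_roots_X: "simple_roots [:0, 1:]"
  by (simp add: simple_roots_def pderiv_pCons)

lemma on_cover_X: "on_cover [:0, 1:] x w \<longleftrightarrow> w ^ 2 = x \<and> w \<noteq> 0"
  by (simp add: on_cover_def)

definition root_i :: "complex \<Rightarrow> complex \<Rightarrow> bpoly" where
  "root_i p q = Y^2 + cst (p^2) * Y * Z^3 + cst p * Y * Z + cst (1/6 * p^3 * (q + 2 * p)) * Z^6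
    + cst (1/2 * p^3) * Z^4 - cst (1/2 * p * q) * Z^2 + cst (1/6 * (2 * q + p))"

lemma g_i_square: "g_i p q = root_i p q ^ 2"
  by (rule bpoly_eqI, unfold g_i_def root_i_def ident.eval2_by_simps, Groebner_Basis.algebra)

text \<open>Completing the square in \<open>y\<close> gives the conic \<open>r\<^sup>2 = p z\<^sup>2 + 2\<close>, parametrised by
  \<open>z = (s - 1 / s) / (2 k)\<close> and \<open>r = (s + 1 / s) / \<surd>2\<close> with \<open>p = 2 k\<^sup>2\<close>.\<close>

lemma genus_i_irreducible:
  assumes p: "p \<noteq> 0" and pq: "p + 2 * q \<noteq> 0"
  shows "curve_genus (g_i p q) 0"
proof -
  define k where "k = csqrt (p / 2)"
  \<comment> \<open>Absorbs the constant factor \<open>- (p + 2 q) = 6 e^2\<close> of the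
    discriminant.\<close>
  define e where "e = csqrt (- (p + 2 * q) / 6)"
  have k: "p = 2 * k ^ 2" "k \<noteq> 0" using p by (simp_all add: k_def)
  have "6 * e ^ 2 = - (p + 2 * q)" by (simp add: e_def)
  then have q: "q = - 3 * e ^ 2 - p / 2" by Groebner_Basis.algebra
  have e0: "e \<noteq> 0" using pq by (auto simp: q)
  let ?m = "root_i p q"
  let ?Q = "[:- 1 / (2 * k), 1 / (2 * k):]"
  let ?M = "[:k / 4 + e / 4, - k / 4 - 3 * e / 4, k / 4 - 3 * e / 4, - k / 4 + e / 4:]"
  \<comment> \<open>On the curve \<open>2 y + p^2 z^3 + p z = e V (s + 1 / s)\<close>, and
    \<open>2 k z = s - 1 / s\<close>. Adding \<open>2 k e z V\<close> gives \<open>2 e V s\<close>,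
    whose square is both \<open>?W\<close> and \<open>s^2 = x\<close> times
    \<open>?U\<close>.\<close>
  let ?V = "cst p * Z^2 - 1"
  let ?U = "cst (4 * e^2) * ?V^2"
  let ?W = "(cst 2 * Y + cst (p^2) * Z^3 + cst p * Z + cst (2 * k * e) * Z * ?V)^2"
  have m: "weight_le 0 1 2 ?m" "Polynomial.coeff ?m 2 = 1"
    unfolding root_i_def
    by ((rule weight_intros order_refl | simp)+, simp add: coeff_y_simps)
  have "curve_genus (?m ^ 2) 0"
  \<comment> \<open>The cover \<open>s^2 = t\<close> is a line with parameter \<open>s\<close>. Over
    \<open>z = 0\<close> lie \<open>s = 1\<close> and \<open>s = - 1\<close>, where \<open>y\<close>
    is \<open>- e\<close> and \<open>e\<close>.\<close>
  proof (rule curve_genus_parametrized[where f = "[:0, 1:]" and n = 0 and Q = ?Q and M = ?M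
      and U = ?U and W = ?W and ?a0.0 = 1 and ?b0.0 = 1 and B = "{e, - e}" and ?z0.0 = 0])
    show "Polynomial.lead_coeff ?m = 1" by (rule degree_eqI_y(2)[OF m])
    have "e \<noteq> - e" using e0 by (simp add: eq_neg_iff_add_eq_0)
    then show "Polynomial.degree ?m \<le> card {e, - e}" using degree_eqI_y(1)[OF m] by simp
    fix x w :: complex assume "on_cover [:0, 1:] x w"
    then have w: "x = w ^ 2" "w \<noteq> 0" by (simp_all add: on_cover_X)
    define z where "z = poly ?Q x / w"
    define y where "y = poly ?M x / w ^ 3"
    have z: "2 * k * (z * w) = w^2 - 1" using w k(2) by (simp add: z_def field_simps)
    have y: "4 * (y * w ^ 3) = - k * (w^6 - w^4 + w^2 - 1) + e * (w^6 - 3 * w^4 - 3 * w^2 + 1)"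
      using w(2) by (simp add: y_def w(1)) Groebner_Basis.algebra
    have "eval2_by (\<lambda>c. c) ?m z y * (16 * w ^ 6) = (4 * (y * w^3))^2
        + 2 * k * (4 * (y * w^3)) * (2 * k * (z * w))^3 + 4 * k * (4 * (y * w^3)) * (2 * k * (z * w)) * w^2
        + (1/3) * (q + 4 * k^2) * (2 * k * (z * w))^6 + 4 * k^2 * (2 * k * (z * w))^4 * w^2
        - 4 * q * (2 * k * (z * w))^2 * w^4 + (8/3) * (2 * q + 2 * k^2) * w^6"
      unfolding root_i_def ident.eval2_by_simps k(1) by Groebner_Basis.algebra
    also have "\<dots> = 0" unfolding z y q k(1) by Groebner_Basis.algebra
    finally show "eval2_by (\<lambda>c. c) ?m z y = 0" using w(2) by simp
    have "(x * eval2_by (\<lambda>c. c) ?U z y - eval2_by (\<lambda>c. c) ?W z y) * (4 * w ^ 6)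
      = 4 * x * w^2 * e^2 * ((2 * k * (z * w))^2 - 2 * w^2)^2
        - (4 * (y * w^3) + k * (2 * k * (z * w))^3 + 2 * k * (2 * k * (z * w)) * w^2
          + e * (2 * k * (z * w)) * ((2 * k * (z * w))^2 - 2 * w^2))^2"
      unfolding ident.eval2_by_simps k(1) by Groebner_Basis.algebra
    also have "\<dots> = 0" unfolding z y w(1) by Groebner_Basis.algebra
    finally show "x * eval2_by (\<lambda>c. c) ?U z y = eval2_by (\<lambda>c. c) ?W z y" using w(2) by simp
  next
    show "on_cover [:0, 1:] 1 1" by (simp add: on_cover_X)
    show "eval2_by (\<lambda>c. c) ?U (poly ?Q 1 / 1) (poly ?M 1 / 1 ^ 3) \<noteq> 0"
      unfolding ident.eval2_by_simps using e0 by simp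
    fix y assume "y \<in> {e, - e}"
    moreover have M1: "poly ?M 1 = - e" by (simp add: field_simps)
    ultimately consider "y = poly ?M 1 / (- 1) ^ 3" | "y = poly ?M 1 / 1 ^ 3"
      by (auto simp del: poly_pCons)
    then show "\<exists>x w. on_cover [:0, 1:] x w \<and> poly ?Q x / w = 0 \<and> poly ?M x / w ^ 3 = y"
    proof cases
      case 1
      then show ?thesis by (intro exI[of _ 1] exI[of _ "- 1"]) (simp add: on_cover_X)
    next
      case 2
      then show ?thesis by (intro exI[of _ 1]) (simp add: on_cover_X)
    qed
  qed (use k simple_roots_X in auto)
  then show ?thesis by (simp only: g_i_square)
qed

text \<open>For \<open>p + 2 q = 0\<close> the discriminant vanishes, and \<open>g_i\<close> is the
  fourth power of the equation of a graph over \<open>z\<close>.\<close>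

lemma genus_i_power:
  assumes p: "p \<noteq> 0" and q: "q = - p / 2"
  shows "curve_genus (g_i p q) 0"
proof -
  let ?m = "Y + cst (1/2 * p^2) * Z^3 + cst (1/2 * p) * Z"
  \<comment> \<open>On \<open>s^2 = t\<close> the coordinate \<open>z = t / s\<close> equals
    \<open>s\<close>, so \<open>?M\<close> is \<open>s^3\<close> times the graph, written in
    \<open>t\<close>.\<close>
  let ?M = "[:0, 0, - p / 2, - (p^2) / 2:]"
  have g: "g_i p q = ?m ^ 4"
    unfolding q by (rule bpoly_eqI, unfold g_i_def ident.eval2_by_simps, Groebner_Basis.algebra)
  have m: "weight_le 0 1 1 ?m" "Polynomial.coeff ?m 1 = 1"
    by ((rule weight_intros order_refl | simp)+, simp add: coeff_y_simps)
  have "curve_genus (?m ^ 4) 0"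
  proof (rule curve_genus_parametrized[where f = "[:0, 1:]" and n = 0 and Q = "[:0, 1:]" and M = ?M
      and U = 1 and W = "Z^2" and ?a0.0 = 1 and ?b0.0 = 1 and B = "{poly ?M 1}" and ?z0.0 = 1])
    show "Polynomial.lead_coeff ?m = 1" by (rule degree_eqI_y(2)[OF m])
    show "Polynomial.degree ?m \<le> card {poly ?M 1}" using degree_eqI_y(1)[OF m] by simp
    fix x w :: complex assume "on_cover [:0, 1:] x w"
    then have w: "x = w ^ 2" "w \<noteq> 0" by (simp_all add: on_cover_X)
    have z: "poly [:0, 1:] x / w = w" using w by (simp add: power2_eq_square)
    have y: "poly ?M x / w ^ 3 = - (1/2 * p^2) * w^3 - 1/2 * p * w"
      using w by (simp add: field_simps power4_eq_xxxx power3_eq_cube power2_eq_square)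
    show "eval2_by (\<lambda>c. c) ?m (poly [:0, 1:] x / w) (poly ?M x / w ^ 3) = 0"
      unfolding z y ident.eval2_by_simps by simp
    show "x * eval2_by (\<lambda>c. c) 1 (poly [:0, 1:] x / w) (poly ?M x / w ^ 3)
      = eval2_by (\<lambda>c. c) (Z^2) (poly [:0, 1:] x / w) (poly ?M x / w ^ 3)"
      unfolding z ident.eval2_by_simps using w by simp
  next
    fix y assume "y \<in> {poly ?M 1}"
    then show "\<exists>x w. on_cover [:0, 1:] x w \<and> poly [:0, 1:] x / w = 1 \<and> poly ?M x / w ^ 3 = y"
      by (intro exI[of _ 1]) (simp add: on_cover_X)
  qed (use simple_roots_X in \<open>auto simp: on_cover_X ident.eval2_by_simps\<close>)
  then show ?thesis by (simp only: g)
qed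

lemma genus_i: "p \<noteq> 0 \<Longrightarrow> curve_genus (g_i p q) 0"
  using genus_i_irreducible[of p q] genus_i_power[of p q]
  by (cases "p + 2 * q = 0") (auto simp: field_simps add_eq_0_iff)

section \<open>The five families of genus one\<close>

text \<open>The involution \<open>(z, y) \<mapsto> (- z, - y)\<close> preserves each of the remaining curves, and the quotient is
  rational. In a parameter \<open>x\<close> of the quotient, \<open>z\<^sup>2\<close> is a constant times \<open>Q\<^sup>2 / f\<close> and \<open>y / z\<close> is a constant
  times \<open>N / (Q f)\<close>, where \<open>f\<close> has degree four: the roots of \<open>f\<close> are the fixed points, over \<open>z = \<infinity>\<close>. The
  polynomials and the quotient \<open>W / U\<close> that expresses \<open>x\<close> through \<open>z\<close> and \<open>y\<close> were computed from the
  branches of the curve over its equilibrium point \<open>z y = - 1\<close>.\<close>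

lemma genus_ii:
  assumes r: "r \<noteq> 0"
  shows "curve_genus (g_ii (19 * r)) 1"
proof -
  let ?Q = "[:-1, -4, 1:]" and ?f = "[:1, 8, 14, 12, 1:]"
    and ?N = "[:-25, -300, -1125, -1400, -575, -100, 25:]"
  \<comment> \<open>On \<open>z y = - 1\<close> the equilibria are given by
    \<open>(25 a + 1) (7 a - 1) = 0\<close> with \<open>a = r z^2\<close>; these are the factors of
    \<open>?U\<close>.\<close>
  let ?U = "cst (7 * r) * (cst (-25 * r) * Z^2 - 1)^4 * (cst r * Z^2 - cst (1/7))"
  \<comment> \<open>The final multiple of \<open>?U\<close> merely shifts the parameter
    \<open>x\<close> by a constant.\<close>
  let ?W = "cst (32 * r) + cst (4420 * r^2) * Z^2 - cst (152 * r) * Z * Y + cst (4) * Y^2 +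
            cst (19000 * r^3) * Z^4 + cst (12800 * r^2) * Z^3 * Y - cst (760 * r) * Z^2 * Y^2 +
            cst (16) * Z * Y^3 + cst (3412500 * r^4) * Z^6 - cst (275000 * r^3) * Z^5 * Y +
            cst (8500 * r^2) * Z^4 * Y^2 - cst (26250000 * r^5) * Z^8 + cst (1500000 * r^4) *
            Z^7 * Y + cst (32) * ?U"
  show ?thesis
  \<comment> \<open>On \<open>z = 0\<close> the curve is a quadratic in \<open>y^2\<close>. Up to
    the factor \<open>\<beta>^2 / \<alpha>^3\<close>, the linear function \<open>l + k x\<close>
    maps the roots of \<open>?Q\<close> to its roots.\<close>
  proof (rule curve_genus_one_criterion[where f = ?f and N = ?N
      and \<alpha> = "-25 * r" and \<beta> = "-25 * r^2" and c = "-1" and b = "-4" and a = "1"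
      and l = "0" and k = "25/4" and U = ?U and W = ?W])
    show "simple_roots ?f"
    proof (rule simple_roots_bezout)
      show "([:-276, -328, -36:] :: complex poly) * ?f
          + [:52, 135, 109, 9:] * pderiv ?f = [:140:]"
        by (simp add: pderiv_pCons)
    qed (use r in simp_all)
  next
    fix x :: complex
    assume "poly ?Q x = 0"
    then have Q: "x^2 - 4 * x - 1 = 0"
      unfolding poly_pCons poly_0 by Groebner_Basis.algebra
    have f: "poly ?f x = 340 * x + 80"
      unfolding poly_pCons poly_0 using Q by Groebner_Basis.algebra
    have N: "poly ?N x = - 68200 * x - 16100"
      unfolding poly_pCons poly_0 using Q by Groebner_Basis.algebra
    \<comment> \<open>The second factor is, up to a constant, an inverse of \<open>f\<close> modulo
      \<open>?Q\<close>, so \<open>f\<close> has no zero at the roots of \<open>?Q\<close>.\<close>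
    have eqf: "20 - (340 * x + 80) * (17 * x - 72) = 0"
      using Q by Groebner_Basis.algebra
    have f0: "poly ?f x \<noteq> 0"
    proof
      assume z: "poly ?f x = 0"
      show False using eqf r unfolding f[symmetric] z by simp
    qed
    have eql: "25 - (0 + 25/4 * x) * (4 * x - 16) = 0"
      using Q by Groebner_Basis.algebra
    have l0: "0 + 25/4 * x \<noteq> 0"
    proof
      assume z: "0 + 25/4 * x = 0"
      show False using eql r unfolding z by simp
    qed
    have "(- 68200 * x - 16100)^2 = (340 * x + 80)^3 * (0 + 25/4 * x)"
      using Q by Groebner_Basis.algebra
    then show "poly ?f x \<noteq> 0 \<and> 0 + 25/4 * x \<noteq> 0
        \<and> poly ?N x ^ 2 = poly ?f x ^ 3 * (0 + 25/4 * x)"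
      using f0 l0 unfolding f N by blast
  next
    fix x w z y :: complex
    assume w: "w \<noteq> 0" "w ^ 2 = -25 * r * poly ?f x"
      and zy: "z * w = poly ?Q x" "y * w ^ 3 = -25 * r^2 * poly ?N x"
    note subst = w(2)[unfolded poly_pCons poly_0] zy[unfolded poly_pCons poly_0]
    \<comment> \<open>With weight 1 for \<open>z\<close> and 3 for \<open>y\<close>, every term of
      the curve has even weight at most 12. After multiplication by \<open>w^12\<close> only
      \<open>z w\<close>, \<open>y w^3\<close> and \<open>w^2\<close> occur, all of them polynomials
      in \<open>x\<close>.\<close>
    have "eval2_by (\<lambda>c. c) (g_ii (19 * r)) z y * w^12
      = - 1/16 * r^2 * (w^2)^6 + r * (y * w^3)^2 * (w^2)^3 + (y * w^3)^4 - 155/4 * r^2 * (z * w)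
        * (y * w^3) * (w^2)^4 - 70 * r * (z * w) * (y * w^3)^3 * (w^2) + 2945/8 * r^3 *
        (z * w)^2 * (w^2)^5 + 1875 * r^2 * (z * w)^2 * (y * w^3)^2 * (w^2)^2 - 22625 * r^3 *
        (z * w)^3 * (y * w^3) * (w^2)^3 + 750 * r^2 * (z * w)^3 * (y * w^3)^3 + 1638125/16 * r^4
        * (z * w)^4 * (w^2)^4 - 39375 * r^3 * (z * w)^4 * (y * w^3)^2 * (w^2) + 1396875/2 * r^4
        * (z * w)^5 * (y * w^3) * (w^2)^2 - 16765625/4 * r^5 * (z * w)^6 * (w^2)^3 + 203125 *
        r^4 * (z * w)^6 * (y * w^3)^2 - 7109375 * r^5 * (z * w)^7 * (y * w^3) * (w^2) +
        1003515625/16 * r^6 * (z * w)^8 * (w^2)^2 + 95703125/4 * r^6 * (z * w)^9 * (y * w^3) -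
        3349609375/8 * r^7 * (z * w)^10 * (w^2) + 16748046875/16 * r^8 * (z * w)^12"
      unfolding g_ii_def ident.eval2_by_simps by Groebner_Basis.algebra
    also have "\<dots> = 0" unfolding subst by Groebner_Basis.algebra
    finally show "eval2_by (\<lambda>c. c) (g_ii (19 * r)) z y = 0" using w(1) by simp
    have "(x * eval2_by (\<lambda>c. c) ?U z y - eval2_by (\<lambda>c. c) ?W z y) * w^10
      = x * (7 * r * (-25 * r * (z * w)^2 - w^2)^4 * (r * (z * w)^2 - 1/7 * w^2))
        - (32 * r * (w^2)^5 + 4420 * r^2 * (z * w)^2 * (w^2)^4 - 152 * r * (z * w) * (y * w^3) *
           (w^2)^3 + 4 * (y * w^3)^2 * (w^2)^2 + 19000 * r^3 * (z * w)^4 * (w^2)^3 + 12800 * r^2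
           * (z * w)^3 * (y * w^3) * (w^2)^2 - 760 * r * (z * w)^2 * (y * w^3)^2 * (w^2) + 16 *
           (z * w) * (y * w^3)^3 + 3412500 * r^4 * (z * w)^6 * (w^2)^2 - 275000 * r^3 *
           (z * w)^5 * (y * w^3) * (w^2) + 8500 * r^2 * (z * w)^4 * (y * w^3)^2 - 26250000 * r^5
           * (z * w)^8 * (w^2) + 1500000 * r^4 * (z * w)^7 * (y * w^3) + 32 * (7 * r * (-25 * r
           * (z * w)^2 - w^2)^4 * (r * (z * w)^2 - 1/7 * w^2)))"
      unfolding ident.eval2_by_simps by Groebner_Basis.algebra
    also have "\<dots> = 0" unfolding subst by Groebner_Basis.algebra
    finally show "x * eval2_by (\<lambda>c. c) ?U z y = eval2_by (\<lambda>c. c) ?W z y" using w(1) by simp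
  next
    show "weight_le 0 1 4 (g_ii (19 * r))"
      unfolding g_ii_def by (rule weight_intros order_refl | simp)+
    show "Polynomial.coeff (g_ii (19 * r)) 4 = 1"
      unfolding g_ii_def by (simp add: coeff_y_simps)
    show "eval2_by (\<lambda>c. c) ?U 0 y \<noteq> 0" for y
      unfolding ident.eval2_by_simps using r by simp
  qed (use r in simp_all)
qed

lemma genus_iii:
  assumes r: "r \<noteq> 0"
  shows "curve_genus (g_iii (59 * r)) 1"
proof -
  let ?Q = "[:-2, 7, 7:]" and ?f = "[:4, -28, 66, -82, 49:]"
    and ?N = "[:-200, 2100, -8400, 17500, -22800, 18075, -7625:]"
  \<comment> \<open>With \<open>a = r z^2\<close> the equilibria are the zeros of
    \<open>(25 a + 1) (2 a - 1)\<close>, again the factors of \<open>?U\<close>.\<close>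
  let ?U = "cst (18816 * r) * (cst (-25 * r) * Z^2 - 1)^5 * (cst r * Z^2 - cst (1/2))"
  let ?W = "cst (86064 * r) - cst (9758420 * r^2) * Z^2 - cst (503524 * r) * Z * Y + cst (5488)
            * Y^2 - cst (517272625 * r^3) * Z^4 + cst (11184625 * r^2) * Z^3 * Y -
            cst (324135 * r) * Z^2 * Y^2 - cst (24353) * Z * Y^3 + cst (8914643750 * r^4) * Z^6
            - cst (64972500 * r^3) * Z^5 * Y - cst (26039250 * r^2) * Z^4 * Y^2 +
            cst (548800 * r) * Z^3 * Y^3 - cst (41077812500 * r^5) * Z^8 -
            cst (2659187500 * r^4) * Z^7 * Y + cst (441025000 * r^3) * Z^6 * Y^2 +
            cst (23859375000 * r^6) * Z^10 - cst (6425000000 * r^5) * Z^9 * Y + cst (167/196) *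
            ?U"
  show ?thesis
  proof (rule curve_genus_one_criterion[where f = ?f and N = ?N
      and \<alpha> = "-25 * r" and \<beta> = "-25 * r^2" and c = "-2" and b = "7" and a = "7"
      and l = "3000/7" and k = "-300/7" and U = ?U and W = ?W])
    show "simple_roots ?f"
    proof (rule simple_roots_bezout)
      show "([:-2726, 5570, -6468:] :: complex poly) * ?f
          + [:-428, 1504, -2069, 1617:] * pderiv ?f = [:1080:]"
        by (simp add: pderiv_pCons)
    qed (use r in simp_all)
  next
    fix x :: complex
    assume "poly ?Q x = 0"
    then have Q: "7 * x^2 + 7 * x - 2 = 0"
      unfolding poly_pCons poly_0 by Groebner_Basis.algebra
    have f: "poly ?f x = - 1935/7 * x + 450/7"
      unfolding poly_pCons poly_0 using Q by Groebner_Basis.algebra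
    have N: "poly ?N x = 854550/7 * x - 9711900/343"
      unfolding poly_pCons poly_0 using Q by Groebner_Basis.algebra
    have eqf: "540 - (- 1935/7 * x + 450/7) * (2107 * x + 2597) = 0"
      using Q by Groebner_Basis.algebra
    have f0: "poly ?f x \<noteq> 0"
    proof
      assume z: "poly ?f x = 0"
      show False using eqf r unfolding f[symmetric] z by simp
    qed
    have eql: "230400 - (3000/7 + -300/7 * x) * (49 * x + 539) = 0"
      using Q by Groebner_Basis.algebra
    have l0: "3000/7 + -300/7 * x \<noteq> 0"
    proof
      assume z: "3000/7 + -300/7 * x = 0"
      show False using eql r unfolding z by simp
    qed
    have "(854550/7 * x - 9711900/343)^2 = (- 1935/7 * x + 450/7)^3 * (3000/7 + -300/7 * x)"
      using Q by Groebner_Basis.algebra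
    then show "poly ?f x \<noteq> 0 \<and> 3000/7 + -300/7 * x \<noteq> 0
        \<and> poly ?N x ^ 2 = poly ?f x ^ 3 * (3000/7 + -300/7 * x)"
      using f0 l0 unfolding f N by blast
  next
    fix x w z y :: complex
    assume w: "w \<noteq> 0" "w ^ 2 = -25 * r * poly ?f x"
      and zy: "z * w = poly ?Q x" "y * w ^ 3 = -25 * r^2 * poly ?N x"
    note subst = w(2)[unfolded poly_pCons poly_0] zy[unfolded poly_pCons poly_0]
    have "eval2_by (\<lambda>c. c) (g_iii (59 * r)) z y * w^12
      = 110592/343 * r^2 * (w^2)^6 + 36 * r * (y * w^3)^2 * (w^2)^3 + (y * w^3)^4 - 129960/343 *
        r^2 * (z * w) * (y * w^3) * (w^2)^4 - 20 * r * (z * w) * (y * w^3)^3 * (w^2) +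
        3833820/343 * r^3 * (z * w)^2 * (w^2)^5 + 210750/343 * r^2 * (z * w)^2 * (y * w^3)^2 *
        (w^2)^2 + 5291500/343 * r^3 * (z * w)^3 * (y * w^3) * (w^2)^3 + 281000/343 * r^2 *
        (z * w)^3 * (y * w^3)^3 - 82923125/343 * r^4 * (z * w)^4 * (w^2)^4 - 4215000/343 * r^3 *
        (z * w)^4 * (y * w^3)^2 * (w^2) - 1425000/49 * r^4 * (z * w)^5 * (y * w^3) * (w^2)^2 +
        230375000/343 * r^5 * (z * w)^6 * (w^2)^3 + 375000/343 * r^4 * (z * w)^6 * (y * w^3)^2 -
        3750000/343 * r^5 * (z * w)^7 * (y * w^3) * (w^2) - 159375000/343 * r^6 * (z * w)^8 *
        (w^2)^2 - 62500000/343 * r^6 * (z * w)^9 * (y * w^3) + 312500000/343 * r^7 * (z * w)^10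
        * (w^2) - 781250000/343 * r^8 * (z * w)^12"
      unfolding g_iii_def ident.eval2_by_simps by Groebner_Basis.algebra
    also have "\<dots> = 0" unfolding subst by Groebner_Basis.algebra
    finally show "eval2_by (\<lambda>c. c) (g_iii (59 * r)) z y = 0" using w(1) by simp
    have "(x * eval2_by (\<lambda>c. c) ?U z y - eval2_by (\<lambda>c. c) ?W z y) * w^12
      = x * (18816 * r * (-25 * r * (z * w)^2 - w^2)^5 * (r * (z * w)^2 - 1/2 * w^2))
        - (86064 * r * (w^2)^6 - 9758420 * r^2 * (z * w)^2 * (w^2)^5 - 503524 * r * (z * w) *
           (y * w^3) * (w^2)^4 + 5488 * (y * w^3)^2 * (w^2)^3 - 517272625 * r^3 * (z * w)^4 *
           (w^2)^4 + 11184625 * r^2 * (z * w)^3 * (y * w^3) * (w^2)^3 - 324135 * r * (z * w)^2 *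
           (y * w^3)^2 * (w^2)^2 - 24353 * (z * w) * (y * w^3)^3 * (w^2) + 8914643750 * r^4 *
           (z * w)^6 * (w^2)^3 - 64972500 * r^3 * (z * w)^5 * (y * w^3) * (w^2)^2 - 26039250 *
           r^2 * (z * w)^4 * (y * w^3)^2 * (w^2) + 548800 * r * (z * w)^3 * (y * w^3)^3 -
           41077812500 * r^5 * (z * w)^8 * (w^2)^2 - 2659187500 * r^4 * (z * w)^7 * (y * w^3) *
           (w^2) + 441025000 * r^3 * (z * w)^6 * (y * w^3)^2 + 23859375000 * r^6 * (z * w)^10 *
           (w^2) - 6425000000 * r^5 * (z * w)^9 * (y * w^3) + 167/196 * (18816 * r * (-25 * r *
           (z * w)^2 - w^2)^5 * (r * (z * w)^2 - 1/2 * w^2)))"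
      unfolding ident.eval2_by_simps by Groebner_Basis.algebra
    also have "\<dots> = 0" unfolding subst by Groebner_Basis.algebra
    finally show "x * eval2_by (\<lambda>c. c) ?U z y = eval2_by (\<lambda>c. c) ?W z y" using w(1) by simp
  next
    show "weight_le 0 1 4 (g_iii (59 * r))"
      unfolding g_iii_def by (rule weight_intros order_refl | simp)+
    show "Polynomial.coeff (g_iii (59 * r)) 4 = 1"
      unfolding g_iii_def by (simp add: coeff_y_simps)
    show "eval2_by (\<lambda>c. c) ?U 0 y \<noteq> 0" for y
      unfolding ident.eval2_by_simps using r by simp
  qed (use r in simp_all)
qed

lemma genus_iv:
  assumes r: "r \<noteq> 0"
  shows "curve_genus (g_iv (311 * r)) 1"
proof -
  let ?Q = "[:1, 20, 1:]" and ?f = "[:1, -68, 24, 13, 1:]"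
    and ?N = "[:484, 67056, -420420, -132880, -46200, -7788, -407:]"
  \<comment> \<open>The equilibria are the zeros of \<open>(121 a + 1) (a + 1)\<close> with
    \<open>a = r z^2\<close>; only the first pair enters the denominator.\<close>
  let ?U = "cst (225 * r) * (cst (-121 * r) * Z^2 - 1)^6"
  let ?W = "cst (37725 * r) - cst (28493927 * r^2) * Z^2 - cst (223168 * r) * Z * Y + cst (400)
            * Y^2 - cst (5710546358 * r^3) * Z^4 + cst (46521112 * r^2) * Z^3 * Y -
            cst (226512 * r) * Z^2 * Y^2 - cst (2112) * Z * Y^3 + cst (777520407290 * r^4) * Z^6
            + cst (715066440 * r^3) * Z^5 * Y - cst (63249120 * r^2) * Z^4 * Y^2 +
            cst (425920 * r) * Z^3 * Y^3 - cst (1846701759815 * r^5) * Z^8 -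
            cst (209681959960 * r^4) * Z^7 * Y + cst (7936593280 * r^3) * Z^6 * Y^2 +
            cst (226304029643725 * r^6) * Z^10 - cst (5187484920200 * r^5) * Z^9 * Y -
            cst (29/3) * ?U"
  show ?thesis
  proof (rule curve_genus_one_criterion[where f = ?f and N = ?N
      and \<alpha> = "-121 * r" and \<beta> = "-121/4 * r^2" and c = "1" and b = "20" and a = "1"
      and l = "172062" and k = "-1089" and U = ?U and W = ?W])
    show "simple_roots ?f"
    proof (rule simple_roots_bezout)
      show "([:-217, -152, -16:] :: complex poly) * ?f
          + [:-164, 99, 51, 4:] * pderiv ?f = [:10935:]"
        by (simp add: pderiv_pCons)
    qed (use r in simp_all)
  next
    fix x :: complex
    assume "poly ?Q x = 0"
    then have Q: "x^2 + 20 * x + 1 = 0"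
      unfolding poly_pCons poly_0 by Groebner_Basis.algebra
    have f: "poly ?f x = - 3321 * x - 162"
      unfolding poly_pCons poly_0 using Q by Groebner_Basis.algebra
    have N: "poly ?N x = 375866568 * x + 18836631"
      unfolding poly_pCons poly_0 using Q by Groebner_Basis.algebra
    have eqf: "3645 - (- 3321 * x - 162) * (41 * x + 818) = 0"
      using Q by Groebner_Basis.algebra
    have f0: "poly ?f x \<noteq> 0"
    proof
      assume z: "poly ?f x = 0"
      show False using eqf r unfolding f[symmetric] z by simp
    qed
    have eql: "30628125 - (172062 + -1089 * x) * (x + 178) = 0"
      using Q by Groebner_Basis.algebra
    have l0: "172062 + -1089 * x \<noteq> 0"
    proof
      assume z: "172062 + -1089 * x = 0"
      show False using eql r unfolding z by simp
    qed
    have "(375866568 * x + 18836631)^2 = (- 3321 * x - 162)^3 * (172062 + -1089 * x)"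
      using Q by Groebner_Basis.algebra
    then show "poly ?f x \<noteq> 0 \<and> 172062 + -1089 * x \<noteq> 0
        \<and> poly ?N x ^ 2 = poly ?f x ^ 3 * (172062 + -1089 * x)"
      using f0 l0 unfolding f N by blast
  next
    fix x w z y :: complex
    assume w: "w \<noteq> 0" "w ^ 2 = -121 * r * poly ?f x"
      and zy: "z * w = poly ?Q x" "y * w ^ 3 = -121/4 * r^2 * poly ?N x"
    note subst = w(2)[unfolded poly_pCons poly_0] zy[unfolded poly_pCons poly_0]
    have "eval2_by (\<lambda>c. c) (g_iv (311 * r)) z y * w^12
      = 2278125/256 * r^2 * (w^2)^6 + 189 * r * (y * w^3)^2 * (w^2)^3 + (y * w^3)^4 - 689337/64
        * r^2 * (z * w) * (y * w^3) * (w^2)^4 - 110 * r * (z * w) * (y * w^3)^3 * (w^2) +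
        214383807/128 * r^3 * (z * w)^2 * (w^2)^5 + 298023/16 * r^2 * (z * w)^2 * (y * w^3)^2 *
        (w^2)^2 + 23645215/16 * r^3 * (z * w)^3 * (y * w^3) * (w^2)^3 + 73205/4 * r^2 *
        (z * w)^3 * (y * w^3)^3 - 29164418129/256 * r^4 * (z * w)^4 * (w^2)^4 - 12078825/8 * r^3
        * (z * w)^4 * (y * w^3)^2 * (w^2) + 611188545/32 * r^4 * (z * w)^5 * (y * w^3) * (w^2)^2
        - 69082021195/64 * r^5 * (z * w)^6 * (w^2)^3 - 292307565/16 * r^4 * (z * w)^6 *
        (y * w^3)^2 + 16076916075/16 * r^5 * (z * w)^7 * (y * w^3) * (w^2) - 10221703240485/256
        * r^6 * (z * w)^8 * (w^2)^2 - 648435615025/64 * r^6 * (z * w)^9 * (y * w^3) +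
        35663958826375/128 * r^7 * (z * w)^10 * (w^2) + 78460709418025/256 * r^8 * (z * w)^12"
      unfolding g_iv_def ident.eval2_by_simps by Groebner_Basis.algebra
    also have "\<dots> = 0" unfolding subst by Groebner_Basis.algebra
    finally show "eval2_by (\<lambda>c. c) (g_iv (311 * r)) z y = 0" using w(1) by simp
    have "(x * eval2_by (\<lambda>c. c) ?U z y - eval2_by (\<lambda>c. c) ?W z y) * w^12
      = x * (225 * r * (-121 * r * (z * w)^2 - w^2)^6)
        - (37725 * r * (w^2)^6 - 28493927 * r^2 * (z * w)^2 * (w^2)^5 - 223168 * r * (z * w) *
           (y * w^3) * (w^2)^4 + 400 * (y * w^3)^2 * (w^2)^3 - 5710546358 * r^3 * (z * w)^4 *
           (w^2)^4 + 46521112 * r^2 * (z * w)^3 * (y * w^3) * (w^2)^3 - 226512 * r * (z * w)^2 *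
           (y * w^3)^2 * (w^2)^2 - 2112 * (z * w) * (y * w^3)^3 * (w^2) + 777520407290 * r^4 *
           (z * w)^6 * (w^2)^3 + 715066440 * r^3 * (z * w)^5 * (y * w^3) * (w^2)^2 - 63249120 *
           r^2 * (z * w)^4 * (y * w^3)^2 * (w^2) + 425920 * r * (z * w)^3 * (y * w^3)^3 -
           1846701759815 * r^5 * (z * w)^8 * (w^2)^2 - 209681959960 * r^4 * (z * w)^7 *
           (y * w^3) * (w^2) + 7936593280 * r^3 * (z * w)^6 * (y * w^3)^2 + 226304029643725 *
           r^6 * (z * w)^10 * (w^2) - 5187484920200 * r^5 * (z * w)^9 * (y * w^3) - 29/3 * (225
           * r * (-121 * r * (z * w)^2 - w^2)^6))"
      unfolding ident.eval2_by_simps by Groebner_Basis.algebra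
    also have "\<dots> = 0" unfolding subst by Groebner_Basis.algebra
    finally show "x * eval2_by (\<lambda>c. c) ?U z y = eval2_by (\<lambda>c. c) ?W z y" using w(1) by simp
  next
    show "weight_le 0 1 4 (g_iv (311 * r))"
      unfolding g_iv_def by (rule weight_intros order_refl | simp)+
    show "Polynomial.coeff (g_iv (311 * r)) 4 = 1"
      unfolding g_iv_def by (simp add: coeff_y_simps)
    show "eval2_by (\<lambda>c. c) ?U 0 y \<noteq> 0" for y
      unfolding ident.eval2_by_simps using r by simp
  qed (use r in simp_all)
qed

lemma genus_v:
  assumes r: "r \<noteq> 0"
  shows "curve_genus (g_v (107 * r)) 1"
proof -
  let ?Q = "[:3, -12, 1:]" and ?f = "[:9, 36, 6, 24, 1:]"
    and ?N = "[:3267, -3564, -19305, -38808, -11583, -2244, 121:]"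
  \<comment> \<open>The equilibria are the zeros of \<open>(121 a + 1) (23 a - 1)\<close> with
    \<open>a = r z^2\<close>; the first pair alone enters the denominator.\<close>
  let ?U = "cst (3 * r) * (cst (-121 * r) * Z^2 - 1)^3"
  let ?W = "- cst (4 * r) + cst (46948 * r^2) * Z^2 - cst (880 * r) * Z * Y + cst (4) * Y^2 -
            cst (1346972 * r^3) * Z^4 + cst (10648 * r^2) * Z^3 * Y - cst (4/3) * ?U"
  show ?thesis
  proof (rule curve_genus_one_criterion[where f = ?f and N = ?N
      and \<alpha> = "-121 * r" and \<beta> = "-121 * r^2" and c = "3" and b = "-12" and a = "1"
      and l = "0" and k = "363/4" and U = ?U and W = ?W])
    show "simple_roots ?f"
    proof (rule simple_roots_bezout)
      show "([:384, -2336, -132:] :: complex poly) * ?f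
          + [:771, -57, 782, 33:] * pderiv ?f = [:31212:]"
        by (simp add: pderiv_pCons)
    qed (use r in simp_all)
  next
    fix x :: complex
    assume "poly ?Q x = 0"
    then have Q: "x^2 - 12 * x + 3 = 0"
      unfolding poly_pCons poly_0 by Groebner_Basis.algebra
    have f: "poly ?f x = 5148 * x - 1296"
      unfolding poly_pCons poly_0 using Q by Groebner_Basis.algebra
    have N: "poly ?N x = - 40893336 * x + 10446084"
      unfolding poly_pCons poly_0 using Q by Groebner_Basis.algebra
    have eqf: "31212 - (5148 * x - 1296) * (- 143 * x + 1680) = 0"
      using Q by Groebner_Basis.algebra
    have f0: "poly ?f x \<noteq> 0"
    proof
      assume z: "poly ?f x = 0"
      show False using eqf r unfolding f[symmetric] z by simp
    qed
    have eql: "1089 - (0 + 363/4 * x) * (- 4 * x + 48) = 0"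
      using Q by Groebner_Basis.algebra
    have l0: "0 + 363/4 * x \<noteq> 0"
    proof
      assume z: "0 + 363/4 * x = 0"
      show False using eql r unfolding z by simp
    qed
    have "(- 40893336 * x + 10446084)^2 = (5148 * x - 1296)^3 * (0 + 363/4 * x)"
      using Q by Groebner_Basis.algebra
    then show "poly ?f x \<noteq> 0 \<and> 0 + 363/4 * x \<noteq> 0
        \<and> poly ?N x ^ 2 = poly ?f x ^ 3 * (0 + 363/4 * x)"
      using f0 l0 unfolding f N by blast
  next
    fix x w z y :: complex
    assume w: "w \<noteq> 0" "w ^ 2 = -121 * r * poly ?f x"
      and zy: "z * w = poly ?Q x" "y * w ^ 3 = -121 * r^2 * poly ?N x"
    note subst = w(2)[unfolded poly_pCons poly_0] zy[unfolded poly_pCons poly_0]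
    have "eval2_by (\<lambda>c. c) (g_v (107 * r)) z y * w^12
      = 27/16 * r^2 * (w^2)^6 + 9 * r * (y * w^3)^2 * (w^2)^3 + (y * w^3)^4 - 7623/4 * r^2 *
        (z * w) * (y * w^3) * (w^2)^4 - 374 * r * (z * w) * (y * w^3)^3 * (w^2) + 815661/8 * r^3
        * (z * w)^2 * (w^2)^5 + 54087 * r^2 * (z * w)^2 * (y * w^3)^2 * (w^2)^2 - 3587045 * r^3
        * (z * w)^3 * (y * w^3) * (w^2)^3 + 13310 * r^2 * (z * w)^3 * (y * w^3)^3 +
        1471610833/16 * r^4 * (z * w)^4 * (w^2)^4 - 3733455 * r^3 * (z * w)^4 * (y * w^3)^2 *
        (w^2) + 706852839/2 * r^4 * (z * w)^5 * (y * w^3) * (w^2)^2 - 45176577061/4 * r^5 *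
        (z * w)^6 * (w^2)^3 + 58461513 * r^4 * (z * w)^6 * (y * w^3)^2 - 10932302931 * r^5 *
        (z * w)^7 * (y * w^3) * (w^2) + 8241027180045/16 * r^6 * (z * w)^8 * (w^2)^2 +
        440936218217/4 * r^6 * (z * w)^9 * (y * w^3) - 82455072806579/8 * r^7 * (z * w)^10 *
        (w^2) + 1227125495297911/16 * r^8 * (z * w)^12"
      unfolding g_v_def ident.eval2_by_simps by Groebner_Basis.algebra
    also have "\<dots> = 0" unfolding subst by Groebner_Basis.algebra
    finally show "eval2_by (\<lambda>c. c) (g_v (107 * r)) z y = 0" using w(1) by simp
    have "(x * eval2_by (\<lambda>c. c) ?U z y - eval2_by (\<lambda>c. c) ?W z y) * w^6
      = x * (3 * r * (-121 * r * (z * w)^2 - w^2)^3)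
        - (- 4 * r * (w^2)^3 + 46948 * r^2 * (z * w)^2 * (w^2)^2 - 880 * r * (z * w) * (y * w^3)
           * (w^2) + 4 * (y * w^3)^2 - 1346972 * r^3 * (z * w)^4 * (w^2) + 10648 * r^2 *
           (z * w)^3 * (y * w^3) - 4/3 * (3 * r * (-121 * r * (z * w)^2 - w^2)^3))"
      unfolding ident.eval2_by_simps by Groebner_Basis.algebra
    also have "\<dots> = 0" unfolding subst by Groebner_Basis.algebra
    finally show "x * eval2_by (\<lambda>c. c) ?U z y = eval2_by (\<lambda>c. c) ?W z y" using w(1) by simp
  next
    show "weight_le 0 1 4 (g_v (107 * r))"
      unfolding g_v_def by (rule weight_intros order_refl | simp)+
    show "Polynomial.coeff (g_v (107 * r)) 4 = 1"
      unfolding g_v_def by (simp add: coeff_y_simps)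
    show "eval2_by (\<lambda>c. c) ?U 0 y \<noteq> 0" for y
      unfolding ident.eval2_by_simps using r by simp
  qed (use r in simp_all)
qed

text \<open>In the parameter \<open>P\<close> the two excluded cases are \<open>P = 0\<close> and
  \<open>9 P + 16 = 0\<close>, exactly those in which \<open>f\<close> acquires a multiple root; the
  Bezout constant \<open>2 P^3 (9 P + 16)\<close> reflects this.\<close>

lemma genus_vi:
  assumes q: "q \<noteq> 0" and P: "P \<noteq> 0" "9 * P + 16 \<noteq> 0"
  shows "curve_genus (g_vi ((P + 2) * q^2) q) 1"
proof -
  let ?Q = "[:P, 0, 1:]" and ?f = "[:-1 * P^2, 0, -6 * P, 6 * P, 3:]"
    and ?N = "[:-1 * P^3, 0, -3 * P^2, -6 * P^2, -27 * P, 18 * P, -9 - 9 * P:]"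
  \<comment> \<open>With \<open>a = q z^2\<close> the equilibria are the zeros of
    \<open>(a - 1) (a + 3)\<close>, independently of \<open>P\<close>.\<close>
  let ?U = "cst q * (cst q * Z^2 - 1)^4 * (cst q * Z^2 + cst 3)"
  let ?W = "- cst ((32 + 18 * P) * q) + cst ((112 + 72 * P) * q^2) * Z^2 - cst (40 * q) * Z * Y
            - cst (24) * Y^2 - cst ((168 + 60 * P) * q^3) * Z^4 + cst ((72 + 48 * P) * q^2) *
            Z^3 * Y + cst (144 * q) * Z^2 * Y^2 + cst (96) * Z * Y^3 +
            cst ((128 + 72 * P) * q^4) * Z^6 + cst ((168 + 96 * P) * q^3) * Z^5 * Y +
            cst ((168 + 96 * P) * q^2) * Z^4 * Y^2 + cst ((56 + 30 * P) * q^5) * Z^8 +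
            cst ((88 + 48 * P) * q^4) * Z^7 * Y + cst (6 * P + 12) * ?U"
  show ?thesis
  proof (rule curve_genus_one_criterion[where f = ?f and N = ?N
      and \<alpha> = "1/3 * q" and \<beta> = "1/9 * q^2" and c = "P" and b = "0" and a = "1"
      and l = "1/2" and k = "-3/8" and U = ?U and W = ?W])
    show "simple_roots ?f"
    proof (rule simple_roots_bezout)
      show "([:-32 * P - 18 * P^2, 24 * P, 24:] :: complex poly) * ?f
          + [:-2 * P^2, 14 * P + 6 * P^2, -9 * P, -6:] * pderiv ?f = [:2 * P^3 * (9 * P + 16):]"
        by (simp add: pderiv_pCons algebra_simps power_numeral_reduce)
    qed (use q P in simp_all)
  next
    fix x :: complex
    assume "poly ?Q x = 0"
    then have Q: "x^2 + P = 0"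
      unfolding poly_pCons poly_0 by Groebner_Basis.algebra
    have f: "poly ?f x = - 6 * P^2 * x + 8 * P^2"
      unfolding poly_pCons poly_0 using Q by Groebner_Basis.algebra
    have N: "poly ?N x = 24 * P^3 * x + (-16 * P^3 + 9 * P^4)"
      unfolding poly_pCons poly_0 using Q by Groebner_Basis.algebra
    have eqf: "2 * P^2 * (9 * P + 16) - (- 6 * P^2 * x + 8 * P^2) * (3 * x + 4) = 0"
      using Q by Groebner_Basis.algebra
    have f0: "poly ?f x \<noteq> 0"
    proof
      assume z: "poly ?f x = 0"
      show False using eqf q P unfolding f[symmetric] z by simp
    qed
    have eql: "(9 * P + 16) - (1/2 + -3/8 * x) * (24 * x + 32) = 0"
      using Q by Groebner_Basis.algebra
    have l0: "1/2 + -3/8 * x \<noteq> 0"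
    proof
      assume z: "1/2 + -3/8 * x = 0"
      show False using eql q P unfolding z by simp
    qed
    have "(24 * P^3 * x + (-16 * P^3 + 9 * P^4))^2 = (- 6 * P^2 * x + 8 * P^2)^3 * (1/2 + -3/8 * x)"
      using Q by Groebner_Basis.algebra
    then show "poly ?f x \<noteq> 0 \<and> 1/2 + -3/8 * x \<noteq> 0
        \<and> poly ?N x ^ 2 = poly ?f x ^ 3 * (1/2 + -3/8 * x)"
      using f0 l0 unfolding f N by blast
  next
    fix x w z y :: complex
    assume w: "w \<noteq> 0" "w ^ 2 = 1/3 * q * poly ?f x"
      and zy: "z * w = poly ?Q x" "y * w ^ 3 = 1/9 * q^2 * poly ?N x"
    note subst = w(2)[unfolded poly_pCons poly_0] zy[unfolded poly_pCons poly_0]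
    have "eval2_by (\<lambda>c. c) (g_vi ((P + 2) * q^2) q) z y * w^12
      = (1/36 + 1/64 * P) * q^2 * (w^2)^6 - 1/3 * q * (y * w^3)^2 * (w^2)^3 + (y * w^3)^4 +
        (-1/3 + 3/16 * P) * q^2 * (z * w) * (y * w^3) * (w^2)^4 + 2 * q * (z * w) * (y * w^3)^3
        * (w^2) + (-1/6 + 3/32 * P) * q^3 * (z * w)^2 * (w^2)^5 + (2 + 3/4 * P) * q^2 *
        (z * w)^2 * (y * w^3)^2 * (w^2)^2 + (2/3 + 3/4 * P) * q^3 * (z * w)^3 * (y * w^3) *
        (w^2)^3 + (2 + P) * q^2 * (z * w)^3 * (y * w^3)^3 + (1/12 + 15/64 * P) * q^4 * (z * w)^4
        * (w^2)^4 + (3 + 3/2 * P) * q^3 * (z * w)^4 * (y * w^3)^2 * (w^2) + (2 + 9/8 * P) * q^4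
        * (z * w)^5 * (y * w^3) * (w^2)^2 + (4/9 + 5/16 * P) * q^5 * (z * w)^6 * (w^2)^3 +
        (4/3 + 3/4 * P) * q^4 * (z * w)^6 * (y * w^3)^2 + (4/3 + 3/4 * P) * q^5 * (z * w)^7 *
        (y * w^3) * (w^2) + (5/12 + 15/64 * P) * q^6 * (z * w)^8 * (w^2)^2 + (1/3 + 3/16 * P) *
        q^6 * (z * w)^9 * (y * w^3) + (1/6 + 3/32 * P) * q^7 * (z * w)^10 * (w^2) +
        (1/36 + 1/64 * P) * q^8 * (z * w)^12"
      unfolding g_vi_def ident.eval2_by_simps by Groebner_Basis.algebra
    also have "\<dots> = 0" unfolding subst by Groebner_Basis.algebra
    finally show "eval2_by (\<lambda>c. c) (g_vi ((P + 2) * q^2) q) z y = 0" using w(1) by simp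
    have "(x * eval2_by (\<lambda>c. c) ?U z y - eval2_by (\<lambda>c. c) ?W z y) * w^10
      = x * (q * (q * (z * w)^2 - w^2)^4 * (q * (z * w)^2 + 3 * w^2))
        - (- (32 + 18 * P) * q * (w^2)^5 + (112 + 72 * P) * q^2 * (z * w)^2 * (w^2)^4 - 40 * q *
           (z * w) * (y * w^3) * (w^2)^3 - 24 * (y * w^3)^2 * (w^2)^2 - (168 + 60 * P) * q^3 *
           (z * w)^4 * (w^2)^3 + (72 + 48 * P) * q^2 * (z * w)^3 * (y * w^3) * (w^2)^2 + 144 * q
           * (z * w)^2 * (y * w^3)^2 * (w^2) + 96 * (z * w) * (y * w^3)^3 + (128 + 72 * P) * q^4
           * (z * w)^6 * (w^2)^2 + (168 + 96 * P) * q^3 * (z * w)^5 * (y * w^3) * (w^2) +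
           (168 + 96 * P) * q^2 * (z * w)^4 * (y * w^3)^2 + (56 + 30 * P) * q^5 * (z * w)^8 *
           (w^2) + (88 + 48 * P) * q^4 * (z * w)^7 * (y * w^3) + (6 * P + 12) * (q * (q *
           (z * w)^2 - w^2)^4 * (q * (z * w)^2 + 3 * w^2)))"
      unfolding ident.eval2_by_simps by Groebner_Basis.algebra
    also have "\<dots> = 0" unfolding subst by Groebner_Basis.algebra
    finally show "x * eval2_by (\<lambda>c. c) ?U z y = eval2_by (\<lambda>c. c) ?W z y" using w(1) by simp
  next
    show "weight_le 0 1 4 (g_vi ((P + 2) * q^2) q)"
      unfolding g_vi_def by (rule weight_intros order_refl | simp)+
    show "Polynomial.coeff (g_vi ((P + 2) * q^2) q) 4 = 1"
      unfolding g_vi_def by (simp add: coeff_y_simps)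
    show "eval2_by (\<lambda>c. c) ?U 0 y \<noteq> 0" for y
      unfolding ident.eval2_by_simps using q by simp
  qed (use q P in simp_all)
qed

theorem corollary2:
  fixes p q :: complex
  shows
    "(let P = Z * Y + 1;
          Q = cst 3 * Y^2 + cst p * Z * Y + cst (- p * q - 2 * p^2) * Z^2 + cst q
      in quadratic_system P Q \<and> invariant_curve P Q (g_i p q) (cst 12 * Y)) \<and>
     (p \<noteq> 0 \<and> q + 2 * p \<noteq> 0 \<longrightarrow> total_degree (g_i p q) = 12 \<and> curve_genus (g_i p q) 0) \<and>

     (let P = Z * Y + 1;
          Q = cst 3 * Y^2 - cst (35/19 * q) * Z * Y - cst (525/361 * q^2) * Z^2 + cst q
      in quadratic_system P Q \<and> invariant_curve P Q (g_ii q) (cst 12 * Y)) \<and>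
     (q \<noteq> 0 \<longrightarrow> total_degree (g_ii q) = 12 \<and> curve_genus (g_ii q) 1) \<and>

     (let P = Z * Y + 1;
          Q = cst 3 * Y^2 - cst (10/59 * q) * Z * Y - cst (150/3481 * q^2) * Z^2 + cst q
      in quadratic_system P Q \<and> invariant_curve P Q (g_iii q) (cst 12 * Y)) \<and>
     (q \<noteq> 0 \<longrightarrow> total_degree (g_iii q) = 12 \<and> curve_genus (g_iii q) 1) \<and>

     (let P = Z * Y + 1;
          Q = cst 3 * Y^2 - cst (55/311 * q) * Z * Y + cst (363/96721 * q^2) * Z^2 + cst q
      in quadratic_system P Q \<and> invariant_curve P Q (g_iv q) (cst 12 * Y)) \<and>
     (q \<noteq> 0 \<longrightarrow> total_degree (g_iv q) = 12 \<and> curve_genus (g_iv q) 1) \<and>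

     (let P = Z * Y + 1;
          Q = cst 3 * Y^2 - cst (187/107 * q) * Z * Y - cst (8349/11449 * q^2) * Z^2 + cst q
      in quadratic_system P Q \<and> invariant_curve P Q (g_v q) (cst 12 * Y)) \<and>
     (q \<noteq> 0 \<longrightarrow> total_degree (g_v q) = 12 \<and> curve_genus (g_v q) 1) \<and>

     (let P = Z * Y + 1;
          Q = cst 3 * Y^2 + cst q * Z * Y - cst (q^2) * Z^2 - cst q
      in quadratic_system P Q \<and> invariant_curve P Q (g_vi p q) (cst 12 * Y)) \<and>
     (q \<noteq> 0 \<and> p \<noteq> 2 * q^2 \<and> 9 * p \<noteq> 2 * q^2 \<longrightarrow> total_degree (g_vi p q) = 12 \<and> curve_genus (g_vi p q) 1)"
  unfolding Let_def
proof (intro conjI impI)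
  \<comment> \<open>Writing \<open>q\<close> as 19, 59, 311 or 107 times a parameter clears the
    powers of these primes from the denominators.\<close>
  have ii: "curve_genus (g_ii q) 1" if "q \<noteq> 0" for q using genus_ii[of "q / 19"] that by simp
  have iii: "curve_genus (g_iii q) 1" if "q \<noteq> 0" for q using genus_iii[of "q / 59"] that by simp
  have iv: "curve_genus (g_iv q) 1" if "q \<noteq> 0" for q using genus_iv[of "q / 311"] that by simp
  have v: "curve_genus (g_v q) 1" if "q \<noteq> 0" for q using genus_v[of "q / 107"] that by simp
  \<comment> \<open>\<open>P = p / q^2 - 2\<close> turns \<open>p \<noteq> 2 * q^2\<close> into
    \<open>P \<noteq> 0\<close> and \<open>9 * p \<noteq> 2 * q^2\<close> into
    \<open>9 * P + 16 \<noteq> 0\<close>.\<close>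
  have vi: "curve_genus (g_vi p q) 1" if "q \<noteq> 0" "p \<noteq> 2 * q^2" "9 * p \<noteq> 2 * q^2" for p q
    using genus_vi[of q "p / q^2 - 2"] that by (simp add: field_simps)
  show "p \<noteq> 0 \<and> q + 2 * p \<noteq> 0 \<Longrightarrow> curve_genus (g_i p q) 0" by (simp add: genus_i)
  show "q \<noteq> 0 \<Longrightarrow> curve_genus (g_ii q) 1" by (rule ii)
  show "q \<noteq> 0 \<Longrightarrow> curve_genus (g_iii q) 1" by (rule iii)
  show "q \<noteq> 0 \<Longrightarrow> curve_genus (g_iv q) 1" by (rule iv)
  show "q \<noteq> 0 \<Longrightarrow> curve_genus (g_v q) 1" by (rule v)
  show "q \<noteq> 0 \<and> p \<noteq> 2 * q^2 \<and> 9 * p \<noteq> 2 * q^2 \<Longrightarrow> curve_genus (g_vi p q) 1"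
    using vi by blast
  show "q \<noteq> 0 \<and> p \<noteq> 2 * q^2 \<and> 9 * p \<noteq> 2 * q^2 \<Longrightarrow> total_degree (g_vi p q) = 12"
    by (rule total_degree_vi) simp
qed (rule invariant_i invariant_ii invariant_iii invariant_iv invariant_v invariant_vi
      total_degree_i total_degree_ii total_degree_iii total_degree_iv total_degree_v
      quadratic_system_Z_Y weight_intros order_refl | assumption | simp)+

end
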